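(* Let $\beta\mathbb{N}$ be the Stone-Čech compactification of the discrete space $\mathbb{N}$. The space $C_p(\beta\mathbb{N})$ (1) has a quotient isomorphic to $\ell_\infty$; (2) contains a subspace isomorphic to $c_0$; (3) has no quotient isomorphic to $c_0$; (4) has no Polishable infinite-dimensional quotients; (5) contains no complemented separable infinite-dimensional subspaces.
   Context: For a Tychonoff space $X$, $C_p(X)$ is the space of continuous real-valued functions on $X$ with the topology of pointwise convergence (the subspace topology from $\mathbb{R}^X$). Here $c_0=\{(x_n)_{n\in\mathbb{N}}\in\mathbb{R}^{\mathbb{N}}: x_n\to 0\}$ and $\ell_\infty=\{(x_n)_{n\in\mathbb{N}}\in\mathbb{R}^{\mathbb{N}}:\sup_n|x_n|<\infty\}$ are both endowed with the topology inherited from the product topology of $\mathbb{R}^{\mathbb{N}}$ (not the sup-norm topology). "Isomorphic" means linearly homeomorphic. "Subspace" means linear subspace with the induced topology; it is complemented if it is the range of a continuous linear projection of the whole space. A quotient of $C_p(X)$ is a space $C_p(X)/Z$ with the quotient topology, where $Z$ is a closed linear subspace. A locally convex space is Polishable if it admits a stronger (i.e. finer) separable Fréchet (complete metrizable locally convex) vector space topology. *)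

theory Defs
  imports "HOL-Analysis.Analysis"
begin

section \<open>Real topological vector spaces on carriers\<close>

text \<open>
  The carrier is the \<^const>\<open>topspace\<close> of the topology. A record is used instead of type classes because
  quotients by a linear subspace have carriers depending on that subspace.
\<close>

record 'v tvs =
  vtop :: "'v topology"
  vadd :: "'v \<Rightarrow> 'v \<Rightarrow> 'v"
  vzero :: 'v
  vscale :: "real \<Rightarrow> 'v \<Rightarrow> 'v"

abbreviation vcarrier :: "'v tvs \<Rightarrow> 'v set" where
  "vcarrier E \<equiv> topspace (vtop E)"

definition real_vector_on :: "'v tvs \<Rightarrow> bool" where
  "real_vector_on E \<longleftrightarrow>
     vzero E \<in> vcarrier E \<and>
     (\<forall>x\<in>vcarrier E. \<forall>y\<in>vcarrier E. vadd E x y \<in> vcarrier E) \<and>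
     (\<forall>c. \<forall>x\<in>vcarrier E. vscale E c x \<in> vcarrier E) \<and>
     (\<forall>x\<in>vcarrier E. \<forall>y\<in>vcarrier E. \<forall>z\<in>vcarrier E.
        vadd E (vadd E x y) z = vadd E x (vadd E y z)) \<and>
     (\<forall>x\<in>vcarrier E. \<forall>y\<in>vcarrier E. vadd E x y = vadd E y x) \<and>
     (\<forall>x\<in>vcarrier E. vadd E x (vzero E) = x) \<and>
     (\<forall>x\<in>vcarrier E. \<exists>y\<in>vcarrier E. vadd E x y = vzero E) \<and>
     (\<forall>c. \<forall>x\<in>vcarrier E. \<forall>y\<in>vcarrier E.
        vscale E c (vadd E x y) = vadd E (vscale E c x) (vscale E c y)) \<and>
     (\<forall>c d. \<forall>x\<in>vcarrier E. vscale E (c + d) x = vadd E (vscale E c x) (vscale E d x)) \<and>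
     (\<forall>c d. \<forall>x\<in>vcarrier E. vscale E c (vscale E d x) = vscale E (c * d) x) \<and>
     (\<forall>x\<in>vcarrier E. vscale E 1 x = x)"

definition is_tvs :: "'v tvs \<Rightarrow> bool" where
  "is_tvs E \<longleftrightarrow> real_vector_on E \<and>
     continuous_map (prod_topology (vtop E) (vtop E)) (vtop E) (\<lambda>(x, y). vadd E x y) \<and>
     continuous_map (prod_topology euclideanreal (vtop E)) (vtop E) (\<lambda>(c, x). vscale E c x)"

definition convex_in :: "'v tvs \<Rightarrow> 'v set \<Rightarrow> bool" where
  "convex_in E C \<longleftrightarrow> C \<subseteq> vcarrier E \<and>
     (\<forall>x\<in>C. \<forall>y\<in>C. \<forall>t. 0 \<le> t \<and> t \<le> 1 \<longrightarrow> vadd E (vscale E (1 - t) x) (vscale E t y) \<in> C)"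

definition locally_convex :: "'v tvs \<Rightarrow> bool" where
  "locally_convex E \<longleftrightarrow> is_tvs E \<and> neighbourhood_base_at (vzero E) (convex_in E) (vtop E)"

definition frechet :: "'v tvs \<Rightarrow> bool" where
  "frechet E \<longleftrightarrow> locally_convex E \<and>
     (\<exists>d. Metric_space (vcarrier E) d \<and>
          (\<forall>x\<in>vcarrier E. \<forall>y\<in>vcarrier E. \<forall>z\<in>vcarrier E. d (vadd E x z) (vadd E y z) = d x y) \<and>
          Metric_space.mtopology (vcarrier E) d = vtop E \<and>
          Metric_space.mcomplete (vcarrier E) d)"

definition polishable :: "'v tvs \<Rightarrow> bool" where
  "polishable E \<longleftrightarrow>
     (\<exists>T. topspace T = vcarrier E \<and> (\<forall>U. openin (vtop E) U \<longrightarrow> openin T U) \<and>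
          frechet (E\<lparr>vtop := T\<rparr>) \<and> separable_space T)"

definition linear_subspace :: "'v tvs \<Rightarrow> 'v set \<Rightarrow> bool" where
  "linear_subspace E S \<longleftrightarrow> S \<subseteq> vcarrier E \<and> vzero E \<in> S \<and>
     (\<forall>x\<in>S. \<forall>y\<in>S. vadd E x y \<in> S) \<and> (\<forall>c. \<forall>x\<in>S. vscale E c x \<in> S)"

definition infinite_dimensional :: "'v tvs \<Rightarrow> bool" where
  "infinite_dimensional E \<longleftrightarrow>
     \<not> (\<exists>B. finite B \<and> B \<subseteq> vcarrier E \<and> linear_subspace E hull B = vcarrier E)"

definition linear_map :: "'v tvs \<Rightarrow> 'w tvs \<Rightarrow> ('v \<Rightarrow> 'w) \<Rightarrow> bool" where
  "linear_map E F f \<longleftrightarrow> f ` vcarrier E \<subseteq> vcarrier F \<and>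
     (\<forall>x\<in>vcarrier E. \<forall>y\<in>vcarrier E. f (vadd E x y) = vadd F (f x) (f y)) \<and>
     (\<forall>c. \<forall>x\<in>vcarrier E. f (vscale E c x) = vscale F c (f x))"

definition isomorphic_tvs :: "'v tvs \<Rightarrow> 'w tvs \<Rightarrow> bool" where
  "isomorphic_tvs E F \<longleftrightarrow> (\<exists>f. linear_map E F f \<and> homeomorphic_map (vtop E) (vtop F) f)"

definition subspace_tvs :: "'v tvs \<Rightarrow> 'v set \<Rightarrow> 'v tvs" where
  "subspace_tvs E S = E\<lparr>vtop := subtopology (vtop E) S\<rparr>"

definition complemented_in :: "'v tvs \<Rightarrow> 'v set \<Rightarrow> bool" where
  "complemented_in E S \<longleftrightarrow>
     (\<exists>P. linear_map E E P \<and> continuous_map (vtop E) (vtop E) P \<and>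
          (\<forall>x\<in>vcarrier E. P (P x) = P x) \<and> P ` vcarrier E = S)"

definition vcoset :: "'v tvs \<Rightarrow> 'v set \<Rightarrow> 'v \<Rightarrow> 'v set" where
  "vcoset E Z x = vadd E x ` Z"

definition quotient_topology :: "'a topology \<Rightarrow> ('a \<Rightarrow> 'b) \<Rightarrow> 'b topology" where
  "quotient_topology X q =
     topology (\<lambda>U. U \<subseteq> q ` topspace X \<and> openin X {x \<in> topspace X. q x \<in> U})"

text \<open>
  In the scalar multiplication, \<open>Z\<close> is added again so that \<open>0\<close> times a coset is \<open>Z\<close> and not just the
  singleton of the zero vector.
\<close>

definition quotient_tvs :: "'v tvs \<Rightarrow> 'v set \<Rightarrow> 'v set tvs" where
  "quotient_tvs E Z =
     \<lparr>vtop = quotient_topology (vtop E) (vcoset E Z),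
      vadd = (\<lambda>A B. {vadd E a b |a b. a \<in> A \<and> b \<in> B}),
      vzero = Z,
      vscale = (\<lambda>c A. {vadd E (vscale E c a) z |a z. a \<in> A \<and> z \<in> Z})\<rparr>"

definition closed_linear_subspace :: "'v tvs \<Rightarrow> 'v set \<Rightarrow> bool" where
  "closed_linear_subspace E Z \<longleftrightarrow> linear_subspace E Z \<and> closedin (vtop E) Z"

lemma openin_quotient_topology:
  "openin (quotient_topology X q) U \<longleftrightarrow>
     U \<subseteq> q ` topspace X \<and> openin X {x \<in> topspace X. q x \<in> U}"
proof -
  have "istopology (\<lambda>U. U \<subseteq> q ` topspace X \<and> openin X {x \<in> topspace X. q x \<in> U})"
    unfolding istopology_def
  proof (intro conjI allI impI)
    fix S T
    assume S: "S \<subseteq> q ` topspace X \<and> openin X {x \<in> topspace X. q x \<in> S}"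
      and T: "T \<subseteq> q ` topspace X \<and> openin X {x \<in> topspace X. q x \<in> T}"
    show "S \<inter> T \<subseteq> q ` topspace X"
      using S by blast
    have "{x \<in> topspace X. q x \<in> S \<inter> T} =
        {x \<in> topspace X. q x \<in> S} \<inter> {x \<in> topspace X. q x \<in> T}"
      by blast
    then show "openin X {x \<in> topspace X. q x \<in> S \<inter> T}"
      using S T by (simp only: openin_Int)
  next
    fix K
    assume K: "\<forall>U\<in>K. U \<subseteq> q ` topspace X \<and> openin X {x \<in> topspace X. q x \<in> U}"
    then show "\<Union>K \<subseteq> q ` topspace X"
      by blast
    have "{x \<in> topspace X. q x \<in> \<Union>K} = (\<Union>U\<in>K. {x \<in> topspace X. q x \<in> U})"
      by blast
    then show "openin X {x \<in> topspace X. q x \<in> \<Union>K}"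
      using K by (simp only:) (rule openin_Union, blast)
  qed
  then show ?thesis
    by (simp add: quotient_topology_def)
qed

lemma quotient_map_quotient_topology:
  "quotient_map X (quotient_topology X q) q"
proof -
  have "topspace (quotient_topology X q) = q ` topspace X" (is "?L = ?R")
  proof
    show "?L \<subseteq> ?R"
      using openin_topspace[of "quotient_topology X q"] unfolding openin_quotient_topology by (rule conjunct1)
    have "{x \<in> topspace X. q x \<in> ?R} = topspace X"
      by blast
    then show "?R \<subseteq> ?L"
      by (intro openin_subset) (simp add: openin_quotient_topology)
  qed
  then show ?thesis
    by (simp add: quotient_map_def openin_quotient_topology)
qed

section \<open>Function spaces with the topology of pointwise convergence\<close>

definition real_power :: "'a set \<Rightarrow> ('a \<Rightarrow> real) tvs" where
  "real_power I =
     \<lparr>vtop = product_topology (\<lambda>_. euclideanreal) I,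
      vadd = (\<lambda>f g. \<lambda>i\<in>I. f i + g i),
      vzero = (\<lambda>i\<in>I. 0),
      vscale = (\<lambda>c f. \<lambda>i\<in>I. c * f i)\<rparr>"

definition Cp :: "'a topology \<Rightarrow> ('a \<Rightarrow> real) tvs" where
  "Cp X = subspace_tvs (real_power (topspace X)) {f. continuous_map X euclideanreal f}"

definition c0_space :: "(nat \<Rightarrow> real) tvs" where
  "c0_space = subspace_tvs (real_power UNIV) {x. x \<longlonglongrightarrow> 0}"

definition linf_space :: "(nat \<Rightarrow> real) tvs" where
  "linf_space = subspace_tvs (real_power UNIV) {x. bounded (range x)}"

section \<open>The Stone-Cech compactification\<close>

text \<open>
  The closure of the canonical image of the space in the cube indexed by all continuous functions
  into the unit interval. Functions are taken extensional, so that every continuous function is counted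
  exactly once.
\<close>

definition unit_interval_maps :: "'a topology \<Rightarrow> ('a \<Rightarrow> real) set" where
  "unit_interval_maps X =
     {f \<in> extensional (topspace X). continuous_map X (top_of_set {0..1}) f}"

definition stone_cech_cube :: "'a topology \<Rightarrow> (('a \<Rightarrow> real) \<Rightarrow> real) topology" where
  "stone_cech_cube X = product_topology (\<lambda>_. top_of_set {0..1}) (unit_interval_maps X)"

definition stone_cech_map :: "'a topology \<Rightarrow> 'a \<Rightarrow> ('a \<Rightarrow> real) \<Rightarrow> real" where
  "stone_cech_map X x = (\<lambda>f\<in>unit_interval_maps X. f x)"

definition stone_cech :: "'a topology \<Rightarrow> (('a \<Rightarrow> real) \<Rightarrow> real) topology" where
  "stone_cech X =
     subtopology (stone_cech_cube X)
       (stone_cech_cube X closure_of (stone_cech_map X ` topspace X))"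

definition beta_nat :: "((nat \<Rightarrow> real) \<Rightarrow> real) topology" where
  "beta_nat = stone_cech (discrete_topology UNIV)"

lemma compact_space_stone_cech: "compact_space (stone_cech X)"
proof -
  have "compact_space (stone_cech_cube X)"
    by (simp add: stone_cech_cube_def compact_space_product_topology compact_space_subtopology)
  then show ?thesis
    by (simp add: stone_cech_def closedin_compact_space compact_space_subtopology)
qed

lemma Hausdorff_space_stone_cech: "Hausdorff_space (stone_cech X)"
  by (simp add: stone_cech_def stone_cech_cube_def Hausdorff_space_subtopology
      Hausdorff_space_product_topology)

lemma stone_cech_extension:
  assumes "f \<in> unit_interval_maps X"
  shows "continuous_map (stone_cech X) (top_of_set {0..1}) (\<lambda>p. p f)"
    and "x \<in> topspace X \<Longrightarrow> stone_cech_map X x f = f x"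
proof -
  show "continuous_map (stone_cech X) (top_of_set {0..1}) (\<lambda>p. p f)"
    unfolding stone_cech_def stone_cech_cube_def
    by (intro continuous_map_from_subtopology
        continuous_map_product_projection[where X = "\<lambda>_. top_of_set {0..1}"] assms)
  show "x \<in> topspace X \<Longrightarrow> stone_cech_map X x f = f x"
    using assms by (simp add: stone_cech_map_def)
qed

end

theory Submission
  imports Defs "HOL-Complex_Analysis.Great_Picard"
begin

text \<open>
  The dual of \<open>C\<^sub>p(X)\<close> consists of the finitely supported signed measures on \<open>X\<close>, and everything below is
  about these measures on \<open>\<beta>\<nat>\<close>. Points of \<open>\<beta>\<nat>\<close> are ultrafilters, so that a set \<open>A \<subseteq> \<nat>\<close> gives a clopen set
  \<open>beta_hat A\<close>, and each such measure is a finitely additive measure on all subsets of \<open>\<nat>\<close>.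

  The negative statements rest on a theorem in the spirit of Grothendieck, Phillips and Schur
  (\<open>setwise_null_imp_norm_null\<close>): a bounded sequence of such measures that tends to zero on every
  \<open>beta_hat A\<close> tends to zero in variation. If the variation is concentrated on finite sets up
  to arbitrarily small errors, it suffices to separate the points of such a finite set. If it is not, there are
  disjoint sets \<open>U\<^sub>0, U\<^sub>1, \<dots> \<subseteq> \<nat>\<close>, each of a large mass for one measure of a subsequence. A
  union of a subsequence of the \<open>U\<^sub>t\<close> is again a subset of \<open>\<nat>\<close>, and a finitely supported measure
  misses such a union if the subsequence is well chosen; this gives one set on which the measures do not tend to zero.

  The coordinates of a continuous linear map into \<open>c\<^sub>0\<close> are such measures and tend to zero on \<open>C(\<beta>\<nat>)\<close>, hence in norm; so the
  images tend to zero at a rate that depends on the map only, and the map is not onto.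

  For the other two negative statements let \<open>M\<close> be a linear space of measures, and suppose that every sequence
  in its unit ball has a subsequence that converges on every \<open>beta_hat A\<close>. Then the unit ball of \<open>M\<close> has a finite
  \<open>1/2\<close>-net \<open>F\<close>, because differences of a separated sequence contradict the theorem; and on the common kernel of
  \<open>F\<close> the supremum of \<open>\<bar>\<mu>(f)\<bar>\<close> over the unit ball is at most half of itself. Thus \<open>F\<close> and \<open>M\<close> have the same kernel
  (\<open>finitely_determined_annihilator\<close>), which therefore has finite codimension. For a quotient by \<open>Z\<close> take for \<open>M\<close> the
  annihilator of \<open>Z\<close>: if the quotient is Polishable, then Baire's theorem makes the unit ball of \<open>M\<close>
  equicontinuous for the finer topology, and a diagonal sequence over a countable dense set converges
  everywhere. For a projection \<open>P\<close> onto a separable subspace \<open>S\<close> take for \<open>M\<close> the measures \<open>\<mu>\<close> with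
  \<open>\<mu> \<circ> P = \<mu>\<close>: by compactness a pointwise separable \<open>S\<close> is even uniformly separable, and a diagonal sequence
  converges again.

  For the positive statements, \<open>c\<^sub>0\<close> consists of the restrictions to \<open>\<nat>\<close> of the functions that vanish on
  \<open>\<beta>\<nat> - \<nat>\<close>, and the quotient \<open>\<ell>\<^sub>\<infinity>\<close> comes from the functionals \<open>f \<mapsto> (\<Sum>i\<le>n. f(n, i) / 2^i)\<close> on
  \<open>\<nat> \<times> \<nat> \<cong> \<nat>\<close>. Restriction to \<open>\<nat>\<close> itself would not be open onto its range; here a value can be prescribed by
  changing \<open>f\<close> on a single column, and some column stays away from any finitely many points of \<open>\<beta>\<nat>\<close>.
\<close>

section \<open>Finitely supported signed measures\<close>

lemma disjoint_family_on_unique: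
  "disjoint_family_on A I \<Longrightarrow> i \<in> I \<Longrightarrow> j \<in> I \<Longrightarrow> x \<in> A i \<Longrightarrow> x \<in> A j \<Longrightarrow> i = j"
  by (metis IntI disjoint_family_onD empty_iff)

lemma disjoint_family_on_uniqueI:
  "(\<And>i j x. i \<in> I \<Longrightarrow> j \<in> I \<Longrightarrow> x \<in> A i \<Longrightarrow> x \<in> A j \<Longrightarrow> i = j) \<Longrightarrow> disjoint_family_on A I"
  by (auto simp: disjoint_family_on_def)

text \<open>
  A finitely supported signed measure is represented by its point masses.
\<close>

definition msupp :: "('p \<Rightarrow> real) \<Rightarrow> 'p set" where
  "msupp a = {p. a p \<noteq> 0}"

definition pairing :: "('p \<Rightarrow> real) \<Rightarrow> ('p \<Rightarrow> real) \<Rightarrow> real" where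
  "pairing a f = (\<Sum>p\<in>msupp a. a p * f p)"

definition mass :: "('p \<Rightarrow> real) \<Rightarrow> 'p set \<Rightarrow> real" where
  "mass a A = (\<Sum>p\<in>msupp a \<inter> A. a p)"

definition variation :: "('p \<Rightarrow> real) \<Rightarrow> 'p set \<Rightarrow> real" where
  "variation a A = mass (\<lambda>p. \<bar>a p\<bar>) A"

lemma msupp_abs [simp]: "msupp (\<lambda>p. \<bar>a p\<bar>) = msupp a"
  by (simp add: msupp_def)

lemma variation_eq: "variation a A = (\<Sum>p\<in>msupp a \<inter> A. \<bar>a p\<bar>)"
  by (simp add: variation_def mass_def)

lemma pairing_eq_sum:
  assumes "finite S" "msupp a \<subseteq> S"
  shows "pairing a f = (\<Sum>p\<in>S. a p * f p)"
  unfolding pairing_def by (rule sum.mono_neutral_left) (use assms in \<open>auto simp: msupp_def\<close>)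

lemma mass_eq_pairing: "finite (msupp a) \<Longrightarrow> mass a A = pairing a (indicator A)"
  unfolding mass_def pairing_def by (simp add: indicator_def sum.If_cases)

lemma mass_Un:
  assumes "finite (msupp a)" "A \<inter> B = {}"
  shows "mass a (A \<union> B) = mass a A + mass a B"
proof -
  have "msupp a \<inter> (A \<union> B) = (msupp a \<inter> A) \<union> (msupp a \<inter> B)" by blast
  then show ?thesis
    unfolding mass_def using assms by (metis (no_types, lifting) finite_Int sum.union_disjoint Int_assoc Int_left_commute Int_empty_right)
qed

lemma mass_empty [simp]: "mass a {} = 0"
  by (simp add: mass_def)

lemma mass_disjoint_support: "msupp a \<inter> A = {} \<Longrightarrow> mass a A = 0"
  by (simp add: mass_def)

lemma mass_UN:
  assumes "finite (msupp a)" "finite J" "disjoint_family_on V J"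
  shows "mass a (\<Union>j\<in>J. V j) = (\<Sum>j\<in>J. mass a (V j))"
  using assms(2,3)
proof (induction J)
  case (insert j J)
  then have "V j \<inter> (\<Union>j\<in>J. V j) = {}"
    by (fastforce simp: disjoint_family_on_def)
  moreover have "disjoint_family_on V J"
    using insert.prems by (auto simp: disjoint_family_on_def)
  ultimately show ?case
    using insert assms(1) by (simp add: mass_Un)
qed auto

lemmas variation_Un = mass_Un[of "\<lambda>p. \<bar>a p\<bar>" for a, folded variation_def, simplified]
lemmas variation_UN = mass_UN[of "\<lambda>p. \<bar>a p\<bar>" for a, folded variation_def, simplified]

lemma variation_nonneg: "0 \<le> variation a A"
  by (simp add: variation_eq sum_nonneg)

lemma variation_mono: "finite (msupp a) \<Longrightarrow> msupp a \<inter> A \<subseteq> B \<Longrightarrow> variation a A \<le> variation a B"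
  unfolding variation_eq by (intro sum_mono2) auto

lemma abs_mass_le: "\<bar>mass a A\<bar> \<le> variation a A"
  unfolding variation_eq mass_def by (rule sum_abs)

lemma variation_UNIV_eq_sum:
  assumes "finite S" "msupp a \<subseteq> S"
  shows "variation a UNIV = (\<Sum>p\<in>S. \<bar>a p\<bar>)"
  unfolding variation_eq by (rule sum.mono_neutral_left) (use assms in \<open>auto simp: msupp_def\<close>)

lemma abs_pairing_le:
  assumes "\<And>p. p \<in> msupp a \<Longrightarrow> \<bar>f p\<bar> \<le> K"
  shows "\<bar>pairing a f\<bar> \<le> K * variation a UNIV"
proof -
  have "\<bar>pairing a f\<bar> \<le> (\<Sum>p\<in>msupp a. \<bar>a p * f p\<bar>)"
    unfolding pairing_def by (rule sum_abs)
  also have "\<dots> \<le> (\<Sum>p\<in>msupp a. K * \<bar>a p\<bar>)"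
  proof (rule sum_mono)
    fix p assume "p \<in> msupp a"
    then show "\<bar>a p * f p\<bar> \<le> K * \<bar>a p\<bar>"
      using mult_right_mono[OF assms, of p "\<bar>a p\<bar>"] by (simp add: abs_mult mult.commute)
  qed
  finally show ?thesis by (simp add: variation_eq sum_distrib_left)
qed

lemma msupp_diff: "msupp (\<lambda>p. a p - b p) \<subseteq> msupp a \<union> msupp b"
  by (auto simp: msupp_def)

lemma msupp_scale: "msupp (\<lambda>p. c * a p) \<subseteq> msupp a"
  by (auto simp: msupp_def)

lemma pairing_diff:
  assumes "finite (msupp a)" "finite (msupp b)"
  shows "pairing (\<lambda>p. a p - b p) f = pairing a f - pairing b f"
proof -
  let ?S = "msupp a \<union> msupp b"
  have "finite ?S" using assms by simp
  then show ?thesis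
    using pairing_eq_sum[of ?S a f] pairing_eq_sum[of ?S b f] pairing_eq_sum[of ?S "\<lambda>p. a p - b p" f]
      msupp_diff[of a b] by (simp add: left_diff_distrib sum_subtractf)
qed

lemma pairing_scale:
  assumes "finite (msupp a)"
  shows "pairing (\<lambda>p. c * a p) f = c * pairing a f"
  using pairing_eq_sum[OF assms msupp_scale[of c a], of f]
  by (simp add: pairing_def sum_distrib_left mult.assoc)

lemma variation_scale:
  assumes "finite (msupp a)"
  shows "variation (\<lambda>p. c * a p) UNIV = \<bar>c\<bar> * variation a UNIV"
  using variation_UNIV_eq_sum[OF assms msupp_scale[of c a]]
  by (simp add: variation_eq sum_distrib_left abs_mult)

lemma variation_diff_le:
  assumes "finite (msupp a)" "finite (msupp b)"
  shows "variation (\<lambda>p. a p - b p) UNIV \<le> variation a UNIV + variation b UNIV"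
proof -
  let ?S = "msupp a \<union> msupp b"
  have "finite ?S" using assms by simp
  then show ?thesis
    using variation_UNIV_eq_sum[of ?S a] variation_UNIV_eq_sum[of ?S b] variation_UNIV_eq_sum[of ?S "\<lambda>p. a p - b p"]
      msupp_diff[of a b] by (simp add: sum.distrib[symmetric] sum_mono)
qed

section \<open>Setwise null sequences of measures on a power set\<close>

text \<open>
  The model is the map that takes each subset of a discrete space to its closure in the Stone-Cech compactification.
  Such a Boolean homomorphism need not preserve infinite unions, but these exist in the power set and serve as test
  sets below.
\<close>

locale separating_algebra =
  fixes X :: "'p set" and hat :: "'n set \<Rightarrow> 'p set"
  assumes hat_Int: "hat (A \<inter> B) = hat A \<inter> hat B"
    and hat_Compl: "hat (- A) = X - hat A"
    and hat_separates: "p \<in> X \<Longrightarrow> q \<in> X \<Longrightarrow> p \<noteq> q \<Longrightarrow> \<exists>A. p \<in> hat A \<and> q \<notin> hat A"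
begin

lemma hat_empty [simp]: "hat {} = {}"
  using hat_Int[of UNIV "- UNIV"] hat_Compl[of UNIV] by auto

lemma hat_UNIV [simp]: "hat UNIV = X"
  using hat_Compl[of "{}"] by simp

lemma hat_subset: "hat A \<subseteq> X"
  using hat_Compl[of "- A"] by auto

lemma hat_Un: "hat (A \<union> B) = hat A \<union> hat B"
  using hat_Compl[of "- A \<inter> - B"] hat_Int[of "-A" "-B"] hat_Compl[of A] hat_Compl[of B] hat_subset[of A] hat_subset[of B]
  by auto

lemma hat_Diff: "hat (A - B) = hat A - hat B"
  using hat_Int[of A "- B"] hat_Compl[of B] hat_subset[of A] by (auto simp: Diff_eq)

lemma hat_mono: "A \<subseteq> B \<Longrightarrow> hat A \<subseteq> hat B"
  using hat_Int[of A B] by (metis inf.absorb_iff1 inf.absorb_iff2 inf_commute)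

lemma hat_UN: "finite J \<Longrightarrow> hat (\<Union>j\<in>J. A j) = (\<Union>j\<in>J. hat (A j))"
  by (induction J rule: finite_induct) (auto simp: hat_Un)

lemma separate_point:
  assumes "finite Q" "p \<in> X" "Q \<subseteq> X" "p \<notin> Q"
  shows "\<exists>A. p \<in> hat A \<and> Q \<inter> hat A = {}"
  using assms
proof (induction Q)
  case empty
  then show ?case by (intro exI[of _ UNIV]) auto
next
  case (insert q Q)
  then obtain A where "p \<in> hat A" "Q \<inter> hat A = {}" by auto
  moreover obtain B where "p \<in> hat B" "q \<notin> hat B"
    using insert.prems hat_separates[of p q] by auto
  ultimately show ?case
    by (intro exI[of _ "A \<inter> B"]) (auto simp: hat_Int)
qed

lemma separate_finite:
  assumes "finite P" "finite Q" "P \<subseteq> X" "Q \<subseteq> X" "P \<inter> Q = {}"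
  shows "\<exists>A. P \<subseteq> hat A \<and> Q \<inter> hat A = {}"
  using assms
proof (induction P)
  case empty
  then show ?case by (intro exI[of _ "{}"]) auto
next
  case (insert p P)
  then obtain A where "P \<subseteq> hat A" "Q \<inter> hat A = {}" by auto
  moreover obtain B where "p \<in> hat B" "Q \<inter> hat B = {}"
    using insert.prems separate_point[of Q p] by auto
  ultimately show ?case
    by (intro exI[of _ "A \<union> B"]) (auto simp: hat_Un)
qed

text \<open>
  Sets that separate each member from the other ones are made disjoint by removing from each the
  others: the latter do not meet the former on the points in question.
\<close>

lemma separate_family:
  assumes "finite J" "\<And>j. j \<in> J \<Longrightarrow> finite (E j)" "\<And>j. j \<in> J \<Longrightarrow> E j \<subseteq> X" "disjoint_family_on E J"
  obtains V where "\<And>j. j \<in> J \<Longrightarrow> E j \<subseteq> hat (V j)" "disjoint_family_on V J"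
proof -
  have "\<exists>A. E j \<subseteq> hat A \<and> (\<Union>l\<in>J-{j}. E l) \<inter> hat A = {}" if "j \<in> J" for j
    by (rule separate_finite)
      (use assms(1-3) that in \<open>auto dest: disjoint_family_on_unique[OF assms(4)]\<close>)
  then obtain B where B: "\<And>j. j \<in> J \<Longrightarrow> E j \<subseteq> hat (B j) \<and> (\<Union>l\<in>J-{j}. E l) \<inter> hat (B j) = {}"
    by metis
  let ?V = "\<lambda>j. B j - (\<Union>l\<in>J-{j}. B l)"
  show thesis
  proof
    fix j assume j: "j \<in> J"
    have "E j \<inter> hat (B l) = {}" if "l \<in> J - {j}" for l
      using B[of l] that j by auto
    moreover have "hat (\<Union>l\<in>J-{j}. B l) = (\<Union>l\<in>J-{j}. hat (B l))"
      using assms(1) by (intro hat_UN) simp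
    ultimately show "E j \<subseteq> hat (?V j)"
      using B[OF j] by (auto simp: hat_Diff)
  next
    show "disjoint_family_on ?V J"
      by (auto simp: disjoint_family_on_def)
  qed
qed

lemma disjoint_hat: "disjoint_family_on V J \<Longrightarrow> disjoint_family_on (\<lambda>j. hat (V j)) J"
  unfolding disjoint_family_on_def by (metis hat_Int hat_empty)

text \<open>
  Separate the points of \<open>G\<close> by disjoint sets. The mass of each of them tends to zero, and differs from the
  point mass by at most the variation on the rest of the set, which lies outside \<open>G\<close>.
\<close>

lemma variation_null_if_concentrated:
  assumes fin: "\<And>k. finite (msupp (a k))" and supp: "\<And>k. msupp (a k) \<subseteq> X"
    and null: "\<And>A. (\<lambda>k. mass (a k) (hat A)) \<longlonglongrightarrow> 0"
    and conc: "\<And>\<delta>. \<delta> > 0 \<Longrightarrow> \<exists>G. finite G \<and> (\<forall>\<^sub>F k in sequentially. variation (a k) (- G) \<le> \<delta>)"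
  shows "(\<lambda>k. variation (a k) UNIV) \<longlonglongrightarrow> 0"
proof (rule LIMSEQ_I)
  fix e :: real assume e: "0 < e"
  obtain G0 where G0: "finite G0" "\<forall>\<^sub>F k in sequentially. variation (a k) (- G0) \<le> e/4"
    using conc[of "e/4"] e by auto
  define G where "G = G0 \<inter> X"
  have G: "finite G" "G \<subseteq> X" using G0 by (auto simp: G_def)
  have "variation (a k) (- G) \<le> variation (a k) (- G0)" for k
    using supp[of k] by (intro variation_mono fin) (auto simp: G_def)
  then have out: "\<forall>\<^sub>F k in sequentially. variation (a k) (- G) \<le> e/4"
    using G0(2) by (rule_tac eventually_mono[OF G0(2)]) (meson order_trans)
  obtain V where V: "\<And>p. p \<in> G \<Longrightarrow> {p} \<subseteq> hat (V p)" "disjoint_family_on V G"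
    using separate_family[of G "\<lambda>p. {p}"] G by (auto simp: disjoint_family_on_def)
  have "(\<lambda>k. \<Sum>p\<in>G. \<bar>mass (a k) (hat (V p))\<bar>) \<longlonglongrightarrow> (\<Sum>p\<in>G. \<bar>0\<bar>)"
    by (intro tendsto_sum tendsto_rabs null)
  then have small: "\<forall>\<^sub>F k in sequentially. (\<Sum>p\<in>G. \<bar>mass (a k) (hat (V p))\<bar>) < e/4"
    using e by (intro order_tendstoD(2)) auto
  have key: "variation (a k) UNIV \<le> (\<Sum>p\<in>G. \<bar>mass (a k) (hat (V p))\<bar>) + 2 * variation (a k) (- G)" for k
  proof -
    have eq: "mass (a k) (hat (V p)) = a k p + mass (a k) (hat (V p) - {p})" if "p \<in> G" for p
    proof -
      have "hat (V p) = {p} \<union> (hat (V p) - {p})" using V(1)[OF that] by auto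
      then have "mass (a k) (hat (V p)) = mass (a k) {p} + mass (a k) (hat (V p) - {p})"
        using mass_Un[OF fin, of "{p}" "hat (V p) - {p}" k] by (metis Diff_disjoint)
      moreover have "mass (a k) {p} = a k p"
        by (cases "a k p = 0") (auto simp: mass_def msupp_def)
      ultimately show ?thesis by simp
    qed
    have le: "variation (a k) {p} \<le> \<bar>mass (a k) (hat (V p))\<bar> + variation (a k) (hat (V p) - {p})" if "p \<in> G" for p
    proof -
      have "variation (a k) {p} = \<bar>a k p\<bar>"
        by (cases "a k p = 0") (auto simp: variation_eq msupp_def)
      then show ?thesis
        using eq[OF that] abs_mass_le[of "a k" "hat (V p) - {p}"] by linarith
    qed
    have dis: "disjoint_family_on (\<lambda>p. hat (V p) - {p}) G"
      by (auto intro!: disjoint_family_on_uniqueI dest: disjoint_family_on_unique[OF disjoint_hat[OF V(2)]])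
    have "variation (a k) UNIV = variation (a k) G + variation (a k) (- G)"
      using variation_Un[OF fin, of G "- G" k] by simp
    also have "variation (a k) G = (\<Sum>p\<in>G. variation (a k) {p})"
      using variation_UN[OF fin G(1), of "\<lambda>p. {p}" k] by (simp add: disjoint_family_on_def)
    also have "\<dots> \<le> (\<Sum>p\<in>G. \<bar>mass (a k) (hat (V p))\<bar> + variation (a k) (hat (V p) - {p}))"
      by (rule sum_mono) (rule le)
    also have "\<dots> = (\<Sum>p\<in>G. \<bar>mass (a k) (hat (V p))\<bar>) + variation (a k) (\<Union>p\<in>G. hat (V p) - {p})"
      using variation_UN[OF fin G(1) dis] by (simp add: sum.distrib)
    also have "variation (a k) (\<Union>p\<in>G. hat (V p) - {p}) \<le> variation (a k) (- G)"
    proof (rule variation_mono[OF fin])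
      show "msupp (a k) \<inter> (\<Union>p\<in>G. hat (V p) - {p}) \<subseteq> - G"
        using V(1) by (auto dest: disjoint_family_on_unique[OF disjoint_hat[OF V(2)]])
    qed
    finally show ?thesis by simp
  qed
  have "\<forall>\<^sub>F k in sequentially. variation (a k) UNIV < e"
    using out small
  proof eventually_elim
    case (elim k)
    then show ?case using key[of k] e by linarith
  qed
  then show "\<exists>N. \<forall>k\<ge>N. norm (variation (a k) UNIV - 0) < e"
    by (simp add: variation_nonneg eventually_sequentially)
qed

text \<open>
  If no finite set carries almost all of the variation, then each new measure may be chosen to have variation
  \<open>\<delta>\<close> outside the union of the supports of those chosen before.
\<close>

lemma disjoint_supports:
  assumes fin: "\<And>k::nat. finite (msupp (a k))"
    and nc: "\<And>G. finite G \<Longrightarrow> \<exists>\<^sub>F k in sequentially. variation (a k) (- G) > \<delta>"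
  obtains r E where "strict_mono (r :: nat \<Rightarrow> nat)" "disjoint_family E" "\<And>i. E i \<subseteq> msupp (a (r i))"
    "\<And>i. variation (a (r i)) (E i) > \<delta>"
proof -
  let ?P = "\<lambda>(n::nat) (k::nat, G). finite G \<and> msupp (a k) \<subseteq> G"
  let ?Q = "\<lambda>(n::nat) (k, G) (k', G'). k < k' \<and> G \<subseteq> G' \<and> variation (a k') (- G) > \<delta>"
  have "\<exists>s. \<forall>n. ?P n (s n) \<and> ?Q n (s n) (s (Suc n))"
  proof (rule dependent_nat_choice)
    show "\<exists>s. ?P 0 s" using fin by auto
  next
    fix s n assume s: "?P n s"
    obtain k G where kG: "s = (k, G)" by force
    obtain k' where "k' > k" "variation (a k') (- G) > \<delta>"
      using nc[of G] s kG by (auto simp: frequently_sequentially) (metis Suc_le_eq)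
    then show "\<exists>y. ?P (Suc n) y \<and> ?Q n s y"
      using s fin[of k'] kG by (intro exI[of _ "(k', G \<union> msupp (a k'))"]) auto
  qed
  then obtain s where s0: "\<forall>n. ?P n (s n) \<and> ?Q n (s n) (s (Suc n))" ..
  have s: "?P n (s n)" "?Q n (s n) (s (Suc n))" for n
    using s0[rule_format, of n] by (rule conjunct1, rule conjunct2)
  define k where "k n = fst (s n)" for n
  define G where "G n = snd (s n)" for n
  have kG: "finite (G n)" "msupp (a (k n)) \<subseteq> G n" "k n < k (Suc n)" "G n \<subseteq> G (Suc n)"
    "variation (a (k (Suc n))) (- G n) > \<delta>" for n
    using s[of n] by (auto simp: k_def G_def split: prod.splits)
  have mono: "G m \<subseteq> G n" if "m \<le> n" for m n
    using lift_Suc_mono_le[of G, OF kG(4) that] .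
  (* The union G i contains the supports up to index i, so the new measure is the one with index i + 1. *)
  let ?E = "\<lambda>i. msupp (a (k (Suc i))) - G i"
  show thesis
  proof
    show "strict_mono (\<lambda>i. k (Suc i))"
      using kG(3) by (simp add: strict_mono_Suc_iff)
    have "?E i \<inter> ?E j = {}" if "i < j" for i j
      using kG(2)[of "Suc i"] mono[of "Suc i" j] that by auto
    then show "disjoint_family ?E"
      unfolding disjoint_family_on_def by (metis Int_commute linorder_neqE_nat)
    show "?E i \<subseteq> msupp (a (k (Suc i)))" for i by auto
    show "variation (a (k (Suc i))) (?E i) > \<delta>" for i
    proof -
      have "variation (a (k (Suc i))) (- G i) \<le> variation (a (k (Suc i))) (?E i)"
        by (rule variation_mono[OF fin]) auto
      then show ?thesis using kG(5)[of i] by linarith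
    qed
  qed
qed

text \<open>
  The supports of \<open>N\<close> candidates are covered by \<open>N\<close> disjoint sets. Since the variations are at most \<open>C\<close>, every
  measure has variation less than \<open>e\<close> on one of these sets, if \<open>N\<close> is large; so one of the sets may be removed
  from \<open>W\<close> at the cost of \<open>e\<close> for infinitely many of the measures.
\<close>

lemma disjointify_step:
  assumes fin: "\<And>k::nat. finite (msupp (b k))"
    and E: "disjoint_family E" "\<And>k. E k \<subseteq> msupp (b k)"
    and bd: "\<And>k. variation (b k) UNIV \<le> C"
    and I: "infinite I" "\<And>k. k \<in> I \<Longrightarrow> variation (b k) (E k \<inter> hat W) > c" and e: "e > 0"
  shows "\<exists>i V I'. i \<in> I \<and> V \<subseteq> W \<and> I' \<subseteq> I \<and> infinite I' \<and> variation (b i) (hat V) > c \<and>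
    (\<forall>k\<in>I'. i < k \<and> variation (b k) (E k \<inter> hat (W - V)) > c - e)"
proof -
  obtain N0 :: nat where N0: "C < real N0 * e"
    using e reals_Archimedean3 by blast
  define N where "N = Suc N0"
  have N: "C < real N * e" "N > 0"
    using N0 e by (auto simp: N_def algebra_simps)
  obtain J where J: "J \<subseteq> I" "finite J" "card J = N"
    using infinite_arbitrarily_large[OF I(1)] by blast
  obtain V0 where V0: "\<And>j. j \<in> J \<Longrightarrow> E j \<inter> hat W \<subseteq> hat (V0 j)" "disjoint_family_on V0 J"
  proof (rule separate_family[of J "\<lambda>j. E j \<inter> hat W"])
    show "finite (E j \<inter> hat W)" for j
      using fin[of j] E(2)[of j] by (meson finite_Int finite_subset)
    show "E j \<inter> hat W \<subseteq> X" for j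
      using hat_subset by auto
    show "disjoint_family_on (\<lambda>j. E j \<inter> hat W) J"
      by (auto intro!: disjoint_family_on_uniqueI dest: disjoint_family_on_unique[OF E(1) UNIV_I UNIV_I])
  qed (use J in auto)
  define V where "V j = V0 j \<inter> W" for j
  have V: "\<And>j. j \<in> J \<Longrightarrow> E j \<inter> hat W \<subseteq> hat (V j)" "disjoint_family_on V J" "\<And>j. V j \<subseteq> W"
    using V0(1) by (auto simp: V_def hat_Int
        intro!: disjoint_family_on_uniqueI dest: disjoint_family_on_unique[OF V0(2)])
  have "\<exists>j\<in>J. variation (b k) (hat (V j)) < e" for k
  proof (rule ccontr)
    assume "\<not> ?thesis"
    then have "(\<Sum>j\<in>J. e) \<le> (\<Sum>j\<in>J. variation (b k) (hat (V j)))"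
      by (intro sum_mono) auto
    also have "\<dots> = variation (b k) (\<Union>j\<in>J. hat (V j))"
      using variation_UN[OF fin J(2) disjoint_hat[OF V(2)]] by simp
    also have "\<dots> \<le> variation (b k) UNIV"
      by (rule variation_mono[OF fin]) auto
    finally show False using bd[of k] N J by simp
  qed
  then obtain jf where jf: "\<And>k. jf k \<in> J" "\<And>k. variation (b k) (hat (V (jf k))) < e"
    by metis
  have "finite (jf ` I)"
    using jf(1) J(2) by (meson finite_subset image_subsetI)
  then obtain k0 where k0: "k0 \<in> I" "infinite {k \<in> I. jf k = jf k0}"
    using pigeonhole_infinite[OF I(1)] by blast
  define j where "j = jf k0"
  define I' where "I' = {k \<in> I. jf k = j} - {..j}"
  have jJ: "j \<in> J" and jI: "j \<in> I" using jf J by (auto simp: j_def)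
  have "infinite I'" using k0 by (simp add: I'_def j_def)
  moreover have "I' \<subseteq> I" by (auto simp: I'_def)
  moreover have "variation (b j) (hat (V j)) > c"
  proof -
    have "variation (b j) (E j \<inter> hat W) \<le> variation (b j) (hat (V j))"
      using V(1)[OF jJ] by (intro variation_mono fin) auto
    then show ?thesis using I(2)[OF jI] by linarith
  qed
  moreover have "j < k \<and> variation (b k) (E k \<inter> hat (W - V j)) > c - e" if "k \<in> I'" for k
  proof -
    have kI: "k \<in> I" "jf k = j" "j < k" using that by (auto simp: I'_def)
    have "hat W = hat (W - V j) \<union> hat (V j)"
      using V(3)[of j] by (metis Diff_partition Un_commute hat_Un)
    then have "E k \<inter> hat W = (E k \<inter> hat (W - V j)) \<union> (E k \<inter> hat (V j))" by auto
    then have "variation (b k) (E k \<inter> hat W) = variation (b k) (E k \<inter> hat (W - V j)) + variation (b k) (E k \<inter> hat (V j))"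
      using variation_Un[OF fin, of "E k \<inter> hat (W - V j)" "E k \<inter> hat (V j)" k] by (auto simp: hat_Diff)
    moreover have "variation (b k) (E k \<inter> hat (V j)) \<le> variation (b k) (hat (V j))"
      by (rule variation_mono[OF fin]) auto
    ultimately show ?thesis using jf(2)[of k] kI I(2)[of k] by auto
  qed
  ultimately show ?thesis using jI V(3)[of j] by blast
qed

text \<open>
  Disjoint finite sets of points need not have disjoint neighbourhoods simultaneously, as the points may accumulate
  at each other. Passing to a subsequence and giving up half of the variation makes this possible.
\<close>

lemma disjointify:
  assumes fin: "\<And>k::nat. finite (msupp (b k))" and supp: "\<And>k. msupp (b k) \<subseteq> X"
    and E: "disjoint_family E" "\<And>k. E k \<subseteq> msupp (b k)"
    and bd: "\<And>k. variation (b k) UNIV \<le> C"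
    and big: "\<And>k. variation (b k) (E k) > c" and c: "c > 0"
  obtains r V where "strict_mono (r :: nat \<Rightarrow> nat)" "disjoint_family V"
    "\<And>t. variation (b (r t)) (hat (V t)) > c / 2"
proof -
  (* Step n may lose c/4 * (1/2)^n, so that more than c/2 remains forever. *)
  let ?c = "\<lambda>n::nat. c/2 + c/2 * (1/2)^n"
  let ?P = "\<lambda>n (W, I, i::nat, V::'n set). infinite I \<and> (\<forall>k\<in>I. variation (b k) (E k \<inter> hat W) > ?c n)"
  let ?Q = "\<lambda>(n::nat) (W, I, i::nat, V::'n set) (W', I', i', V'). W' = W - V' \<and> V' \<subseteq> W \<and> i' \<in> I \<and>
      I' \<subseteq> I \<and> (\<forall>k\<in>I'. i' < k) \<and> variation (b i') (hat V') > c/2"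
  have "\<exists>s. \<forall>n. ?P n (s n) \<and> ?Q n (s n) (s (Suc n))"
  proof (rule dependent_nat_choice)
    have "E k \<inter> X = E k" for k using E(2)[of k] supp[of k] by auto
    then show "\<exists>s. ?P 0 s"
      using big by (intro exI[of _ "(UNIV, UNIV, 0, {})"]) auto
  next
    fix s n assume s: "?P n s"
    obtain W I i V where WI: "s = (W, I, i, V)" by (metis prod_cases4)
    obtain i' V' I' where new: "i' \<in> I" "V' \<subseteq> W" "I' \<subseteq> I" "infinite I'" "variation (b i') (hat V') > ?c n"
      "\<forall>k\<in>I'. i' < k \<and> variation (b k) (E k \<inter> hat (W - V')) > ?c n - c/4 * (1/2)^n"
      using disjointify_step[OF fin E bd, of I "?c n" W "c/4 * (1/2)^n"] s c by (auto simp: WI)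
    have 1: "?c n - c/4 * (1/2)^n = ?c (Suc n)" by (simp add: field_simps)
    have 2: "c/2 < ?c n" using c by simp
    show "\<exists>y. ?P (Suc n) y \<and> ?Q n s y"
      using new 2 unfolding 1 by (intro exI[of _ "(W - V', I', i', V')"]) (force simp: WI)
  qed
  then obtain s where s0: "\<forall>n. ?P n (s n) \<and> ?Q n (s n) (s (Suc n))" ..
  have s: "?P n (s n)" "?Q n (s n) (s (Suc n))" for n
    using s0[rule_format, of n] by (rule conjunct1, rule conjunct2)
  define W where "W n = fst (s n)" for n
  define I where "I n = fst (snd (s n))" for n
  define r where "r n = fst (snd (snd (s (Suc n))))" for n
  define V where "V n = snd (snd (snd (s (Suc n))))" for n
  have Q: "W (Suc n) = W n - V n" "V n \<subseteq> W n" "r n \<in> I n" "I (Suc n) \<subseteq> I n" "\<forall>k\<in>I (Suc n). r n < k"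
    "variation (b (r n)) (hat (V n)) > c/2" for n
    using s(2)[of n] by (auto simp: W_def I_def r_def V_def split: prod.splits)
  have Wdec: "W n \<subseteq> W m" if "m \<le> n" for m n
    using that by (induction rule: dec_induct) (use Q(1) in auto)
  show thesis
  proof
    show "strict_mono r"
      using Q(3,5) by (simp add: strict_mono_Suc_iff)
    have "V m \<inter> V n = {}" if "m < n" for m n
      using Q(2)[of n] Wdec[of "Suc m" n] Q(1)[of m] that by auto
    then show "disjoint_family V"
      unfolding disjoint_family_on_def by (metis Int_commute linorder_neqE_nat)
  qed (rule Q(6))
qed

lemma large_mass_in_half:
  assumes fin: "finite (msupp a)" and supp: "msupp a \<subseteq> X" and big: "variation a (hat V) > 2 * c"
  obtains U where "U \<subseteq> V" "\<bar>mass a (hat U)\<bar> > c"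
proof -
  obtain A where A: "{p \<in> msupp a. a p > 0} \<subseteq> hat A" "{p \<in> msupp a. a p < 0} \<inter> hat A = {}"
    using separate_finite[of "{p \<in> msupp a. a p > 0}" "{p \<in> msupp a. a p < 0}"] fin supp by fastforce
  have Un: "hat V = hat (V \<inter> A) \<union> hat (V - A)" "hat (V \<inter> A) \<inter> hat (V - A) = {}"
    by (auto simp: hat_Int hat_Diff)
  have "variation a (hat V) = variation a (hat (V \<inter> A)) + variation a (hat (V - A))"
    using variation_Un[OF fin Un(2)] Un(1) by simp
  moreover have "variation a (hat (V \<inter> A)) = mass a (hat (V \<inter> A))"
    unfolding variation_eq mass_def
  proof (rule sum.cong)
    fix p assume "p \<in> msupp a \<inter> hat (V \<inter> A)"
    then show "\<bar>a p\<bar> = a p" using A(2) by (auto simp: hat_Int)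
  qed simp
  moreover have "variation a (hat (V - A)) = - mass a (hat (V - A))"
    unfolding variation_eq mass_def sum_negf[symmetric]
  proof (rule sum.cong)
    fix p assume "p \<in> msupp a \<inter> hat (V - A)"
    then show "\<bar>a p\<bar> = - a p" using A(1) by (auto simp: hat_Diff)
  qed simp
  ultimately have "\<bar>mass a (hat (V \<inter> A))\<bar> > c \<or> \<bar>mass a (hat (V - A))\<bar> > c"
    using big by linarith
  then show thesis using that by blast
qed

text \<open>
  Two disjoint infinite subfamilies have disjoint unions, and a point lies in the \<open>hat\<close> of at most one of them.
\<close>

lemma avoid_finite_set:
  assumes dis: "disjoint_family (U :: nat \<Rightarrow> 'n set)" and "infinite I" "finite F"
  shows "\<exists>I'. I' \<subseteq> I \<and> infinite I' \<and> F \<inter> hat (\<Union>s\<in>I'. U s) = {}"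
  using assms(3)
proof (induction F)
  case empty
  then show ?case using assms(2) by blast
next
  case (insert p F)
  then obtain I' where I': "I' \<subseteq> I" "infinite I'" "F \<inter> hat (\<Union>s\<in>I'. U s) = {}" by auto
  obtain C :: "nat \<Rightarrow> nat set" where C: "pairwise (\<lambda>i j. disjnt (C i) (C j)) UNIV" "(\<Union>i. C i) \<subseteq> I'" "\<And>i. infinite (C i)"
    using infinite_infinite_partition[OF I'(2)] by blast
  have "C 0 \<inter> C 1 = {}" using C(1) by (auto simp: pairwise_def disjnt_def)
  then have "(\<Union>s\<in>C 0. U s) \<inter> (\<Union>s\<in>C 1. U s) = {}"
    using disjoint_family_on_unique[OF dis] by fast
  then have "hat (\<Union>s\<in>C 0. U s) \<inter> hat (\<Union>s\<in>C 1. U s) = {}"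
    by (metis hat_Int hat_empty)
  then obtain i where "p \<notin> hat (\<Union>s\<in>C i. U s)" by blast
  moreover have "hat (\<Union>s\<in>C i. U s) \<subseteq> hat (\<Union>s\<in>I'. U s)"
    using C(2) by (intro hat_mono) blast
  ultimately show ?case
    using I' C by (intro exI[of _ "C i"]) blast
qed

text \<open>
  A gliding hump: choose indices such that the union of the preceding sets has a small mass for the next
  measure, which is possible if the measures are setwise null, and such that its support misses the union of all later sets. Then the
  union of the chosen sets has a large mass for each of the chosen measures.
\<close>

lemma not_setwise_null:
  assumes fin: "\<And>t::nat. finite (msupp (b t))" and dis: "disjoint_family U"
    and big: "\<And>t. \<bar>mass (b t) (hat (U t))\<bar> > 2 * c" and c: "c > 0"
  shows "\<exists>A. \<not> (\<lambda>t. mass (b t) (hat A)) \<longlonglongrightarrow> 0"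
proof (rule ccontr)
  assume "\<not> ?thesis"
  then have null: "(\<lambda>t. mass (b t) (hat A)) \<longlonglongrightarrow> 0" for A by blast
  let ?P = "\<lambda>(n::nat) (t, I, D). infinite I \<and> t \<in> I \<and> \<bar>mass (b t) (hat D)\<bar> < c \<and> D \<inter> (\<Union>s\<in>I. U s) = {}"
  let ?Q = "\<lambda>(n::nat) (t::nat, I, D) (t', I', D'). t < t' \<and> I' \<subseteq> I \<and> D' = D \<union> U t \<and>
       msupp (b t) \<inter> hat (\<Union>s\<in>I'. U s) = {}"
  have "\<exists>s. \<forall>n. ?P n (s n) \<and> ?Q n (s n) (s (Suc n))"
  proof (rule dependent_nat_choice)
    show "\<exists>s. ?P 0 s" using c by (intro exI[of _ "(0, UNIV, {})"]) auto
  next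
    fix s n assume s: "?P n s"
    obtain t I D where tI: "s = (t, I, D)" by (metis prod_cases3)
    have "\<forall>\<^sub>F k in sequentially. \<bar>mass (b k) (hat (D \<union> U t))\<bar> < c"
      using tendsto_rabs[OF null[of "D \<union> U t"]] c by (intro order_tendstoD(2)) auto
    then obtain N where N: "\<And>k. k \<ge> N \<Longrightarrow> \<bar>mass (b k) (hat (D \<union> U t))\<bar> < c"
      by (auto simp: eventually_sequentially)
    have "infinite (I - {..max N t})" using s tI by simp
    then obtain I' where I': "I' \<subseteq> I - {..max N t}" "infinite I'" "msupp (b t) \<inter> hat (\<Union>s\<in>I'. U s) = {}"
      using avoid_finite_set[OF dis _ fin] by meson
    obtain t' where t': "t' \<in> I'" using I'(2) by (metis finite.emptyI equals0I)
    then have "t < t'" "N \<le> t'" using I'(1) by auto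
    have "U t \<inter> U k = {}" if "k \<in> I'" for k
    proof -
      have "t \<noteq> k" using that I'(1) by auto
      then show ?thesis using dis by (auto simp: disjoint_family_on_def)
    qed
    moreover have "D \<inter> U k = {}" if "k \<in> I'" for k
      using s I'(1) that by (auto simp: tI)
    ultimately have "(D \<union> U t) \<inter> (\<Union>s\<in>I'. U s) = {}" by blast
    then show "\<exists>y. ?P (Suc n) y \<and> ?Q n s y"
      using I' t' \<open>t < t'\<close> N[OF \<open>N \<le> t'\<close>]
      by (intro exI[of _ "(t', I', D \<union> U t)"]) (auto simp: tI)
  qed
  then obtain s where s0: "\<forall>n. ?P n (s n) \<and> ?Q n (s n) (s (Suc n))" ..
  have s: "?P n (s n)" "?Q n (s n) (s (Suc n))" for n
    using s0[rule_format, of n] by (rule conjunct1, rule conjunct2)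
  define t where "t n = fst (s n)" for n
  define I where "I n = fst (snd (s n))" for n
  define D where "D n = snd (snd (s n))" for n
  have P: "t n \<in> I n" "\<bar>mass (b (t n)) (hat (D n))\<bar> < c" "D n \<inter> (\<Union>s\<in>I n. U s) = {}" for n
    using s(1)[of n] by (auto simp: t_def I_def D_def split: prod.splits)
  have Q: "t n < t (Suc n)" "I (Suc n) \<subseteq> I n" "D (Suc n) = D n \<union> U (t n)"
    "msupp (b (t n)) \<inter> hat (\<Union>s\<in>I (Suc n). U s) = {}" for n
    using s(2)[of n] by (auto simp: t_def I_def D_def split: prod.splits)
  have sm: "strict_mono t" using Q(1) by (simp add: strict_mono_Suc_iff)
  have Idec: "I n \<subseteq> I m" if "m \<le> n" for m n
    using that by (induction rule: dec_induct) (use Q(2) in auto)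
  have Dinc: "D m \<subseteq> D n" if "m \<le> n" for m n
    using that by (induction rule: dec_induct) (use Q(3) in auto)
  (* Dependent choice does not prescribe the first state, so D 0 need not be empty. *)
  define A where "A = (\<Union>n. U (t n)) \<union> D 0"
  have large: "\<bar>mass (b (t n)) (hat A)\<bar> > c" for n
  proof -
    define R where "R = A - D n - U (t n)"
    have R: "R \<subseteq> (\<Union>s\<in>I (Suc n). U s)"
    proof
      fix x assume x: "x \<in> R"
      then have "x \<notin> D 0" using Dinc[of 0 n] by (auto simp: R_def)
      then obtain m where m: "x \<in> U (t m)" using x by (auto simp: R_def A_def)
      have "\<not> m < n"
      proof
        assume "m < n"
        then have "D (Suc m) \<subseteq> D n" by (intro Dinc) auto
        then show False using m x Q(3)[of m] by (auto simp: R_def)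
      qed
      moreover have "m \<noteq> n" using m x by (auto simp: R_def)
      ultimately have "t m \<in> I (Suc n)" using P(1)[of m] Idec[of "Suc n" m] by auto
      then show "x \<in> (\<Union>s\<in>I (Suc n). U s)" using m by blast
    qed
    have "D n \<subseteq> A"
    proof (induction n)
      case 0 then show ?case by (auto simp: A_def)
    next
      case (Suc n) then show ?case unfolding Q(3) by (auto simp: A_def)
    qed
    then have "A = (D n \<union> U (t n)) \<union> R" by (auto simp: R_def A_def)
    then have hatA: "hat A = (hat (D n) \<union> hat (U (t n))) \<union> hat R" by (metis hat_Un)
    have d1: "hat (D n) \<inter> hat (U (t n)) = {}"
    proof -
      have "D n \<inter> U (t n) = {}" using P(1,3)[of n] by blast
      then show ?thesis by (metis hat_Int hat_empty)
    qed
    have d2: "(hat (D n) \<union> hat (U (t n))) \<inter> hat R = {}"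
      by (auto simp: R_def hat_Diff)
    have "mass (b (t n)) (hat R) = 0"
      using Q(4)[of n] hat_mono[OF R] by (intro mass_disjoint_support) auto
    then have "mass (b (t n)) (hat A) = mass (b (t n)) (hat (D n)) + mass (b (t n)) (hat (U (t n)))"
      unfolding hatA by (simp add: mass_Un[OF fin d2] mass_Un[OF fin d1])
    then show ?thesis using P(2)[of n] big[of "t n"] by linarith
  qed
  have "(\<lambda>n. mass (b (t n)) (hat A)) \<longlonglongrightarrow> 0"
    using LIMSEQ_subseq_LIMSEQ[OF null[of A] sm] by (simp add: o_def)
  from tendsto_rabs[OF this] have "\<forall>\<^sub>F n in sequentially. \<bar>mass (b (t n)) (hat A)\<bar> < c"
    using c by (intro order_tendstoD(2)) auto
  then show False using large by (meson eventually_sequentially less_asym order_refl)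
qed

text \<open>
  This combines the theorem of Phillips on finitely additive measures with the Schur property of \<open>\<ell>\<^sub>1\<close>: the points of
  \<open>X\<close> need not be isolated, but finitely many of them can be handled as if they were.
\<close>

theorem setwise_null_imp_norm_null:
  assumes fin: "\<And>k::nat. finite (msupp (a k))" and supp: "\<And>k. msupp (a k) \<subseteq> X"
    and bd: "\<And>k. variation (a k) UNIV \<le> C"
    and null: "\<And>A. (\<lambda>k. mass (a k) (hat A)) \<longlonglongrightarrow> 0"
  shows "(\<lambda>k. variation (a k) UNIV) \<longlonglongrightarrow> 0"
proof (rule variation_null_if_concentrated[OF fin supp null])
  fix \<delta> :: real assume \<delta>: "\<delta> > 0"
  show "\<exists>G. finite G \<and> (\<forall>\<^sub>F k in sequentially. variation (a k) (- G) \<le> \<delta>)"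
  proof (rule ccontr)
    assume "\<not> ?thesis"
    then have nc: "\<exists>\<^sub>F k in sequentially. variation (a k) (- G) > \<delta>" if "finite G" for G
      using that by (auto simp: frequently_def not_less)
    obtain r E where r: "strict_mono (r :: nat \<Rightarrow> nat)" "disjoint_family E" "\<And>i. E i \<subseteq> msupp (a (r i))"
      "\<And>i. variation (a (r i)) (E i) > \<delta>"
      using disjoint_supports[of a \<delta>, OF fin nc] by metis
    obtain t V where t: "strict_mono (t :: nat \<Rightarrow> nat)" "disjoint_family V"
      "\<And>n. variation (a (r (t n))) (hat (V n)) > \<delta> / 2"
      by (rule disjointify[of "\<lambda>i. a (r i)" E C \<delta>, OF fin supp r(2,3) bd r(4) \<delta>]) (rule that)
    have "\<exists>U. U \<subseteq> V n \<and> \<bar>mass (a (r (t n))) (hat U)\<bar> > \<delta>/4" for n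
      using large_mass_in_half[OF fin supp, of "\<delta>/4" "r (t n)" "V n"] t(3)[of n] by auto
    then obtain U where U: "\<And>n. U n \<subseteq> V n" "\<And>n. \<bar>mass (a (r (t n))) (hat (U n))\<bar> > \<delta>/4"
      by metis
    have "disjoint_family U"
      unfolding disjoint_family_on_def
    proof (intro ballI impI)
      fix m n :: nat assume "m \<noteq> n"
      then have "V m \<inter> V n = {}" using t(2) by (simp add: disjoint_family_on_def)
      then show "U m \<inter> U n = {}" using U(1)[of m] U(1)[of n] by blast
    qed
    then obtain A where "\<not> (\<lambda>n. mass (a (r (t n))) (hat A)) \<longlonglongrightarrow> 0"
      using not_setwise_null[of "\<lambda>n. a (r (t n))" U "\<delta>/8"] fin U(2) \<delta> by auto
    moreover have "strict_mono (r \<circ> t)" using r(1) t(1) by (rule strict_mono_o)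
    ultimately show False
      using LIMSEQ_subseq_LIMSEQ[OF null[of A], of "r \<circ> t"] by (simp add: o_def)
  qed
qed

section \<open>Compact unit balls\<close>

text \<open>
  Relative sequential compactness of the unit ball of \<open>M\<close> in the topology of convergence on every \<open>hat A\<close>; the
  limit need not be a finitely supported measure.
\<close>

definition setwise_compact :: "('p \<Rightarrow> real) set \<Rightarrow> bool" where
  "setwise_compact M \<longleftrightarrow> (\<forall>a :: nat \<Rightarrow> 'p \<Rightarrow> real. (\<forall>n. a n \<in> M \<and> variation (a n) UNIV \<le> 1) \<longrightarrow>
     (\<exists>r. strict_mono r \<and> (\<forall>A. convergent (\<lambda>n. mass (a (r n)) (hat A)))))"

text \<open>
  Otherwise there is a sequence in the unit ball with mutual distances above \<open>1/2\<close>. The successive differences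
  of a convergent subsequence are setwise null but not norm null.
\<close>

lemma finite_half_net:
  assumes fin: "\<And>a. a \<in> M \<Longrightarrow> finite (msupp a)" and supp: "\<And>a. a \<in> M \<Longrightarrow> msupp a \<subseteq> X"
    and comp: "setwise_compact M"
  shows "\<exists>F. finite F \<and> F \<subseteq> M \<and>
    (\<forall>a\<in>M. variation a UNIV \<le> 1 \<longrightarrow> (\<exists>\<phi>\<in>F. variation (\<lambda>p. a p - \<phi> p) UNIV \<le> 1/2))"
proof (rule ccontr)
  assume no: "\<not> ?thesis"
  define B where "B = {a \<in> M. variation a UNIV \<le> 1}"
  have far: "\<exists>a\<in>B. \<forall>\<phi>\<in>F. variation (\<lambda>p. a p - \<phi> p) UNIV > 1/2" if F: "finite F" "F \<subseteq> B" for F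
  proof (rule ccontr)
    assume near: "\<not> ?thesis"
    have "\<forall>a\<in>M. variation a UNIV \<le> 1 \<longrightarrow> (\<exists>\<phi>\<in>F. variation (\<lambda>p. a p - \<phi> p) UNIV \<le> 1/2)"
      using near by (auto simp: not_less B_def)
    moreover have "F \<subseteq> M" using F by (auto simp: B_def)
    ultimately show False using F no by blast
  qed
  have "\<exists>a. \<forall>n::nat. a n \<in> B \<and> (\<forall>m<n. variation (\<lambda>p. a n p - a m p) UNIV > 1/2)"
  proof (rule dependent_wellorder_choice)
    fix n and a :: "nat \<Rightarrow> 'p \<Rightarrow> real"
    assume "\<And>m. m < n \<Longrightarrow> a m \<in> B \<and> (\<forall>l<m. variation (\<lambda>p. a m p - a l p) UNIV > 1/2)"
    then have "a ` {..<n} \<subseteq> B" by blast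
    then show "\<exists>b. b \<in> B \<and> (\<forall>m<n. variation (\<lambda>p. b p - a m p) UNIV > 1/2)"
      using far[of "a ` {..<n}"] by (simp only: finite_imageI finite_lessThan ball_simps) auto
  qed simp
  then obtain a :: "nat \<Rightarrow> 'p \<Rightarrow> real" where a: "\<And>n. a n \<in> B"
    "\<And>m n. m < n \<Longrightarrow> variation (\<lambda>p. a n p - a m p) UNIV > 1/2" by blast
  have aM: "a n \<in> M" "variation (a n) UNIV \<le> 1" "finite (msupp (a n))" "msupp (a n) \<subseteq> X" for n
    using a(1)[of n] fin supp by (auto simp: B_def)
  obtain r where r: "strict_mono (r :: nat \<Rightarrow> nat)" "\<And>A. convergent (\<lambda>n. mass (a (r n)) (hat A))"
    using comp aM unfolding setwise_compact_def by blast
  let ?b = "\<lambda>n p. a (r (Suc n)) p - a (r n) p"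
  have "(\<lambda>n. variation (?b n) UNIV) \<longlonglongrightarrow> 0"
  proof (rule setwise_null_imp_norm_null)
    show fb: "finite (msupp (?b n))" for n
      using msupp_diff[of "a (r (Suc n))" "a (r n)"] aM(3) by (meson finite_UnI finite_subset)
    show "msupp (?b n) \<subseteq> X" for n
      using msupp_diff[of "a (r (Suc n))" "a (r n)"] aM(4) by blast
    show "variation (?b n) UNIV \<le> 2" for n
      using variation_diff_le[OF aM(3) aM(3), of "r (Suc n)" "r n"] aM(2)[of "r (Suc n)"] aM(2)[of "r n"] by linarith
    fix A
    obtain l where l: "(\<lambda>n. mass (a (r n)) (hat A)) \<longlonglongrightarrow> l"
      using r(2)[of A] by (auto simp: convergent_def)
    have "(\<lambda>n. mass (a (r (Suc n))) (hat A) - mass (a (r n)) (hat A)) \<longlonglongrightarrow> l - l"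
      using LIMSEQ_Suc[OF l] l by (intro tendsto_diff)
    moreover have "mass (?b n) (hat A) = mass (a (r (Suc n))) (hat A) - mass (a (r n)) (hat A)" for n
      by (simp only: mass_eq_pairing[OF fb] mass_eq_pairing[OF aM(3)] pairing_diff[OF aM(3) aM(3)])
    ultimately show "(\<lambda>n. mass (?b n) (hat A)) \<longlonglongrightarrow> 0" by simp
  qed
  then have "\<forall>\<^sub>F n in sequentially. variation (?b n) UNIV < 1/2"
    by (rule order_tendstoD(2)) simp
  then obtain n where "variation (?b n) UNIV < 1/2"
    by (auto simp: eventually_sequentially)
  moreover have "r n < r (Suc n)" using r(1) by (simp add: strict_mono_Suc_iff)
  ultimately show False using a(2) by (meson less_asym)
qed

text \<open>
  Suppose that \<open>f\<close> is annihilated by a \<open>1/2\<close>-net \<open>F\<close> of the unit ball. If \<open>b\<close> is in the ball and \<open>\<phi> \<in> F\<close> is near \<open>b\<close>,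
  then \<open>2 (b - \<phi>)\<close> is in the ball and has twice the value of \<open>b\<close> at \<open>f\<close>. Iterating this gives the value zero.
\<close>

theorem finitely_determined_annihilator:
  assumes fin: "\<And>a. a \<in> M \<Longrightarrow> finite (msupp a)" and supp: "\<And>a. a \<in> M \<Longrightarrow> msupp a \<subseteq> X"
    and diff: "\<And>a b. a \<in> M \<Longrightarrow> b \<in> M \<Longrightarrow> (\<lambda>p. a p - b p) \<in> M"
    and scale: "\<And>a c. a \<in> M \<Longrightarrow> (\<lambda>p. c * a p) \<in> M"
    and comp: "setwise_compact M"
  obtains F where "finite F" "F \<subseteq> M"
    "\<forall>f. bounded (f ` X) \<longrightarrow> (\<forall>\<phi>\<in>F. pairing \<phi> f = 0) \<longrightarrow> (\<forall>a\<in>M. pairing a f = 0)"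
proof -
  obtain F where F: "finite F" "F \<subseteq> M"
    "\<And>a. a \<in> M \<Longrightarrow> variation a UNIV \<le> 1 \<Longrightarrow> \<exists>\<phi>\<in>F. variation (\<lambda>p. a p - \<phi> p) UNIV \<le> 1/2"
    using finite_half_net[OF fin supp comp] by metis
  have "pairing a f = 0" if bdd: "bounded (f ` X)" and ker: "\<And>\<phi>. \<phi> \<in> F \<Longrightarrow> pairing \<phi> f = 0" and a: "a \<in> M"
    for f a
  proof -
    obtain K where K: "\<And>p. p \<in> X \<Longrightarrow> \<bar>f p\<bar> \<le> K" using bdd by (auto simp: bounded_iff)
    have ball: "\<bar>pairing b f\<bar> \<le> \<bar>K\<bar> * (1/2)^n" if "b \<in> M" "variation b UNIV \<le> 1" for b n
      using that
    proof (induction n arbitrary: b)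
      case 0
      have "\<bar>pairing b f\<bar> \<le> \<bar>K\<bar> * variation b UNIV"
        using K supp[OF 0(1)] by (intro abs_pairing_le) force
      then show ?case using 0(2) mult_left_mono[of "variation b UNIV" 1 "\<bar>K\<bar>"] by simp
    next
      case (Suc n)
      obtain \<phi> where \<phi>: "\<phi> \<in> F" "variation (\<lambda>p. b p - \<phi> p) UNIV \<le> 1/2" using F(3) Suc.prems by blast
      let ?d = "\<lambda>p. b p - \<phi> p"
      have d: "?d \<in> M" "\<phi> \<in> M" using diff Suc.prems \<phi> F(2) by auto
      have "\<bar>pairing (\<lambda>p. 2 * ?d p) f\<bar> \<le> \<bar>K\<bar> * (1/2)^n"
      proof (rule Suc.IH)
        show "(\<lambda>p. 2 * ?d p) \<in> M" by (rule scale[OF d(1)])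
        show "variation (\<lambda>p. 2 * ?d p) UNIV \<le> 1"
          using \<phi>(2) variation_scale[OF fin[OF d(1)], of 2] by simp
      qed
      moreover have "pairing (\<lambda>p. 2 * ?d p) f = 2 * pairing b f"
        using pairing_scale[OF fin[OF d(1)], of 2 f] pairing_diff[OF fin[OF Suc.prems(1)] fin[OF d(2)], of f] ker[OF \<phi>(1)]
        by simp
      ultimately show ?case by (simp add: abs_mult)
    qed
    have zero: "pairing b f = 0" if "b \<in> M" "variation b UNIV \<le> 1" for b
    proof -
      have "(\<lambda>n. \<bar>K\<bar> * (1/2)^n) \<longlonglongrightarrow> \<bar>K\<bar> * 0"
        by (intro tendsto_mult tendsto_const LIMSEQ_power_zero) simp
      then have "\<bar>pairing b f\<bar> \<le> \<bar>K\<bar> * 0"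
        using ball[OF that] by (intro LIMSEQ_le_const) auto
      then show ?thesis by simp
    qed
    define c where "c = 1 / (1 + variation a UNIV)"
    have c: "c > 0" "c * variation a UNIV \<le> 1"
      using variation_nonneg[of a UNIV] by (auto simp: c_def divide_simps)
    have "pairing (\<lambda>p. c * a p) f = 0"
      using c variation_scale[OF fin[OF a], of c] by (intro zero scale a) simp
    then show "pairing a f = 0" using pairing_scale[OF fin[OF a], of c f] c by simp
  qed
  then show thesis by (intro that[OF F(1,2)] allI impI ballI) simp_all
qed

end

section \<open>Duality for spaces of continuous functions\<close>

lemma vcarrier_Cp: "vcarrier (Cp X) = {f \<in> extensional (topspace X). continuous_map X euclideanreal f}"
  by (auto simp: Cp_def subspace_tvs_def real_power_def PiE_def)

lemma vadd_Cp: "vadd (Cp X) f g = (\<lambda>i\<in>topspace X. f i + g i)"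
  and vscale_Cp: "vscale (Cp X) c f = (\<lambda>i\<in>topspace X. c * f i)"
  and vzero_Cp: "vzero (Cp X) = (\<lambda>i\<in>topspace X. 0)"
  by (simp_all add: Cp_def subspace_tvs_def real_power_def)

lemma vtop_Cp: "vtop (Cp X) = subtopology (product_topology (\<lambda>_. euclideanreal) (topspace X)) {f. continuous_map X euclideanreal f}"
  by (simp add: Cp_def subspace_tvs_def real_power_def)

lemma Cp_eqI: "f \<in> vcarrier (Cp X) \<Longrightarrow> g \<in> vcarrier (Cp X) \<Longrightarrow> (\<And>p. p \<in> topspace X \<Longrightarrow> f p = g p) \<Longrightarrow> f = g"
  by (auto simp: vcarrier_Cp intro: extensionalityI)

lemma restrict_in_Cp: "continuous_map X euclideanreal f \<Longrightarrow> restrict f (topspace X) \<in> vcarrier (Cp X)"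
  by (auto simp: vcarrier_Cp intro: continuous_map_eq)

lemma vadd_Cp_closed: "f \<in> vcarrier (Cp X) \<Longrightarrow> g \<in> vcarrier (Cp X) \<Longrightarrow> vadd (Cp X) f g \<in> vcarrier (Cp X)"
  unfolding vadd_Cp by (intro restrict_in_Cp continuous_map_add) (auto simp: vcarrier_Cp)

lemma vscale_Cp_closed: "f \<in> vcarrier (Cp X) \<Longrightarrow> vscale (Cp X) c f \<in> vcarrier (Cp X)"
  unfolding vscale_Cp by (intro restrict_in_Cp continuous_map_real_mult continuous_map_const[THEN iffD2]) (auto simp: vcarrier_Cp)

lemma vzero_Cp_closed: "vzero (Cp X) \<in> vcarrier (Cp X)"
  unfolding vzero_Cp by (intro restrict_in_Cp) simp

lemma linear_subspace_vcarrier_Cp: "linear_subspace (Cp X) (vcarrier (Cp X))"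
  by (auto simp: linear_subspace_def vadd_Cp_closed vscale_Cp_closed vzero_Cp_closed)

lemma continuous_eval_Cp:
  assumes "p \<in> topspace X"
  shows "continuous_map (vtop (Cp X)) euclideanreal (\<lambda>f. f p)"
  unfolding vtop_Cp
  by (intro continuous_map_from_subtopology continuous_map_product_projection assms)

lemma continuous_pairing:
  assumes "finite (msupp a)" "msupp a \<subseteq> topspace X"
  shows "continuous_map (vtop (Cp X)) euclideanreal (pairing a)"
  unfolding pairing_def
  by (intro continuous_map_sum continuous_map_real_mult continuous_eval_Cp)
    (use assms in auto)

lemma continuous_map_into_real_power:
  assumes "f \<in> topspace Y \<rightarrow> extensional I" "\<And>i. i \<in> I \<Longrightarrow> continuous_map Y euclideanreal (\<lambda>y. f y i)"
  shows "continuous_map Y (product_topology (\<lambda>_. euclideanreal) I) f"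
  using assms by (auto simp: continuous_map_componentwise)

lemma real_power_nhd:
  assumes U: "openin (product_topology (\<lambda>_. euclideanreal) I) U" and f: "f \<in> U"
  obtains F \<epsilon> where "finite F" "F \<subseteq> I" "\<epsilon> > 0"
    "\<And>g. g \<in> extensional I \<Longrightarrow> (\<And>p. p \<in> F \<Longrightarrow> \<bar>g p - f p\<bar> < \<epsilon>) \<Longrightarrow> g \<in> U"
proof -
  obtain V where V: "finite {i \<in> I. V i \<noteq> topspace euclideanreal}" "\<And>i. i \<in> I \<Longrightarrow> openin euclideanreal (V i)"
    "f \<in> PiE I V" "PiE I V \<subseteq> U"
    using U[unfolded openin_product_topology_alt, rule_format, OF f] by (elim exE conjE) (rule that; simp)
  define F where "F = {i \<in> I. V i \<noteq> UNIV}"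
  have "\<exists>\<epsilon>>0. \<forall>y. \<bar>y - f p\<bar> < \<epsilon> \<longrightarrow> y \<in> V p" if "p \<in> F" for p
  proof -
    have "open (V p)" "f p \<in> V p" using V(2,3) that by (auto simp: F_def PiE_iff)
    then obtain \<epsilon> where \<epsilon>: "\<epsilon> > 0" "ball (f p) \<epsilon> \<subseteq> V p" by (rule openE)
    have "y \<in> V p" if "\<bar>y - f p\<bar> < \<epsilon>" for y
      using \<epsilon>(2) that by (auto simp: subset_eq dist_real_def abs_minus_commute)
    then show ?thesis using \<epsilon>(1) by blast
  qed
  then obtain e where e: "\<And>p. p \<in> F \<Longrightarrow> e p > 0" "\<And>p y. p \<in> F \<Longrightarrow> \<bar>y - f p\<bar> < e p \<Longrightarrow> y \<in> V p"
    by metis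
  have fin: "finite F" using V(1) by (simp add: F_def)
  define \<epsilon> where "\<epsilon> = Min (insert 1 (e ` F))"
  show thesis
  proof
    show "\<epsilon> > 0" using fin e(1) by (simp add: \<epsilon>_def)
    fix g assume g: "g \<in> extensional I" "\<And>p. p \<in> F \<Longrightarrow> \<bar>g p - f p\<bar> < \<epsilon>"
    have "g i \<in> V i" if "i \<in> I" for i
    proof (cases "i \<in> F")
      case True
      then have "\<epsilon> \<le> e i" using fin by (simp add: \<epsilon>_def)
      then show ?thesis using e(2)[OF True] g(2)[OF True] by simp
    next
      case False
      then show ?thesis using that by (simp add: F_def)
    qed
    then have "g \<in> PiE I V" using g(1) by (simp add: PiE_iff)
    then show "g \<in> U" using V(4) by blast
  qed (use fin in \<open>auto simp: F_def\<close>)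
qed

lemma Cp_nhd:
  assumes U: "openin (vtop (Cp X)) U" and f: "f \<in> U"
  obtains F \<epsilon> where "finite F" "F \<subseteq> topspace X" "\<epsilon> > 0"
    "\<forall>g\<in>vcarrier (Cp X). (\<forall>p\<in>F. \<bar>g p - f p\<bar> < \<epsilon>) \<longrightarrow> g \<in> U"
proof -
  obtain U' where U': "openin (product_topology (\<lambda>_. euclideanreal) (topspace X)) U'"
    "U = U' \<inter> {f. continuous_map X euclideanreal f}"
    using U by (auto simp: vtop_Cp openin_subtopology)
  obtain F \<epsilon> where F: "finite F" "F \<subseteq> topspace X" "\<epsilon> > 0"
    "\<And>g. g \<in> extensional (topspace X) \<Longrightarrow> (\<And>p. p \<in> F \<Longrightarrow> \<bar>g p - f p\<bar> < \<epsilon>) \<Longrightarrow> g \<in> U'"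
    using real_power_nhd[OF U'(1)] f U'(2) by (metis (no_types, lifting) IntD1)
  show thesis
    by (rule that[OF F(1-3)]) (use F(4) U'(2) in \<open>auto simp: vcarrier_Cp\<close>)
qed

lemma vadd_vscale_Cp_apply:
  "p \<in> topspace X \<Longrightarrow> vadd (Cp X) f (vscale (Cp X) c g) p = f p + c * g p"
  by (simp add: vadd_Cp vscale_Cp)

lemma pairing_vadd_vscale:
  assumes "finite (msupp a)" "msupp a \<subseteq> topspace X"
  shows "pairing a (vadd (Cp X) f (vscale (Cp X) c g)) = pairing a f + c * pairing a g"
proof -
  have "pairing a (vadd (Cp X) f (vscale (Cp X) c g)) = (\<Sum>p\<in>msupp a. a p * f p + c * (a p * g p))"
    unfolding pairing_def by (rule sum.cong) (use assms in \<open>auto simp: vadd_vscale_Cp_apply algebra_simps\<close>)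
  then show ?thesis by (simp add: pairing_def sum.distrib sum_distrib_left)
qed

lemma linear_subspace_vadd_vscale:
  "linear_subspace E S \<Longrightarrow> f \<in> S \<Longrightarrow> g \<in> S \<Longrightarrow> vadd E f (vscale E c g) \<in> S"
  by (simp add: linear_subspace_def)

definition dirac :: "'p \<Rightarrow> 'p \<Rightarrow> real" where
  "dirac x = (\<lambda>p. if p = x then 1 else 0)"

lemma msupp_dirac [simp]: "msupp (dirac x) = {x}"
  by (auto simp: msupp_def dirac_def)

lemma pairing_dirac [simp]: "pairing (dirac x) f = f x"
  by (simp add: pairing_def) (simp add: dirac_def)

text \<open>
  The usual fact that a functional vanishing on the common kernel of finitely many functionals is a linear
  combination of them, for the evaluations at the points of \<open>F\<close> on a subspace \<open>W\<close>.
\<close>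

lemma functional_eq_pairing_if_vanishing:
  assumes "finite F" "F \<subseteq> topspace X" and W: "linear_subspace (Cp X) W"
    and lin: "\<And>f g c. f \<in> W \<Longrightarrow> g \<in> W \<Longrightarrow> \<psi> (vadd (Cp X) f (vscale (Cp X) c g)) = \<psi> f + c * \<psi> g"
    and ker: "\<And>f. f \<in> W \<Longrightarrow> (\<And>p. p \<in> F \<Longrightarrow> f p = 0) \<Longrightarrow> \<psi> f = (0::real)"
  shows "\<exists>a. finite (msupp a) \<and> msupp a \<subseteq> F \<and> (\<forall>f\<in>W. \<psi> f = pairing a f)"
  using assms(1,2) lin ker
proof (induction F arbitrary: \<psi>)
  case empty
  have "msupp (\<lambda>_::'a. 0::real) = {}" by (simp add: msupp_def)
  then show ?case using empty.prems(3) by (intro exI[of _ "\<lambda>_. 0"]) (simp add: pairing_def)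
next
  case (insert x F)
  show ?case
  proof (cases "\<forall>f\<in>W. (\<forall>p\<in>F. f p = 0) \<longrightarrow> f x = 0")
    case True
    then have "\<exists>a. finite (msupp a) \<and> msupp a \<subseteq> F \<and> (\<forall>f\<in>W. \<psi> f = pairing a f)"
    proof (intro insert.IH)
      fix f assume "f \<in> W" "\<And>p. p \<in> F \<Longrightarrow> f p = 0"
      with True show "\<psi> f = 0" by (intro insert.prems(3)) auto
    qed (use insert.prems in auto)
    then show ?thesis by blast
  next
    case False
    then obtain f1 where f1: "f1 \<in> W" "\<forall>p\<in>F. f1 p = 0" "f1 x \<noteq> 0" by blast
    have top: "x \<in> topspace X" "F \<subseteq> topspace X" using insert.prems(1) by auto
    (* Subtracting c times the evaluation at x makes the functional vanish at f1. *)
    define c where "c = \<psi> f1 / f1 x"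
    have "\<exists>a. finite (msupp a) \<and> msupp a \<subseteq> F \<and> (\<forall>f\<in>W. \<psi> f - c * f x = pairing a f)"
    proof (rule insert.IH)
      show "\<psi> (vadd (Cp X) f (vscale (Cp X) d g)) - c * vadd (Cp X) f (vscale (Cp X) d g) x
        = \<psi> f - c * f x + d * (\<psi> g - c * g x)" if "f \<in> W" "g \<in> W" for f g d
        using that insert.prems(2) top by (simp add: vadd_vscale_Cp_apply algebra_simps)
      fix f assume f: "f \<in> W" "\<And>p. p \<in> F \<Longrightarrow> f p = 0"
      have "\<psi> (vadd (Cp X) f (vscale (Cp X) (- f x / f1 x) f1)) = 0"
      proof (rule insert.prems(3))
        show "vadd (Cp X) f (vscale (Cp X) (- f x / f1 x) f1) p = 0" if "p \<in> insert x F" for p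
        proof -
          have "p \<in> topspace X" using that top by auto
          then show ?thesis using f(2) f1 that by (auto simp: vadd_vscale_Cp_apply)
        qed
      qed (rule linear_subspace_vadd_vscale[OF W f(1) f1(1)])
      then show "\<psi> f - c * f x = 0"
        using insert.prems(2)[OF f(1) f1(1)] by (simp add: c_def field_simps)
    qed (use top in auto)
    then obtain a where a: "finite (msupp a)" "msupp a \<subseteq> F" "\<And>f. f \<in> W \<Longrightarrow> \<psi> f - c * f x = pairing a f"
      by blast
    let ?a = "\<lambda>p. a p - (- c) * dirac x p"
    have d: "finite (msupp (\<lambda>p. (- c) * dirac x p))" "msupp (\<lambda>p. (- c) * dirac x p) \<subseteq> {x}"
      using msupp_scale[of "- c" "dirac x"] by (auto intro: finite_subset)
    have "msupp ?a \<subseteq> insert x F"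
      using msupp_diff[of a "\<lambda>p. (- c) * dirac x p"] d(2) a(2) by blast
    moreover have "pairing ?a f = pairing a f - (- c) * f x" for f
      using pairing_diff[OF a(1) d(1), of f] pairing_scale[of "dirac x" "- c" f] by simp
    then have "\<forall>f\<in>W. \<psi> f = pairing ?a f"
      using a(3) by (auto simp: algebra_simps)
    ultimately show ?thesis
      using insert.hyps(1) by (intro exI[of _ ?a]) (auto intro: finite_subset)
  qed
qed

text \<open>
  A neighbourhood of zero only restricts the values at finitely many points, so a continuous functional vanishes on
  all functions that vanish at these points.
\<close>

lemma continuous_functional_eq_pairing:
  assumes cont: "continuous_map (vtop (Cp X)) euclideanreal \<psi>"
    and lin: "\<And>f g c. f \<in> vcarrier (Cp X) \<Longrightarrow> g \<in> vcarrier (Cp X) \<Longrightarrow>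
      \<psi> (vadd (Cp X) f (vscale (Cp X) c g)) = \<psi> f + c * \<psi> g"
  obtains a where "finite (msupp a)" "msupp a \<subseteq> topspace X" "\<And>f. f \<in> vcarrier (Cp X) \<Longrightarrow> \<psi> f = pairing a f"
proof -
  let ?C = "vcarrier (Cp X)" and ?o = "vzero (Cp X)"
  have z: "?o \<in> ?C" by (rule vzero_Cp_closed)
  have scale0: "vadd (Cp X) ?o (vscale (Cp X) c f) = vscale (Cp X) c f" for c f
    by (auto simp: vadd_Cp vzero_Cp vscale_Cp)
  have "vadd (Cp X) ?o (vscale (Cp X) 1 ?o) = ?o"
    by (auto simp: vadd_Cp vzero_Cp vscale_Cp)
  then have \<psi>0: "\<psi> ?o = 0" using lin[OF z z, of 1] by simp
  have "openin (vtop (Cp X)) {f \<in> ?C. \<psi> f \<in> {-1<..<1}}"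
    by (rule openin_continuous_map_preimage[OF cont]) simp
  moreover have "?o \<in> {f \<in> ?C. \<psi> f \<in> {-1<..<1}}" using z \<psi>0 by simp
  ultimately obtain F \<epsilon> where F: "finite F" "F \<subseteq> topspace X" "\<epsilon> > 0"
    "\<forall>g\<in>?C. (\<forall>p\<in>F. \<bar>g p - ?o p\<bar> < \<epsilon>) \<longrightarrow> g \<in> {f \<in> ?C. \<psi> f \<in> {-1<..<1}}"
    by (rule Cp_nhd) (rule that)
  have "\<psi> f = 0" if f: "f \<in> ?C" "\<And>p. p \<in> F \<Longrightarrow> f p = 0" for f
  proof (rule ccontr)
    assume nz: "\<psi> f \<noteq> 0"
    let ?g = "vscale (Cp X) (1 / \<psi> f) f"
    have "?g \<in> {f \<in> ?C. \<psi> f \<in> {-1<..<1}}"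
    proof (rule F(4)[rule_format])
      show "\<bar>?g p - ?o p\<bar> < \<epsilon>" if "p \<in> F" for p
      proof -
        have "p \<in> topspace X" using that F(2) by auto
        then show ?thesis using f(2)[OF that] F(3) by (simp add: vzero_Cp vscale_Cp)
      qed
    qed (rule vscale_Cp_closed[OF f(1)])
    moreover have "\<psi> ?g = 1" using lin[OF z f(1), of "1 / \<psi> f"] \<psi>0 nz by (simp add: scale0)
    ultimately show False by simp
  qed
  then obtain a where "finite (msupp a)" "msupp a \<subseteq> F" "\<And>f. f \<in> ?C \<Longrightarrow> \<psi> f = pairing a f"
    using functional_eq_pairing_if_vanishing[OF F(1,2) linear_subspace_vcarrier_Cp, of \<psi>] lin by metis
  then show thesis using that F(2) by blast
qed

text \<open>
  Closedness yields a finite set \<open>F\<close> on which no element of \<open>Z\<close> agrees with \<open>f\<close>. Shrink \<open>F\<close> as long as this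
  remains true. When a further point \<open>x\<close> is removed, some \<open>z\<^sub>0 \<in> Z\<close> agrees with \<open>f\<close> on the rest, and the value at \<open>x\<close> of elements of \<open>Z\<close> must be a
  linear combination of those at the other points; this relation fails for \<open>f\<close>.
\<close>

lemma separate_from_closed_subspace:
  assumes Z: "closed_linear_subspace (Cp X) Z" and f: "f \<in> vcarrier (Cp X)" "f \<notin> Z"
  obtains a where "finite (msupp a)" "msupp a \<subseteq> topspace X" "\<And>z. z \<in> Z \<Longrightarrow> pairing a z = 0" "pairing a f \<noteq> 0"
proof -
  have lin: "linear_subspace (Cp X) Z" and clo: "closedin (vtop (Cp X)) Z"
    using Z by (auto simp: closed_linear_subspace_def)
  have ZC: "Z \<subseteq> vcarrier (Cp X)" and Z0: "vzero (Cp X) \<in> Z" using lin by (auto simp: linear_subspace_def)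
  have "openin (vtop (Cp X)) (vcarrier (Cp X) - Z)" using clo by blast
  then obtain F \<epsilon> where F: "finite F" "F \<subseteq> topspace X" "\<epsilon> > 0"
    "\<forall>g\<in>vcarrier (Cp X). (\<forall>p\<in>F. \<bar>g p - f p\<bar> < \<epsilon>) \<longrightarrow> g \<in> vcarrier (Cp X) - Z"
    using Cp_nhd[of X "vcarrier (Cp X) - Z" f] f by blast
  have "\<forall>z\<in>Z. \<exists>p\<in>F. z p \<noteq> f p"
    using F(3,4) ZC by fastforce
  with F(1,2) have "\<exists>a. finite (msupp a) \<and> msupp a \<subseteq> topspace X \<and> (\<forall>z\<in>Z. pairing a z = 0) \<and> pairing a f \<noteq> 0"
  proof (induction F)
    case empty
    then show ?case using Z0 by auto
  next
    case (insert x F)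
    show ?case
    proof (cases "\<forall>z\<in>Z. \<exists>p\<in>F. z p \<noteq> f p")
      case True
      then show ?thesis using insert by auto
    next
      case False
      then obtain z0 where z0: "z0 \<in> Z" "\<And>p. p \<in> F \<Longrightarrow> z0 p = f p" by blast
      have z0x: "z0 x \<noteq> f x" using insert.prems(2) z0 by auto
      have top: "x \<in> topspace X" "F \<subseteq> topspace X" using insert.prems(1) by auto
      have "\<exists>a. finite (msupp a) \<and> msupp a \<subseteq> F \<and> (\<forall>z\<in>Z. z x = pairing a z)"
      proof (rule functional_eq_pairing_if_vanishing[OF insert.hyps(1) top(2) lin])
        fix z assume z: "z \<in> Z" "\<And>p. p \<in> F \<Longrightarrow> z p = 0"
        show "z x = 0"
        proof (rule ccontr)
          assume nz: "z x \<noteq> 0"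
          let ?w = "vadd (Cp X) z0 (vscale (Cp X) ((f x - z0 x) / z x) z)"
          have "?w \<in> Z" by (rule linear_subspace_vadd_vscale[OF lin z0(1) z(1)])
          moreover have "?w p = f p" if "p \<in> insert x F" for p
          proof -
            have "p \<in> topspace X" using that top by auto
            then show ?thesis using that z0(2) z(2) nz by (auto simp: vadd_vscale_Cp_apply)
          qed
          ultimately show False using insert.prems(2) by blast
        qed
      qed (use top in \<open>simp add: vadd_vscale_Cp_apply\<close>)
      then obtain a where a: "finite (msupp a)" "msupp a \<subseteq> F" "\<And>z. z \<in> Z \<Longrightarrow> z x = pairing a z" by blast
      let ?a = "\<lambda>p. a p - dirac x p"
      have p: "pairing ?a g = pairing a g - g x" for g
        using pairing_diff[OF a(1), of "dirac x" g] by simp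
      have "pairing a f = pairing a z0"
        unfolding pairing_def using a(2) z0(2) by (intro sum.cong) auto
      then have "pairing ?a f \<noteq> 0" using p[of f] a(3)[OF z0(1)] z0x by simp
      moreover have "msupp ?a \<subseteq> insert x F" using msupp_diff[of a "dirac x"] a(2) by auto
      moreover have "finite (msupp ?a)" using calculation(2) insert.hyps(1) by (meson finite_insert finite_subset)
      ultimately show ?thesis
        using p a(3) insert.prems(1) by (intro exI[of _ ?a]) auto
    qed
  qed
  then show thesis using that by blast
qed

text \<open>
  The common kernel of finitely many functionals has finite codimension. The conclusion is phrased by means of
  subspaces containing the generators, which is the form of the span as a hull.
\<close>

lemma finite_codimension_generators:
  assumes "finite \<Lambda>" "\<And>a. a \<in> \<Lambda> \<Longrightarrow> finite (msupp a)" "\<And>a. a \<in> \<Lambda> \<Longrightarrow> msupp a \<subseteq> topspace X"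
  shows "\<exists>B. finite B \<and> B \<subseteq> vcarrier (Cp X) \<and>
    (\<forall>S. linear_subspace (Cp X) S \<longrightarrow> B \<subseteq> S \<longrightarrow>
      (\<forall>f\<in>vcarrier (Cp X). (\<forall>a\<in>\<Lambda>. pairing a f = 0) \<longrightarrow> f \<in> S) \<longrightarrow> vcarrier (Cp X) \<subseteq> S)"
  using assms
proof (induction \<Lambda>)
  case empty
  then show ?case by (intro exI[of _ "{}"]) auto
next
  case (insert a \<Lambda>)
  let ?C = "vcarrier (Cp X)"
  obtain B where B: "finite B" "B \<subseteq> ?C"
    "\<And>S. linear_subspace (Cp X) S \<Longrightarrow> B \<subseteq> S \<Longrightarrow> (\<forall>f\<in>?C. (\<forall>a\<in>\<Lambda>. pairing a f = 0) \<longrightarrow> f \<in> S) \<Longrightarrow> ?C \<subseteq> S"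
    using insert by auto
  show ?case
  proof (cases "\<forall>f\<in>?C. (\<forall>b\<in>\<Lambda>. pairing b f = 0) \<longrightarrow> pairing a f = 0")
    case True
    then show ?thesis using B by (intro exI[of _ B]) auto
  next
    case False
    then obtain g where g: "g \<in> ?C" "\<forall>b\<in>\<Lambda>. pairing b g = 0" "pairing a g \<noteq> 0" by blast
    have "?C \<subseteq> S" if S: "linear_subspace (Cp X) S" "insert g B \<subseteq> S"
      "\<forall>f\<in>?C. (\<forall>b\<in>insert a \<Lambda>. pairing b f = 0) \<longrightarrow> f \<in> S" for S
    proof (rule B(3)[OF S(1)])
      show "\<forall>f\<in>?C. (\<forall>b\<in>\<Lambda>. pairing b f = 0) \<longrightarrow> f \<in> S"
      proof (intro ballI impI)
        fix f assume f: "f \<in> ?C" "\<forall>b\<in>\<Lambda>. pairing b f = 0"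
        define c where "c = pairing a f / pairing a g"
        let ?h = "vadd (Cp X) f (vscale (Cp X) (- c) g)"
        have "?h \<in> ?C" by (rule linear_subspace_vadd_vscale[OF linear_subspace_vcarrier_Cp f(1) g(1)])
        moreover have "pairing b ?h = 0" if "b \<in> insert a \<Lambda>" for b
          using that f g insert.prems by (auto simp: pairing_vadd_vscale c_def)
        ultimately have "?h \<in> S" using S(3) by blast
        then have "vadd (Cp X) ?h (vscale (Cp X) c g) \<in> S"
          by (rule linear_subspace_vadd_vscale[OF S(1)]) (use S(2) in auto)
        moreover have "vadd (Cp X) ?h (vscale (Cp X) c g) = f"
          using f(1) by (intro extensionalityI[of _ "topspace X"]) (auto simp: vadd_Cp vscale_Cp vcarrier_Cp)
        ultimately show "f \<in> S" by simp
      qed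
    qed (use S in auto)
    then show ?thesis using B(1,2) g(1) by (intro exI[of _ "insert g B"]) auto
  qed
qed

lemma finite_dimensional_image:
  assumes lin: "linear_map (Cp X) E q" and surj: "q ` vcarrier (Cp X) = vcarrier E"
    and \<Lambda>: "finite \<Lambda>" "\<And>a. a \<in> \<Lambda> \<Longrightarrow> finite (msupp a)" "\<And>a. a \<in> \<Lambda> \<Longrightarrow> msupp a \<subseteq> topspace X"
    and ker: "\<And>f. f \<in> vcarrier (Cp X) \<Longrightarrow> (\<And>a. a \<in> \<Lambda> \<Longrightarrow> pairing a f = 0) \<Longrightarrow> q f = vzero E"
    and zero: "q (vzero (Cp X)) = vzero E"
  shows "\<not> infinite_dimensional E"
proof -
  let ?C = "vcarrier (Cp X)"
  obtain B where B: "finite B" "B \<subseteq> ?C"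
    "\<And>S. linear_subspace (Cp X) S \<Longrightarrow> B \<subseteq> S \<Longrightarrow> (\<forall>f\<in>?C. (\<forall>a\<in>\<Lambda>. pairing a f = 0) \<longrightarrow> f \<in> S) \<Longrightarrow> ?C \<subseteq> S"
    using finite_codimension_generators[OF \<Lambda>] by metis
  have all: "vcarrier E \<subseteq> S" if S: "linear_subspace E S" "q ` B \<subseteq> S" for S
  proof -
    have "?C \<subseteq> {f \<in> ?C. q f \<in> S}"
    proof (rule B(3))
      show "linear_subspace (Cp X) {f \<in> ?C. q f \<in> S}"
        using S(1) lin zero unfolding linear_subspace_def linear_map_def
        by (auto simp: vadd_Cp_closed vscale_Cp_closed vzero_Cp_closed)
      show "B \<subseteq> {f \<in> ?C. q f \<in> S}" using B(2) S(2) by auto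
      show "\<forall>f\<in>?C. (\<forall>a\<in>\<Lambda>. pairing a f = 0) \<longrightarrow> f \<in> {f \<in> ?C. q f \<in> S}"
        using ker S(1) by (auto simp: linear_subspace_def)
    qed
    then have "q ` ?C \<subseteq> S" by blast
    then show ?thesis by (simp only: surj)
  qed
  have "linear_subspace E (vcarrier E)"
    unfolding linear_subspace_def
  proof (intro conjI ballI allI subset_refl)
    show "vzero E \<in> vcarrier E"
      unfolding zero[symmetric] surj[symmetric] by (intro imageI vzero_Cp_closed)
  next
    fix x y assume "x \<in> vcarrier E" "y \<in> vcarrier E"
    then obtain f g where fg: "f \<in> ?C" "g \<in> ?C" "x = q f" "y = q g" unfolding surj[symmetric] by blast
    then have "vadd E x y = q (vadd (Cp X) f g)" using lin by (simp add: linear_map_def)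
    then show "vadd E x y \<in> vcarrier E" using surj vadd_Cp_closed[OF fg(1,2)] by blast
  next
    fix c x assume "x \<in> vcarrier E"
    then obtain f where f: "f \<in> ?C" "x = q f" unfolding surj[symmetric] by blast
    then have "vscale E c x = q (vscale (Cp X) c f)" using lin by (simp add: linear_map_def)
    then show "vscale E c x \<in> vcarrier E" using surj vscale_Cp_closed[OF f(1)] by blast
  qed
  moreover have "q ` B \<subseteq> vcarrier E" using B(2) surj by blast
  ultimately have "linear_subspace E hull (q ` B) = vcarrier E"
    using all by (intro hull_unique) auto
  then show ?thesis
    using B(1) \<open>q ` B \<subseteq> vcarrier E\<close> unfolding infinite_dimensional_def by blast
qed

section \<open>The Stone-Cech compactification of the natural numbers\<close>

abbreviation C_beta :: "(((nat \<Rightarrow> real) \<Rightarrow> real) \<Rightarrow> real) set" where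
  "C_beta \<equiv> vcarrier (Cp beta_nat)"

definition nat_point :: "nat \<Rightarrow> (nat \<Rightarrow> real) \<Rightarrow> real" where
  "nat_point = stone_cech_map (discrete_topology UNIV)"

definition beta_hat :: "nat set \<Rightarrow> ((nat \<Rightarrow> real) \<Rightarrow> real) set" where
  "beta_hat A = {p \<in> topspace beta_nat. p (indicator A) = 1}"

lemma unit_interval_maps_nat: "unit_interval_maps (discrete_topology (UNIV::nat set)) = {f. range f \<subseteq> {0..1}}"
  by (auto simp: unit_interval_maps_def)

lemma nat_point_apply: "range f \<subseteq> {0..1} \<Longrightarrow> nat_point n f = f n"
  by (simp add: nat_point_def stone_cech_map_def unit_interval_maps_nat)

lemma nat_point_in_cube: "range nat_point \<subseteq> topspace (stone_cech_cube (discrete_topology UNIV))"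
  by (auto simp: nat_point_def stone_cech_map_def stone_cech_cube_def unit_interval_maps_nat PiE_def image_subset_iff)

lemma beta_nat_eq:
  "beta_nat = subtopology (stone_cech_cube (discrete_topology UNIV))
     (stone_cech_cube (discrete_topology UNIV) closure_of range nat_point)"
  by (simp add: beta_nat_def stone_cech_def nat_point_def)

lemma topspace_beta_nat: "topspace beta_nat = stone_cech_cube (discrete_topology UNIV) closure_of range nat_point"
  unfolding beta_nat_eq by (simp add: closure_of_subset_topspace inf.absorb2)

lemma nat_point_in_beta: "nat_point n \<in> topspace beta_nat"
  unfolding topspace_beta_nat using closure_of_subset[OF nat_point_in_cube] by blast

text \<open>
  All facts about \<open>\<beta>\<nat>\<close> are obtained from their trivial versions on the dense subset \<open>\<nat>\<close> by this
  principle.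
\<close>

lemma beta_nonneg_by_density:
  assumes g: "continuous_map beta_nat euclideanreal g" and nn: "\<And>n. 0 \<le> g (nat_point n)"
    and p: "p \<in> topspace beta_nat"
  shows "0 \<le> g p"
proof -
  let ?K = "stone_cech_cube (discrete_topology (UNIV::nat set))"
  let ?S = "{p \<in> topspace beta_nat. g p \<in> {0..}}"
  have "closedin beta_nat ?S"
    by (rule closedin_continuous_map_preimage[OF g]) simp
  then have "closedin ?K ?S"
    unfolding beta_nat_eq using closedin_closed_subtopology[OF closedin_closure_of] by blast
  moreover have "range nat_point \<subseteq> ?S" using nn nat_point_in_beta by auto
  ultimately have "?K closure_of range nat_point \<subseteq> ?S" by (meson closure_of_minimal)
  then show ?thesis using p unfolding topspace_beta_nat by auto
qed

lemma beta_le_by_density: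
  assumes "continuous_map beta_nat euclideanreal u" "continuous_map beta_nat euclideanreal v"
    and "\<And>n. u (nat_point n) \<le> v (nat_point n)" and "p \<in> topspace beta_nat"
  shows "u p \<le> v p"
  using beta_nonneg_by_density[of "\<lambda>p. v p - u p" p] assms by (simp add: continuous_map_diff)

lemma beta_eq_by_density:
  assumes "continuous_map beta_nat euclideanreal u" "continuous_map beta_nat euclideanreal v"
    and "\<And>n. u (nat_point n) = v (nat_point n)" and "p \<in> topspace beta_nat"
  shows "u p = v p"
  using beta_le_by_density[of u v p] beta_le_by_density[of v u p] assms by (simp add: order_antisym)

lemma continuous_beta_eval:
  assumes "range f \<subseteq> {0..1}"
  shows "continuous_map beta_nat euclideanreal (\<lambda>p. p f)"
proof -
  have "continuous_map beta_nat (top_of_set {0..1}) (\<lambda>p. p f)"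
    unfolding beta_nat_def by (rule stone_cech_extension) (use assms in \<open>simp add: unit_interval_maps_nat\<close>)
  then show ?thesis by (simp add: continuous_map_in_subtopology)
qed

lemma range_indicator: "range (indicator A :: nat \<Rightarrow> real) \<subseteq> {0..1}"
  by (auto simp: indicator_def)

lemma nat_point_indicator: "nat_point n (indicator A) = indicator A n"
  by (rule nat_point_apply[OF range_indicator])

lemmas beta_continuous_intros = continuous_map_add continuous_map_diff continuous_map_real_mult
  continuous_beta_eval range_indicator continuous_map_canonical_const

lemma beta_indicator_cases:
  assumes p: "p \<in> topspace beta_nat"
  shows "p (indicator A) = 0 \<or> p (indicator A) = 1"
proof -
  have "p (indicator A) * (1 - p (indicator A)) = 0"
    by (rule beta_eq_by_density[OF _ _ _ p]; (intro beta_continuous_intros)?) (simp only: nat_point_indicator, simp add: indicator_def)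
  then show ?thesis by auto
qed

lemma beta_indicator: "p \<in> topspace beta_nat \<Longrightarrow> p (indicator A) = indicator (beta_hat A) p"
  using beta_indicator_cases[of p A] by (auto simp: beta_hat_def indicator_def)

lemma nat_point_in_hat [simp]: "nat_point n \<in> beta_hat A \<longleftrightarrow> n \<in> A"
  by (simp add: beta_hat_def nat_point_in_beta nat_point_indicator) (simp add: indicator_def)

text \<open>
  The witness is \<open>A = {n. f n < r}\<close>: the inequality \<open>r (1 - 1\<^sub>A) \<le> f\<close> puts \<open>p\<close> into \<open>beta_hat A\<close>, and \<open>f \<le> r + (1 - 1\<^sub>A)\<close>
  keeps \<open>q\<close> out of it.
\<close>

lemma beta_hat_separates:
  assumes p: "p \<in> topspace beta_nat" and q: "q \<in> topspace beta_nat"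
    and f: "range f \<subseteq> {0..1}" and r: "p f < r" "r < q f"
  shows "\<exists>A. p \<in> beta_hat A \<and> q \<notin> beta_hat A"
proof -
  define A where "A = {n. f n < r}"
  have f01: "0 \<le> f n" "f n \<le> 1" for n using f by (auto simp: image_subset_iff)
  have "0 \<le> p f"
    by (rule beta_le_by_density[OF _ _ _ p]; (intro beta_continuous_intros f)?) (simp add: nat_point_apply[OF f] f01)
  then have r0: "0 < r" using r by simp
  have "r * (1 - p (indicator A)) \<le> p f"
    by (rule beta_le_by_density[OF _ _ _ p]; (intro beta_continuous_intros f)?)
      (simp only: nat_point_apply[OF f] nat_point_indicator, use f01 in \<open>auto simp: indicator_def A_def\<close>)
  then have "p (indicator A) \<noteq> 0" using r by auto
  moreover have "q f \<le> r + (1 - q (indicator A))"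
    by (rule beta_le_by_density[OF _ _ _ q]; (intro beta_continuous_intros f)?)
      (simp only: nat_point_apply[OF f] nat_point_indicator, use f01 r0 in \<open>auto simp: indicator_def A_def intro: add_increasing\<close>)
  then have "q (indicator A) \<noteq> 1" using r by auto
  ultimately show ?thesis
    using beta_indicator_cases[OF p, of A] p by (auto simp: beta_hat_def)
qed

lemma beta_extensional: "p \<in> topspace beta_nat \<Longrightarrow> p \<in> extensional {f. range f \<subseteq> {0..1}}"
  unfolding topspace_beta_nat using closure_of_subset_topspace[of "stone_cech_cube (discrete_topology (UNIV::nat set))"]
  by (auto simp: stone_cech_cube_def unit_interval_maps_nat PiE_def)

lemma beta_hat_Compl: "beta_hat (- A) = topspace beta_nat - beta_hat A"
proof -
  have "p (indicator (- A)) = 1 - p (indicator A)" if p: "p \<in> topspace beta_nat" for p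
    by (rule beta_eq_by_density[OF _ _ _ p]; (intro beta_continuous_intros)?) (simp only: nat_point_indicator, simp add: indicator_def)
  then show ?thesis using beta_indicator_cases[of _ A] by (force simp: beta_hat_def)
qed

interpretation beta: separating_algebra "topspace beta_nat" beta_hat
proof
  show "beta_hat (A \<inter> B) = beta_hat A \<inter> beta_hat B" for A B
  proof -
    have "p (indicator (A \<inter> B)) = p (indicator A) * p (indicator B)" if p: "p \<in> topspace beta_nat" for p
      by (rule beta_eq_by_density[OF _ _ _ p]; (intro beta_continuous_intros)?) (simp only: nat_point_indicator, simp add: indicator_def)
    then show ?thesis using beta_indicator_cases[of _ A] beta_indicator_cases[of _ B] by (force simp: beta_hat_def)
  qed
  show "beta_hat (- A) = topspace beta_nat - beta_hat A" for A
    by (rule beta_hat_Compl)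
  fix p q assume pq: "p \<in> topspace beta_nat" "q \<in> topspace beta_nat" "p \<noteq> q"
  then obtain f where f: "range f \<subseteq> {0..1}" "p f \<noteq> q f"
    using beta_extensional extensionalityI[of p "{f. range f \<subseteq> {0..1}}" q] by blast
  show "\<exists>A. p \<in> beta_hat A \<and> q \<notin> beta_hat A"
  proof (cases "p f < q f")
    case True
    then show ?thesis using dense[OF True] beta_hat_separates[OF pq(1,2) f(1)] by blast
  next
    case False
    then have "q f < p f" using f(2) by simp
    then obtain A where "q \<in> beta_hat A" "p \<notin> beta_hat A"
      using dense[of "q f" "p f"] beta_hat_separates[OF pq(2,1) f(1)] by blast
    then show ?thesis using pq beta_hat_Compl[of A] by blast
  qed
qed

lemma beta_hat_singleton:
  assumes "p \<in> beta_hat {n}"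
  shows "p = nat_point n"
proof (rule ccontr)
  have p: "p \<in> topspace beta_nat" using assms beta.hat_subset by blast
  assume "p \<noteq> nat_point n"
  then obtain A where A: "p \<in> beta_hat A" "nat_point n \<notin> beta_hat A"
    using beta.hat_separates[OF p nat_point_in_beta] by blast
  then have "{n} \<inter> A = {}" by auto
  then have "beta_hat {n} \<inter> beta_hat A = {}" by (metis beta.hat_Int beta.hat_empty)
  then show False using assms A by blast
qed

lemma beta_hat_finite: "finite A \<Longrightarrow> p \<in> beta_hat A \<Longrightarrow> p \<in> nat_point ` A"
  using beta.hat_UN[of A "\<lambda>n. {n}"] beta_hat_singleton by auto

lemma inj_nat_point: "inj nat_point"
proof (rule injI)
  fix m n assume "nat_point m = nat_point n"
  then have "nat_point m \<in> beta_hat {n}" by simp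
  then show "m = n" by simp
qed

lemma continuous_C_beta: "f \<in> C_beta \<Longrightarrow> continuous_map beta_nat euclideanreal f"
  by (simp add: vcarrier_Cp)

lemma C_beta_extension:
  assumes "\<And>n. \<bar>x n\<bar> \<le> K"
  obtains f where "f \<in> C_beta" "\<And>n. f (nat_point n) = x n"
proof -
  (* Using K + 1 instead of K keeps the denominator positive when x vanishes. *)
  define u where "u n = (x n + (K + 1)) / (2 * (K + 1))" for n
  have K: "K \<ge> 0" using assms[of 0] by linarith
  have "0 \<le> u n \<and> u n \<le> 1" for n
    using assms[of n] K by (auto simp: u_def field_simps abs_le_iff)
  then have u: "range u \<subseteq> {0..1}" by auto
  define f where "f = (\<lambda>p\<in>topspace beta_nat. 2 * (K + 1) * p u - (K + 1))"
  show thesis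
  proof
    show "f \<in> C_beta" unfolding f_def by (intro restrict_in_Cp beta_continuous_intros u)
    show "f (nat_point n) = x n" for n
      using K by (simp add: f_def nat_point_in_beta nat_point_apply[OF u]) (simp add: u_def)
  qed
qed

lemma C_beta_bounded:
  assumes "f \<in> C_beta"
  obtains K where "\<And>p. p \<in> topspace beta_nat \<Longrightarrow> \<bar>f p\<bar> \<le> K"
proof -
  have "compactin euclideanreal (f ` topspace beta_nat)"
    using image_compactin[OF _ continuous_C_beta[OF assms]] compact_space_stone_cech
    by (metis beta_nat_def compact_space_def)
  then have "bounded (f ` topspace beta_nat)"
    by (simp add: compact_imp_bounded)
  then show thesis using that by (auto simp: bounded_iff)
qed

lemma mass_hat_eq_pairing:
  assumes "finite (msupp a)" "msupp a \<subseteq> topspace beta_nat"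
  shows "mass a (beta_hat A) = pairing a (\<lambda>p\<in>topspace beta_nat. p (indicator A))"
  unfolding mass_eq_pairing[OF assms(1)] pairing_def
  by (rule sum.cong) (use assms(2) beta_indicator in auto)

lemma indicator_in_C_beta: "(\<lambda>p\<in>topspace beta_nat. p (indicator A)) \<in> C_beta"
  by (intro restrict_in_Cp beta_continuous_intros)

text \<open>
  Dividing each measure by its norm, if this exceeds one, gives a bounded sequence that is still null on \<open>C(\<beta>\<nat>)\<close>, hence
  null in norm; so the norms were below one from some point on, where nothing was changed.
\<close>

theorem beta_weak_star_null_imp_norm_null:
  assumes fin: "\<And>k::nat. finite (msupp (a k))" and supp: "\<And>k. msupp (a k) \<subseteq> topspace beta_nat"
    and null: "\<And>f. f \<in> C_beta \<Longrightarrow> (\<lambda>k. pairing (a k) f) \<longlonglongrightarrow> 0"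
  shows "(\<lambda>k. variation (a k) UNIV) \<longlonglongrightarrow> 0"
proof -
  define v where "v k = variation (a k) UNIV" for k
  define c where "c k = 1 / max 1 (v k)" for k
  let ?b = "\<lambda>k p. c k * a k p"
  have v0: "0 \<le> v k" for k by (simp add: v_def variation_nonneg)
  have c: "0 < c k" "c k \<le> 1" "c k * v k \<le> 1" for k using v0[of k] by (auto simp: c_def divide_simps max_def)
  have finb: "finite (msupp (?b k))" for k by (rule finite_subset[OF msupp_scale fin])
  have suppb: "msupp (?b k) \<subseteq> topspace beta_nat" for k by (rule subset_trans[OF msupp_scale supp])
  have var: "variation (?b k) UNIV = c k * v k" for k using c[of k] by (simp add: variation_scale[OF fin] v_def)
  have "(\<lambda>k. variation (?b k) UNIV) \<longlonglongrightarrow> 0"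
  proof (rule beta.setwise_null_imp_norm_null[OF finb suppb])
    show "variation (?b k) UNIV \<le> 1" for k using var c by simp
    fix A
    let ?f = "\<lambda>p\<in>topspace beta_nat. p (indicator A)"
    show "(\<lambda>k. mass (?b k) (beta_hat A)) \<longlonglongrightarrow> 0"
    proof (rule Lim_null_comparison)
      show "(\<lambda>k. \<bar>pairing (a k) ?f\<bar>) \<longlonglongrightarrow> 0"
        using tendsto_rabs_zero[OF null[OF indicator_in_C_beta]] .
      show "\<forall>\<^sub>F k in sequentially. norm (mass (?b k) (beta_hat A)) \<le> \<bar>pairing (a k) ?f\<bar>"
      proof (rule always_eventually, rule allI)
        fix k
        have "mass (?b k) (beta_hat A) = c k * pairing (a k) ?f"
          by (simp only: mass_hat_eq_pairing[OF finb suppb] pairing_scale[OF fin])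
        then show "norm (mass (?b k) (beta_hat A)) \<le> \<bar>pairing (a k) ?f\<bar>"
          using c[of k] by (simp add: abs_mult mult_left_le_one_le)
      qed
    qed
  qed
  then have lim: "(\<lambda>k. c k * v k) \<longlonglongrightarrow> 0" by (simp add: var)
  have "\<forall>\<^sub>F k in sequentially. c k * v k < 1" by (rule order_tendstoD(2)[OF lim]) simp
  then have "\<forall>\<^sub>F k in sequentially. c k * v k = v k"
    by eventually_elim (auto simp: c_def max_def split: if_splits)
  then have "v \<longlonglongrightarrow> 0" by (rule Lim_transform_eventually[OF lim])
  then show ?thesis by (simp add: v_def[abs_def])
qed

section \<open>Quotients of spaces of continuous functions\<close>

lemma vtop_quotient: "vtop (quotient_tvs E Z) = quotient_topology (vtop E) (vcoset E Z)"
  by (simp add: quotient_tvs_def)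

lemma quotient_map_vcoset: "quotient_map (vtop E) (vtop (quotient_tvs E Z)) (vcoset E Z)"
  unfolding vtop_quotient by (rule quotient_map_quotient_topology)

lemma vcarrier_quotient: "vcarrier (quotient_tvs E Z) = vcoset E Z ` vcarrier E"
  using quotient_imp_surjective_map[OF quotient_map_vcoset] by metis

lemma vcoset_eq_iff:
  assumes Z: "linear_subspace (Cp X) Z" and fg: "f \<in> vcarrier (Cp X)" "g \<in> vcarrier (Cp X)"
  shows "vcoset (Cp X) Z f = vcoset (Cp X) Z g \<longleftrightarrow> vadd (Cp X) f (vscale (Cp X) (-1) g) \<in> Z"
proof -
  let ?o = "vzero (Cp X)"
  have ext: "h \<in> extensional (topspace X)" if "h \<in> Z \<or> h = f \<or> h = g" for h
  proof -
    have "Z \<subseteq> vcarrier (Cp X)" using Z by (simp add: linear_subspace_def)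
    then have "h \<in> vcarrier (Cp X)" using that fg by blast
    then show ?thesis by (simp add: vcarrier_Cp)
  qed
  show ?thesis
  proof
    assume eq: "vcoset (Cp X) Z f = vcoset (Cp X) Z g"
    have "f = vadd (Cp X) f ?o" using ext by (auto simp: vadd_Cp vzero_Cp fun_eq_iff extensional_def)
    then have "f \<in> vcoset (Cp X) Z g"
      using Z eq by (metis image_eqI linear_subspace_def vcoset_def)
    then obtain z where z: "z \<in> Z" "f = vadd (Cp X) g z" by (auto simp: vcoset_def)
    have "z \<in> extensional (topspace X)" using ext z(1) by simp
    then have "vadd (Cp X) f (vscale (Cp X) (-1) g) = z"
      unfolding z(2) by (auto simp: vadd_Cp vscale_Cp fun_eq_iff extensional_def)
    then show "vadd (Cp X) f (vscale (Cp X) (-1) g) \<in> Z" using z by simp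
  next
    let ?d = "vadd (Cp X) f (vscale (Cp X) (-1) g)"
    assume d: "?d \<in> Z"
    have "vadd (Cp X) f z = vadd (Cp X) g (vadd (Cp X) z (vscale (Cp X) 1 ?d))"
       "vadd (Cp X) g z = vadd (Cp X) f (vadd (Cp X) z (vscale (Cp X) (-1) ?d))" for z
      by (auto simp: vadd_Cp vscale_Cp fun_eq_iff)
    then show "vcoset (Cp X) Z f = vcoset (Cp X) Z g"
      using linear_subspace_vadd_vscale[OF Z _ d] unfolding vcoset_def by (metis (no_types, lifting) image_cong image_eqI subsetI subset_antisym image_subsetI)
  qed
qed

lemma linear_map_vcoset:
  assumes Z: "linear_subspace (Cp X) Z"
  shows "linear_map (Cp X) (quotient_tvs (Cp X) Z) (vcoset (Cp X) Z)"
proof -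
  let ?Q = "quotient_tvs (Cp X) Z" and ?q = "vcoset (Cp X) Z" and ?o = "vzero (Cp X)"
  have o: "?o \<in> Z" using Z by (simp add: linear_subspace_def)
  have "?q (vadd (Cp X) f g) = vadd ?Q (?q f) (?q g)" for f g
  proof
    have "vadd (Cp X) (vadd (Cp X) f g) z = vadd (Cp X) (vadd (Cp X) f z) (vadd (Cp X) g ?o)" for z
      by (auto simp: vadd_Cp vzero_Cp fun_eq_iff)
    then show "?q (vadd (Cp X) f g) \<subseteq> vadd ?Q (?q f) (?q g)"
      unfolding quotient_tvs_def vcoset_def using o by auto
    have "vadd (Cp X) (vadd (Cp X) f z) (vadd (Cp X) g z') = vadd (Cp X) (vadd (Cp X) f g) (vadd (Cp X) z z')" for z z'
      by (auto simp: vadd_Cp fun_eq_iff)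
    then show "vadd ?Q (?q f) (?q g) \<subseteq> ?q (vadd (Cp X) f g)"
      unfolding quotient_tvs_def vcoset_def using Z by (auto simp: linear_subspace_def)
  qed
  moreover have "?q (vscale (Cp X) c f) = vscale ?Q c (?q f)" for c f
  proof
    have "vadd (Cp X) (vscale (Cp X) c f) z = vadd (Cp X) (vscale (Cp X) c (vadd (Cp X) f ?o)) z" for z
      by (auto simp: vadd_Cp vzero_Cp vscale_Cp fun_eq_iff)
    then show "?q (vscale (Cp X) c f) \<subseteq> vscale ?Q c (?q f)"
      unfolding quotient_tvs_def vcoset_def using o by auto
    have "vadd (Cp X) (vscale (Cp X) c (vadd (Cp X) f z)) z' =
        vadd (Cp X) (vscale (Cp X) c f) (vadd (Cp X) z' (vscale (Cp X) c z))" for z z'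
      by (auto simp: vadd_Cp vscale_Cp fun_eq_iff algebra_simps)
    then show "vscale ?Q c (?q f) \<subseteq> ?q (vscale (Cp X) c f)"
      unfolding quotient_tvs_def vcoset_def using linear_subspace_vadd_vscale[OF Z] by auto
  qed
  ultimately show ?thesis by (simp add: linear_map_def vcarrier_quotient)
qed

lemma vcoset_zero:
  assumes "linear_subspace (Cp X) Z"
  shows "vcoset (Cp X) Z (vzero (Cp X)) = vzero (quotient_tvs (Cp X) Z)"
proof -
  have "vadd (Cp X) (vzero (Cp X)) z = z" if "z \<in> Z" for z
    using that assms by (auto simp: linear_subspace_def vcarrier_Cp vadd_Cp vzero_Cp fun_eq_iff extensional_def)
  then show ?thesis by (simp add: vcoset_def quotient_tvs_def)
qed

text \<open>
  A linear map that is a topological quotient map factors over the algebraic quotient by its kernel, and the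
  factor is an injective quotient map.
\<close>

lemma isomorphic_quotient:
  assumes Z: "linear_subspace (Cp X) Z" and lin: "linear_map (Cp X) E T"
    and quo: "quotient_map (vtop (Cp X)) (vtop E) T"
    and ker: "\<And>f g. f \<in> vcarrier (Cp X) \<Longrightarrow> g \<in> vcarrier (Cp X) \<Longrightarrow>
      T f = T g \<longleftrightarrow> vadd (Cp X) f (vscale (Cp X) (-1) g) \<in> Z"
  shows "isomorphic_tvs (quotient_tvs (Cp X) Z) E"
proof -
  let ?Q = "quotient_tvs (Cp X) Z" and ?q = "vcoset (Cp X) Z" and ?C = "vcarrier (Cp X)"
  have fib: "?q f = ?q g \<longleftrightarrow> T f = T g" if "f \<in> ?C" "g \<in> ?C" for f g
    using vcoset_eq_iff[OF Z that] ker[OF that] by simp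
  obtain \<phi> where \<phi>: "continuous_map (vtop ?Q) (vtop E) \<phi>" "\<And>f. f \<in> ?C \<Longrightarrow> \<phi> (?q f) = T f"
    by (rule quotient_map_lift_exists[OF quotient_map_vcoset quotient_imp_continuous_map[OF quo], of Z])
      (use fib in auto)
  have "quotient_map (vtop (Cp X)) (vtop E) (\<phi> \<circ> ?q)"
    using quotient_map_eq[OF quo, of "\<phi> \<circ> ?q"] \<phi>(2) by simp
  then have "quotient_map (vtop ?Q) (vtop E) \<phi>"
    using quotient_map_from_composition[OF quotient_imp_continuous_map[OF quotient_map_vcoset] \<phi>(1)] by blast
  moreover have "inj_on \<phi> (vcarrier ?Q)"
    unfolding vcarrier_quotient
  proof (rule inj_onI)
    fix y z assume "y \<in> ?q ` ?C" "z \<in> ?q ` ?C" and eq: "\<phi> y = \<phi> z"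
    then obtain f g where "f \<in> ?C" "g \<in> ?C" "y = ?q f" "z = ?q g" by blast
    then show "y = z" using fib[of f g] \<phi>(2) eq by simp
  qed
  moreover have "linear_map ?Q E \<phi>"
  proof -
    have q: "linear_map (Cp X) ?Q ?q" by (rule linear_map_vcoset[OF Z])
    have "\<phi> (vadd ?Q (?q f) (?q g)) = vadd E (\<phi> (?q f)) (\<phi> (?q g))" if "f \<in> ?C" "g \<in> ?C" for f g
      using q lin that \<phi>(2) vadd_Cp_closed[OF that] unfolding linear_map_def by metis
    moreover have "\<phi> (vscale ?Q c (?q f)) = vscale E c (\<phi> (?q f))" if "f \<in> ?C" for f c
      using q lin that \<phi>(2) vscale_Cp_closed[OF that] unfolding linear_map_def by metis
    moreover have "\<phi> (?q f) \<in> vcarrier E" if "f \<in> ?C" for f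
      using \<phi>(2) lin that by (auto simp: linear_map_def)
    ultimately show ?thesis by (auto simp: linear_map_def vcarrier_quotient)
  qed
  ultimately show ?thesis by (auto simp: isomorphic_tvs_def homeomorphic_map_def)
qed

section \<open>A quotient isomorphic to the space of bounded sequences\<close>

lemma vcarrier_linf: "vcarrier linf_space = {x. bounded (range x)}"
  and vcarrier_c0: "vcarrier c0_space = {x. x \<longlonglongrightarrow> 0}"
  by (simp_all add: linf_space_def c0_space_def subspace_tvs_def real_power_def)

lemma vtop_linf: "vtop linf_space = subtopology (product_topology (\<lambda>_. euclideanreal) UNIV) {x. bounded (range x)}"
  and vtop_c0: "vtop c0_space = subtopology (product_topology (\<lambda>_. euclideanreal) UNIV) {x. x \<longlonglongrightarrow> 0}"
  by (simp_all add: linf_space_def c0_space_def subspace_tvs_def real_power_def)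

lemma vadd_linf: "vadd linf_space x y = (\<lambda>n. x n + y n)"
  and vscale_linf: "vscale linf_space c x = (\<lambda>n. c * x n)"
  and vadd_c0: "vadd c0_space x y = (\<lambda>n. x n + y n)"
  and vscale_c0: "vscale c0_space c x = (\<lambda>n. c * x n)"
  by (simp_all add: linf_space_def c0_space_def subspace_tvs_def real_power_def fun_eq_iff)

lemma continuous_eval_nat: "continuous_map (product_topology (\<lambda>_. euclideanreal) UNIV) euclideanreal (\<lambda>x. x (n::nat))"
  by (intro continuous_map_product_projection) simp

text \<open>
  The natural numbers are arranged as a square, and the weights decrease along each row, so that the value in row \<open>n\<close>
  can be changed at any place \<open>(n, j)\<close> with \<open>j \<le> n\<close> by a function whose size is controlled by \<open>j\<close> alone.
\<close>

definition dyadic_sums :: "(((nat \<Rightarrow> real) \<Rightarrow> real) \<Rightarrow> real) \<Rightarrow> nat \<Rightarrow> real" where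
  "dyadic_sums f n = (\<Sum>i\<le>n. (1/2)^i * f (nat_point (prod_encode (n, i))))"

lemma sum_half_powers_le: "(\<Sum>i\<le>n. (1/2::real)^i) \<le> 2"
proof -
  have "(\<Sum>i\<le>n. (1/2::real)^i) = 2 - (1/2)^n" by (induction n) (auto simp: field_simps)
  then show ?thesis by simp
qed

lemma dyadic_sums_bounded:
  assumes "f \<in> C_beta"
  shows "bounded (range (dyadic_sums f))"
proof -
  obtain K where K: "\<And>p. p \<in> topspace beta_nat \<Longrightarrow> \<bar>f p\<bar> \<le> K" using C_beta_bounded[OF assms] by metis
  have K0: "0 \<le> K" using K[OF nat_point_in_beta, of 0] by linarith
  have "\<bar>dyadic_sums f n\<bar> \<le> 2 * K" for n
  proof -
    have "\<bar>dyadic_sums f n\<bar> \<le> (\<Sum>i\<le>n. \<bar>(1/2)^i * f (nat_point (prod_encode (n, i)))\<bar>)"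
      unfolding dyadic_sums_def by (rule sum_abs)
    also have "\<dots> \<le> (\<Sum>i\<le>n. (1/2)^i * K)"
      by (rule sum_mono) (simp add: abs_mult K nat_point_in_beta mult_left_mono)
    also have "\<dots> = (\<Sum>i\<le>n. (1/2)^i) * K" by (simp add: sum_distrib_right)
    also have "\<dots> \<le> 2 * K" by (rule mult_right_mono[OF sum_half_powers_le K0])
    finally show ?thesis .
  qed
  then show ?thesis by (auto simp: bounded_iff intro!: exI[of _ "2 * K"])
qed

lemma dyadic_sums_add_scale:
  "dyadic_sums (vadd (Cp beta_nat) f (vscale (Cp beta_nat) c g)) n = dyadic_sums f n + c * dyadic_sums g n"
  by (simp add: dyadic_sums_def vadd_vscale_Cp_apply nat_point_in_beta sum.distrib sum_distrib_left algebra_simps)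

lemma dyadic_sums_linear: "linear_map (Cp beta_nat) linf_space dyadic_sums"
proof -
  have "dyadic_sums (vadd (Cp beta_nat) f g) = (\<lambda>n. dyadic_sums f n + dyadic_sums g n)" for f g
    by (rule ext) (simp add: dyadic_sums_def vadd_Cp nat_point_in_beta sum.distrib algebra_simps)
  moreover have "dyadic_sums (vscale (Cp beta_nat) c f) = (\<lambda>n. c * dyadic_sums f n)" for f c
    by (rule ext) (simp add: dyadic_sums_def vscale_Cp nat_point_in_beta sum_distrib_left algebra_simps)
  ultimately show ?thesis
    by (auto simp: linear_map_def vadd_linf vscale_linf vcarrier_linf dyadic_sums_bounded)
qed

lemma continuous_dyadic_sums_coordinate:
  "continuous_map (vtop (Cp beta_nat)) euclideanreal (\<lambda>f. dyadic_sums f n)"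
  unfolding dyadic_sums_def
  by (intro continuous_map_sum continuous_map_real_mult continuous_eval_Cp nat_point_in_beta) auto

lemma continuous_dyadic_sums: "continuous_map (vtop (Cp beta_nat)) (vtop linf_space) dyadic_sums"
  unfolding vtop_linf continuous_map_in_subtopology
proof
  show "continuous_map (vtop (Cp beta_nat)) (product_topology (\<lambda>_. euclideanreal) UNIV) dyadic_sums"
    by (intro continuous_map_into_real_power continuous_dyadic_sums_coordinate) auto
qed (use dyadic_sums_bounded in auto)

text \<open>
  In the rows from \<open>j\<close> on the preimage lives in column \<open>j\<close>, which avoids \<open>F\<close>; the finitely many rows above do not reach
  column \<open>j\<close>, but there \<open>z\<close> is small and column \<open>0\<close> has weight one.
\<close>

lemma dyadic_sums_right_inverse_small:
  assumes F: "finite F" "F \<subseteq> topspace beta_nat" and z: "bounded (range z)" and \<delta>: "\<delta> \<ge> 0"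
    and j: "F \<inter> beta_hat {k. snd (prod_decode k) = j} = {}" and small: "\<And>n. n < j \<Longrightarrow> \<bar>z n\<bar> \<le> \<delta>"
  obtains h where "h \<in> C_beta" "dyadic_sums h = z" "\<And>p. p \<in> F \<Longrightarrow> \<bar>h p\<bar> \<le> \<delta>"
proof -
  obtain K where K: "\<And>n. \<bar>z n\<bar> \<le> K" using z by (auto simp: bounded_iff)
  have K0: "0 \<le> K" using K[of 0] by linarith
  define pos where "pos n = (if n < j then 0 else j)" for n
  define x where "x k = (case prod_decode k of (n, i) \<Rightarrow> if i = pos n then 2 ^ i * z n else 0)" for k
  have x: "x (prod_encode (n, i)) = (if i = pos n then 2 ^ i * z n else 0)" for n i
    by (simp add: x_def)
  have xK: "\<bar>x k\<bar> \<le> 2 ^ j * K" for k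
  proof -
    obtain n i where k: "k = prod_encode (n, i)" by (metis prod.collapse prod_decode_inverse)
    have "(2::real) ^ pos n \<le> 2 ^ j" by (intro power_increasing) (auto simp: pos_def)
    then have "\<bar>2 ^ pos n * z n\<bar> \<le> 2 ^ j * K" using K[of n] by (simp add: abs_mult mult_mono)
    then show ?thesis using K0 by (simp add: k x)
  qed
  obtain h where h: "h \<in> C_beta" "\<And>k. h (nat_point k) = x k"
    by (rule C_beta_extension[OF xK]) (rule that)
  let ?L = "{k. snd (prod_decode k) = j}"
  have xsmall: "\<bar>x k\<bar> \<le> \<delta> + 2 ^ j * K * indicator ?L k" for k
  proof (cases "k \<in> ?L")
    case True
    then show ?thesis using xK[of k] \<delta> by simp
  next
    case False
    obtain n i where k: "k = prod_encode (n, i)" by (metis prod.collapse prod_decode_inverse)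
    have "i \<noteq> j" using False by (simp add: k)
    then show ?thesis using small[of n] \<delta> by (auto simp: k x pos_def)
  qed
  show thesis
  proof
    show "h \<in> C_beta" by fact
    show "dyadic_sums h = z"
    proof
      fix n
      have "pos n \<le> n" by (simp add: pos_def)
      have "dyadic_sums h n = (\<Sum>i\<le>n. if i = pos n then z n else 0)"
        unfolding dyadic_sums_def h(2) x by (rule sum.cong) (auto simp: power_one_over)
      then show "dyadic_sums h n = z n" using \<open>pos n \<le> n\<close> by simp
    qed
    fix p assume p: "p \<in> F"
    then have pX: "p \<in> topspace beta_nat" using F by auto
    have ind: "continuous_map beta_nat euclideanreal (\<lambda>p. \<delta> + 2 ^ j * K * p (indicator ?L))"
      by (intro beta_continuous_intros)
    have "h p \<le> \<delta> + 2 ^ j * K * p (indicator ?L)"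
      by (rule beta_le_by_density[OF continuous_C_beta[OF h(1)] ind _ pX])
        (use xsmall in \<open>simp only: h(2) nat_point_indicator abs_le_iff\<close>)
    moreover have "- h p \<le> \<delta> + 2 ^ j * K * p (indicator ?L)"
      by (rule beta_le_by_density[OF continuous_map_minus[OF continuous_C_beta[OF h(1)]] ind _ pX])
        (use xsmall in \<open>simp only: h(2) nat_point_indicator abs_le_iff\<close>)
    moreover have "p (indicator ?L) = 0" using j p pX by (auto simp: beta_indicator indicator_def)
    ultimately show "\<bar>h p\<bar> \<le> \<delta>" by simp
  qed
qed

lemma dyadic_sums_surj: "dyadic_sums ` C_beta = vcarrier linf_space"
proof
  show "dyadic_sums ` C_beta \<subseteq> vcarrier linf_space" using dyadic_sums_bounded by (auto simp: vcarrier_linf)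
  show "vcarrier linf_space \<subseteq> dyadic_sums ` C_beta"
  proof
    fix z assume "z \<in> vcarrier linf_space"
    then have "bounded (range z)" by (simp add: vcarrier_linf)
    then obtain h where "h \<in> C_beta" "dyadic_sums h = z"
      using dyadic_sums_right_inverse_small[of "{}" z 0 0] by auto
    then show "z \<in> dyadic_sums ` C_beta" by blast
  qed
qed

text \<open>
  The columns are disjoint, so each of the finitely many points is in the closure of at most one of them.
\<close>

lemma avoid_some_member:
  assumes "finite F" "F \<subseteq> topspace beta_nat"
  shows "\<exists>j::nat. F \<inter> beta_hat {k. g k = j} = {}"
proof (rule ccontr)
  assume "\<not> ?thesis"
  then obtain p where p: "\<And>j. p j \<in> F" "\<And>j. p j \<in> beta_hat {k. g k = j}" by (auto simp: disjoint_iff) metis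
  have "inj p"
  proof (rule injI, rule ccontr)
    fix i j assume "p i = p j" "i \<noteq> j"
    moreover have "{k. g k = i} \<inter> {k. g k = j} = {}" using \<open>i \<noteq> j\<close> by auto
    ultimately show False using p by (metis IntI beta.hat_Int beta.hat_empty empty_iff)
  qed
  moreover have "finite (range p)" using p(1) assms(1) by (meson finite_subset image_subsetI)
  ultimately show False using finite_imageD infinite_UNIV_nat by blast
qed

lemma open_dyadic_sums: "open_map (vtop (Cp beta_nat)) (vtop linf_space) dyadic_sums"
  unfolding open_map_def
proof (intro allI impI)
  fix U assume U: "openin (vtop (Cp beta_nat)) U"
  have UC: "U \<subseteq> C_beta" using openin_subset[OF U] .
  show "openin (vtop linf_space) (dyadic_sums ` U)"
  proof (subst openin_subopen, intro ballI)
    fix y assume "y \<in> dyadic_sums ` U"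
    then obtain f where f: "f \<in> U" "y = dyadic_sums f" by blast
    obtain F \<epsilon> where F: "finite F" "F \<subseteq> topspace beta_nat" "\<epsilon> > 0"
      "\<forall>g\<in>C_beta. (\<forall>p\<in>F. \<bar>g p - f p\<bar> < \<epsilon>) \<longrightarrow> g \<in> U"
      by (rule Cp_nhd[OF U f(1)]) (rule that)
    obtain j where j: "F \<inter> beta_hat {k. snd (prod_decode k) = j} = {}"
      using avoid_some_member[OF F(1,2), of "\<lambda>k. snd (prod_decode k)"] by blast
    let ?N = "{x \<in> vcarrier linf_space. \<forall>n<j. x n \<in> {y n - \<epsilon>/2 <..< y n + \<epsilon>/2}}"
    have yb: "bounded (range y)" using dyadic_sums_bounded UC f by auto
    have "openin (vtop linf_space) ({x \<in> vcarrier linf_space. x n \<in> {y n - \<epsilon>/2 <..< y n + \<epsilon>/2}})" for n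
      by (rule openin_continuous_map_preimage)
        (auto simp: vtop_linf intro!: continuous_map_from_subtopology continuous_eval_nat)
    then have "openin (vtop linf_space) (vcarrier linf_space \<inter> (\<Inter>n\<in>{..<j}. {x \<in> vcarrier linf_space. x n \<in> {y n - \<epsilon>/2 <..< y n + \<epsilon>/2}}))"
      by (intro openin_Int_Inter) auto
    moreover have "vcarrier linf_space \<inter> (\<Inter>n\<in>{..<j}. {x \<in> vcarrier linf_space. x n \<in> {y n - \<epsilon>/2 <..< y n + \<epsilon>/2}}) = ?N"
      by auto
    ultimately have "openin (vtop linf_space) ?N" by simp
    moreover have "y \<in> ?N" using F(3) yb by (auto simp: vcarrier_linf)
    moreover have "?N \<subseteq> dyadic_sums ` U"
    proof
      fix x assume x: "x \<in> ?N"
      let ?z = "\<lambda>n. x n - y n"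
      have "bounded (range ?z)" using x yb by (intro bounded_minus_comp) (auto simp: vcarrier_linf)
      moreover have "\<bar>?z n\<bar> \<le> \<epsilon>/2" if "n < j" for n using x that by (auto simp: abs_le_iff field_simps) (smt (verit) field_sum_of_halves)+
      ultimately obtain h where h: "h \<in> C_beta" "dyadic_sums h = ?z" "\<And>p. p \<in> F \<Longrightarrow> \<bar>h p\<bar> \<le> \<epsilon>/2"
        using dyadic_sums_right_inverse_small[OF F(1,2), of ?z "\<epsilon>/2" j] j F(3) by auto
      let ?g = "vadd (Cp beta_nat) f (vscale (Cp beta_nat) 1 h)"
      have "?g \<in> C_beta"
        using UC f(1) h(1) by (intro linear_subspace_vadd_vscale[OF linear_subspace_vcarrier_Cp]) auto
      moreover have "\<bar>?g p - f p\<bar> < \<epsilon>" if "p \<in> F" for p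
      proof -
        have "p \<in> topspace beta_nat" using that F(2) by auto
        then show ?thesis using h(3)[OF that] F(3) by (simp add: vadd_vscale_Cp_apply)
      qed
      ultimately have "?g \<in> U" using F(4) by blast
      moreover have "dyadic_sums ?g = x"
        by (rule ext) (simp add: dyadic_sums_add_scale h(2) f(2)[symmetric])
      ultimately show "x \<in> dyadic_sums ` U" by blast
    qed
    ultimately show "\<exists>T. openin (vtop linf_space) T \<and> y \<in> T \<and> T \<subseteq> dyadic_sums ` U" by blast
  qed
qed

theorem Cp_beta_quotient_linf:
  "\<exists>Z. closed_linear_subspace (Cp beta_nat) Z \<and> isomorphic_tvs (quotient_tvs (Cp beta_nat) Z) linf_space"
proof -
  define Z where "Z = {f \<in> C_beta. dyadic_sums f = (\<lambda>_. 0)}"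
  have "dyadic_sums (vzero (Cp beta_nat)) = (\<lambda>_. 0)"
    by (rule ext) (simp add: dyadic_sums_def vzero_Cp nat_point_in_beta)
  then have lin: "linear_subspace (Cp beta_nat) Z"
    using dyadic_sums_linear unfolding linear_subspace_def linear_map_def
    by (auto simp: Z_def vadd_linf vscale_linf vadd_Cp_closed vscale_Cp_closed vzero_Cp_closed)
  have "closedin (vtop (Cp beta_nat)) {f \<in> C_beta. dyadic_sums f n \<in> {0}}" for n
    by (rule closedin_continuous_map_preimage[OF continuous_dyadic_sums_coordinate]) simp
  then have "closedin (vtop (Cp beta_nat)) (\<Inter>n. {f \<in> C_beta. dyadic_sums f n \<in> {0}})"
    by (intro closedin_INT) auto
  moreover have "Z = (\<Inter>n. {f \<in> C_beta. dyadic_sums f n \<in> {0}})"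
    by (auto simp: Z_def)
  ultimately have "closed_linear_subspace (Cp beta_nat) Z"
    using lin by (simp add: closed_linear_subspace_def)
  moreover have "isomorphic_tvs (quotient_tvs (Cp beta_nat) Z) linf_space"
  proof (rule isomorphic_quotient[OF lin dyadic_sums_linear])
    show "quotient_map (vtop (Cp beta_nat)) (vtop linf_space) dyadic_sums"
      by (rule continuous_open_imp_quotient_map[OF continuous_dyadic_sums open_dyadic_sums dyadic_sums_surj])
    fix f g assume fg: "f \<in> C_beta" "g \<in> C_beta"
    then have "vadd (Cp beta_nat) f (vscale (Cp beta_nat) (-1) g) \<in> C_beta"
      by (intro linear_subspace_vadd_vscale[OF linear_subspace_vcarrier_Cp])
    then show "dyadic_sums f = dyadic_sums g \<longleftrightarrow> vadd (Cp beta_nat) f (vscale (Cp beta_nat) (-1) g) \<in> Z"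
      by (auto simp: Z_def fun_eq_iff dyadic_sums_add_scale)
  qed
  ultimately show ?thesis by blast
qed

section \<open>A subspace isomorphic to the space of null sequences\<close>

text \<open>
  Off a finite subset of \<open>\<nat>\<close> the function is small on \<open>\<nat>\<close>; such a finite set has no further points in its
  closure.
\<close>

lemma vanishing_off_nat_points:
  assumes f: "f \<in> C_beta" and lim: "(\<lambda>n. f (nat_point n)) \<longlonglongrightarrow> 0"
    and p: "p \<in> topspace beta_nat" "p \<notin> range nat_point"
  shows "f p = 0"
proof -
  have small: "\<bar>f p\<bar> \<le> e" if e: "e > 0" for e
  proof -
    obtain N where N: "\<And>n. n \<ge> N \<Longrightarrow> \<bar>f (nat_point n)\<bar> < e"
      using LIMSEQ_D[OF lim e] by auto
    obtain K where K: "\<And>p. p \<in> topspace beta_nat \<Longrightarrow> \<bar>f p\<bar> \<le> K" using C_beta_bounded[OF f] by metis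
    have le: "\<bar>f (nat_point n)\<bar> \<le> e + K * indicator {..<N} n" for n
      using N[of n] K[OF nat_point_in_beta, of n] e by (cases "n < N") (auto simp: indicator_def)
    have ind: "continuous_map beta_nat euclideanreal (\<lambda>p. e + K * p (indicator {..<N}))"
      by (intro beta_continuous_intros)
    have "f p \<le> e + K * p (indicator {..<N})"
      by (rule beta_le_by_density[OF continuous_C_beta[OF f] ind _ p(1)])
        (use le in \<open>simp only: nat_point_indicator abs_le_iff\<close>)
    moreover have "- f p \<le> e + K * p (indicator {..<N})"
      by (rule beta_le_by_density[OF continuous_map_minus[OF continuous_C_beta[OF f]] ind _ p(1)])
        (use le in \<open>simp only: nat_point_indicator abs_le_iff\<close>)
    moreover have "p (indicator {..<N}) = 0"
      using beta_hat_finite[of "{..<N}" p] p by (auto simp: beta_indicator indicator_def)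
    ultimately show ?thesis by simp
  qed
  have "\<bar>f p\<bar> \<le> 0" by (rule field_le_epsilon) (simp only: add_0_left small)
  then show ?thesis by simp
qed

text \<open>
  The inverse of restriction to \<open>\<nat>\<close> is extension by zero. It is continuous because each of its coordinates is
  either a term of the sequence or zero.
\<close>

theorem Cp_beta_contains_c0:
  "\<exists>S. linear_subspace (Cp beta_nat) S \<and> isomorphic_tvs (subspace_tvs (Cp beta_nat) S) c0_space"
proof -
  define R :: "(((nat \<Rightarrow> real) \<Rightarrow> real) \<Rightarrow> real) \<Rightarrow> nat \<Rightarrow> real" where "R f = (\<lambda>n. f (nat_point n))" for f
  define S where "S = {f \<in> C_beta. R f \<longlonglongrightarrow> 0}"
  define G where "G x = (\<lambda>p\<in>topspace beta_nat. if p \<in> range nat_point then x (inv nat_point p) else 0)" for x :: "nat \<Rightarrow> real"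
  have Radd: "R (vadd (Cp beta_nat) f g) = (\<lambda>n. R f n + R g n)"
    and Rscale: "R (vscale (Cp beta_nat) c f) = (\<lambda>n. c * R f n)"
    and Rzero: "R (vzero (Cp beta_nat)) = (\<lambda>_. 0)" for f g c
    by (simp_all add: R_def vadd_Cp vscale_Cp vzero_Cp nat_point_in_beta)
  have lin: "linear_subspace (Cp beta_nat) S"
    unfolding linear_subspace_def
    by (auto simp: S_def vadd_Cp_closed vscale_Cp_closed vzero_Cp_closed Radd Rscale Rzero
        intro: tendsto_add_zero tendsto_mult_right_zero)
  have SC: "S \<subseteq> C_beta" by (auto simp: S_def)
  let ?E = "subspace_tvs (Cp beta_nat) S"
  have carE: "vcarrier ?E = S" using SC by (auto simp: subspace_tvs_def)
  have GR: "G (R f) = f" if f: "f \<in> S" for f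
  proof (rule extensionalityI[of _ "topspace beta_nat"])
    show "G (R f) \<in> extensional (topspace beta_nat)" by (simp add: G_def)
    show "f \<in> extensional (topspace beta_nat)" using f by (simp add: S_def vcarrier_Cp)
    fix p assume p: "p \<in> topspace beta_nat"
    show "G (R f) p = f p"
    proof (cases "p \<in> range nat_point")
      case True
      then show ?thesis using p by (simp add: G_def R_def f_inv_into_f)
    next
      case False
      then show ?thesis using p f vanishing_off_nat_points[of f p] by (simp add: G_def S_def R_def)
    qed
  qed
  have RG: "R (G x) = x" for x
    by (simp add: R_def G_def nat_point_in_beta inv_f_f[OF inj_nat_point])
  have GS: "G x \<in> S" if x: "x \<longlonglongrightarrow> 0" for x
  proof -
    obtain K where K: "\<And>n. \<bar>x n\<bar> \<le> K"
      using convergent_imp_bounded[OF x] by (auto simp: bounded_iff)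
    obtain f where f: "f \<in> C_beta" "\<And>n. f (nat_point n) = x n"
      by (rule C_beta_extension[OF K]) (rule that)
    have "R f = x" using f(2) by (simp add: R_def)
    then have "f \<in> S" using f(1) x by (simp add: S_def)
    then show ?thesis using GR[of f] \<open>R f = x\<close> by simp
  qed
  have "homeomorphic_maps (vtop ?E) (vtop c0_space) R G"
    unfolding homeomorphic_maps_def carE vcarrier_c0
  proof (intro conjI)
    have coord: "continuous_map (vtop ?E) euclideanreal (\<lambda>f. R f n)" for n
      unfolding R_def subspace_tvs_def
      by (simp add: continuous_map_from_subtopology continuous_eval_Cp nat_point_in_beta)
    show "continuous_map (vtop ?E) (vtop c0_space) R"
      unfolding vtop_c0 continuous_map_in_subtopology
    proof
      show "continuous_map (vtop ?E) (product_topology (\<lambda>_. euclideanreal) UNIV) R"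
        by (intro continuous_map_into_real_power coord) auto
      show "R \<in> topspace (vtop ?E) \<rightarrow> {x. x \<longlonglongrightarrow> 0}" unfolding carE by (auto simp: S_def)
    qed
    have G_coord: "continuous_map (vtop c0_space) euclideanreal (\<lambda>x. G x p)" if "p \<in> topspace beta_nat" for p
      using that by (cases "p \<in> range nat_point")
        (simp_all add: G_def vtop_c0 continuous_map_from_subtopology continuous_eval_nat)
    show "continuous_map (vtop c0_space) (vtop ?E) G"
      unfolding subspace_tvs_def vtop_Cp
    proof (simp add: continuous_map_in_subtopology, intro conjI)
      show "continuous_map (vtop c0_space) (product_topology (\<lambda>_. euclideanreal) (topspace beta_nat)) G"
        by (rule continuous_map_into_real_power) (use G_coord in \<open>auto simp: G_def\<close>)
      show "G \<in> vcarrier c0_space \<rightarrow> {f. continuous_map beta_nat euclideanreal f}"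
        using GS SC by (auto simp: vcarrier_c0 intro: continuous_C_beta)
      show "G \<in> vcarrier c0_space \<rightarrow> S" using GS by (auto simp: vcarrier_c0)
    qed
  qed (use GR RG in auto)
  then have "homeomorphic_map (vtop ?E) (vtop c0_space) R"
    using homeomorphic_map_maps by blast
  moreover have "linear_map ?E c0_space R"
    unfolding linear_map_def carE
    using SC by (auto simp: S_def vcarrier_c0 vadd_c0 vscale_c0 subspace_tvs_def Radd Rscale)
  ultimately show ?thesis using lin by (auto simp: isomorphic_tvs_def)
qed

section \<open>No quotient isomorphic to the space of null sequences\<close>

text \<open>
  The coordinates of such a map are measures of norms \<open>s n\<close> that tend to zero, so the image of \<open>f\<close> is \<open>O(s)\<close>. The null sequence
  \<open>\<surd>s + 1/(n+1)\<close> is not, where the second term takes care of the indices with \<open>s n = 0\<close>.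
\<close>

theorem Cp_beta_no_map_onto_c0:
  assumes lin: "linear_map (Cp beta_nat) c0_space T" and cont: "continuous_map (vtop (Cp beta_nat)) (vtop c0_space) T"
  shows "T ` C_beta \<noteq> vcarrier c0_space"
proof
  assume onto: "T ` C_beta = vcarrier c0_space"
  have coord: "\<exists>a. finite (msupp a) \<and> msupp a \<subseteq> topspace beta_nat \<and> (\<forall>f\<in>C_beta. T f n = pairing a f)" for n
  proof -
    have "continuous_map (vtop (Cp beta_nat)) euclideanreal (\<lambda>f. T f n)"
      using continuous_map_compose[OF cont, of euclideanreal "\<lambda>x. x n"]
      by (simp add: vtop_c0 continuous_map_from_subtopology continuous_eval_nat o_def)
    moreover have "T (vadd (Cp beta_nat) f (vscale (Cp beta_nat) c g)) n = T f n + c * T g n"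
      if "f \<in> C_beta" "g \<in> C_beta" for f g c
      using lin that vscale_Cp_closed[OF that(2)] by (simp add: linear_map_def vadd_c0 vscale_c0)
    ultimately show ?thesis
      using continuous_functional_eq_pairing[of beta_nat "\<lambda>f. T f n"] by metis
  qed
  then obtain a where a: "\<And>n. finite (msupp (a n))" "\<And>n. msupp (a n) \<subseteq> topspace beta_nat"
    "\<And>n f. f \<in> C_beta \<Longrightarrow> T f n = pairing (a n) f" by metis
  define s where "s n = variation (a n) UNIV" for n
  have s0: "0 \<le> s n" for n by (simp add: s_def variation_nonneg)
  have "s \<longlonglongrightarrow> 0"
    unfolding s_def[abs_def]
  proof (rule beta_weak_star_null_imp_norm_null[OF a(1,2)])
    fix f assume f: "f \<in> C_beta"
    have "T f \<longlonglongrightarrow> 0" using onto f by (auto simp: vcarrier_c0)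
    moreover have "T f = (\<lambda>k. pairing (a k) f)" using a(3)[OF f] by auto
    ultimately show "(\<lambda>k. pairing (a k) f) \<longlonglongrightarrow> 0" by simp
  qed
  define x where "x n = sqrt (s n) + 1 / real (Suc n)" for n
  have "x \<longlonglongrightarrow> sqrt 0 + 0"
    unfolding x_def[abs_def] using \<open>s \<longlonglongrightarrow> 0\<close> by (intro tendsto_intros LIMSEQ_Suc[OF lim_1_over_n])
  then have "x \<in> vcarrier c0_space" by (simp add: vcarrier_c0)
  then obtain f where f: "f \<in> C_beta" "T f = x" using onto by (metis imageE)
  obtain K where K: "\<And>p. p \<in> topspace beta_nat \<Longrightarrow> \<bar>f p\<bar> \<le> K" using C_beta_bounded[OF f(1)] by metis
  have le: "x n \<le> K * s n" for n
  proof -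
    have "\<bar>pairing (a n) f\<bar> \<le> K * s n"
      unfolding s_def by (rule abs_pairing_le) (use K a(2)[of n] in blast)
    then show ?thesis using a(3)[OF f(1), of n] f(2) by simp
  qed
  have "(\<lambda>n. K * sqrt (s n)) \<longlonglongrightarrow> K * sqrt 0"
    using \<open>s \<longlonglongrightarrow> 0\<close> by (intro tendsto_intros)
  then have "\<forall>\<^sub>F n in sequentially. K * sqrt (s n) < 1" by (intro order_tendstoD(2)) auto
  then obtain n where n: "K * sqrt (s n) < 1" by (auto simp: eventually_sequentially)
  have "K * s n = (K * sqrt (s n)) * sqrt (s n)" using s0[of n] by (simp add: mult.assoc)
  also have "\<dots> \<le> 1 * sqrt (s n)" using n s0[of n] by (intro mult_right_mono) auto
  finally have "x n \<le> sqrt (s n)" using le[of n] by simp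
  then show False by (simp add: x_def field_simps)
qed

theorem Cp_beta_no_quotient_c0:
  "\<not> (\<exists>Z. closed_linear_subspace (Cp beta_nat) Z \<and> isomorphic_tvs (quotient_tvs (Cp beta_nat) Z) c0_space)"
proof
  assume "\<exists>Z. closed_linear_subspace (Cp beta_nat) Z \<and> isomorphic_tvs (quotient_tvs (Cp beta_nat) Z) c0_space"
  then obtain Z \<phi> where Z: "linear_subspace (Cp beta_nat) Z"
    and \<phi>: "linear_map (quotient_tvs (Cp beta_nat) Z) c0_space \<phi>"
      "homeomorphic_map (vtop (quotient_tvs (Cp beta_nat) Z)) (vtop c0_space) \<phi>"
    by (auto simp: closed_linear_subspace_def isomorphic_tvs_def)
  let ?q = "vcoset (Cp beta_nat) Z"
  have lin: "linear_map (Cp beta_nat) c0_space (\<phi> \<circ> ?q)"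
    using linear_map_vcoset[OF Z] \<phi>(1) by (auto simp: linear_map_def image_subset_iff)
  have quo: "quotient_map (vtop (Cp beta_nat)) (vtop c0_space) (\<phi> \<circ> ?q)"
    using quotient_map_compose[OF quotient_map_vcoset, of "Cp beta_nat" Z "vtop c0_space" \<phi>] \<phi>(2)
    by (simp add: homeomorphic_map_def)
  show False
    using Cp_beta_no_map_onto_c0[OF lin quotient_imp_continuous_map[OF quo]] quotient_imp_surjective_map[OF quo]
    by blast
qed

section \<open>A criterion for finite dimension\<close>

lemma pointwise_bounded_subsequence:
  fixes g :: "nat \<Rightarrow> 'a \<Rightarrow> real"
  assumes "countable S" and bd: "\<And>y. y \<in> S \<Longrightarrow> \<exists>K. \<forall>n. \<bar>g n y\<bar> \<le> K"
  obtains r where "strict_mono (r :: nat \<Rightarrow> nat)" "\<And>y. y \<in> S \<Longrightarrow> convergent (\<lambda>n. g (r n) y)"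
proof -
  obtain K where K: "\<And>y n. y \<in> S \<Longrightarrow> \<bar>g n y\<bar> \<le> K y" using bd by metis
  define h where "h n y = g n y / (1 + \<bar>K y\<bar>)" for n y
  have "norm (h n y) \<le> 1" if "y \<in> S" for n y
  proof -
    have pos: "0 < 1 + \<bar>K y\<bar>" by linarith
    have "\<bar>g n y\<bar> \<le> 1 + \<bar>K y\<bar>" using K[OF that, of n] by linarith
    then show ?thesis unfolding h_def real_norm_def abs_divide abs_of_pos[OF pos] using pos by simp
  qed
  then obtain r where r: "strict_mono (r :: nat \<Rightarrow> nat)" "\<And>y. y \<in> S \<Longrightarrow> \<exists>l. (\<lambda>n. h (r n) y) \<longlonglongrightarrow> l"
    using function_convergent_subsequence[OF assms(1), of h 1] by blast
  have "convergent (\<lambda>n. g (r n) y)" if y: "y \<in> S" for y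
  proof -
    obtain l where "(\<lambda>n. h (r n) y) \<longlonglongrightarrow> l" using r(2)[OF y] by blast
    then have "(\<lambda>n. (1 + \<bar>K y\<bar>) * h (r n) y) \<longlonglongrightarrow> (1 + \<bar>K y\<bar>) * l" by (intro tendsto_intros)
    moreover have "(1 + \<bar>K y\<bar>) * h n y = g n y" for n
    proof -
      have "1 + \<bar>K y\<bar> \<noteq> 0" by linarith
      then show ?thesis by (simp add: h_def)
    qed
    ultimately show ?thesis by (auto simp: convergent_def)
  qed
  then show thesis using r(1) that by blast
qed

lemma convergent_if_approximable:
  fixes u :: "nat \<Rightarrow> real"
  assumes "\<And>e. e > 0 \<Longrightarrow> \<exists>h. convergent h \<and> (\<forall>n. \<bar>u n - h n\<bar> \<le> e)"
  shows "convergent u"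
proof -
  have "Cauchy u"
  proof (rule metric_CauchyI)
    fix e :: real assume e: "0 < e"
    obtain h where h: "convergent h" "\<And>n. \<bar>u n - h n\<bar> \<le> e/4" using assms[of "e/4"] e by auto
    obtain N where N: "\<And>m n. m \<ge> N \<Longrightarrow> n \<ge> N \<Longrightarrow> dist (h m) (h n) < e/4"
      using metric_CauchyD[OF convergent_Cauchy[OF h(1)], of "e/4"] e by auto
    have "dist (u m) (u n) < e" if "m \<ge> N" "n \<ge> N" for m n
      using N[OF that] h(2)[of m] h(2)[of n] e unfolding dist_real_def by linarith
    then show "\<exists>M. \<forall>m\<ge>M. \<forall>n\<ge>M. dist (u m) (u n) < e" by blast
  qed
  then show ?thesis by (rule Cauchy_convergent)
qed

definition beta_measures :: "(((nat \<Rightarrow> real) \<Rightarrow> real) \<Rightarrow> real) set" where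
  "beta_measures = {a. finite (msupp a) \<and> msupp a \<subseteq> topspace beta_nat}"

lemma beta_measures_diff: "a \<in> beta_measures \<Longrightarrow> b \<in> beta_measures \<Longrightarrow> (\<lambda>p. a p - b p) \<in> beta_measures"
  using msupp_diff[of a b] by (auto simp: beta_measures_def intro: finite_subset)

lemma beta_measures_scale: "a \<in> beta_measures \<Longrightarrow> (\<lambda>p. c * a p) \<in> beta_measures"
  using msupp_scale[of c a] by (auto simp: beta_measures_def intro: finite_subset)

text \<open>
  Finitely many members of \<open>M\<close> have the same kernel as \<open>M\<close>, so \<open>q\<close> factors over a finite-dimensional space.
\<close>

lemma finite_dimensional_if_setwise_compact:
  assumes lin: "linear_map (Cp beta_nat) E q" and surj: "q ` C_beta = vcarrier E"
    and zero: "q (vzero (Cp beta_nat)) = vzero E"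
    and M: "M \<subseteq> beta_measures" and diff: "\<And>a b. a \<in> M \<Longrightarrow> b \<in> M \<Longrightarrow> (\<lambda>p. a p - b p) \<in> M"
    and scale: "\<And>a c. a \<in> M \<Longrightarrow> (\<lambda>p. c * a p) \<in> M"
    and comp: "beta.setwise_compact M"
    and ker: "\<And>f. f \<in> C_beta \<Longrightarrow> (\<And>a. a \<in> M \<Longrightarrow> pairing a f = 0) \<Longrightarrow> q f = vzero E"
  shows "\<not> infinite_dimensional E"
proof -
  have fin: "finite (msupp a)" and supp: "msupp a \<subseteq> topspace beta_nat" if "a \<in> M" for a
    using M that by (auto simp: beta_measures_def)
  obtain F where F: "finite F" "F \<subseteq> M"
    "\<forall>f. bounded (f ` topspace beta_nat) \<longrightarrow> (\<forall>\<phi>\<in>F. pairing \<phi> f = 0) \<longrightarrow> (\<forall>a\<in>M. pairing a f = 0)"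
    by (rule beta.finitely_determined_annihilator[OF fin supp diff scale comp]) (assumption | rule that)+
  show ?thesis
  proof (rule finite_dimensional_image[OF lin surj F(1)])
    show "q f = vzero E" if f: "f \<in> C_beta" "\<And>a. a \<in> F \<Longrightarrow> pairing a f = 0" for f
    proof (rule ker[OF f(1)])
      fix a assume a: "a \<in> M"
      have "bounded (f ` topspace beta_nat)"
        using C_beta_bounded[OF f(1)] unfolding bounded_iff by (metis imageE real_norm_def)
      then show "pairing a f = 0" using F(3) f(2) a by blast
    qed
  qed (use F(2) fin supp zero in auto)
qed

section \<open>No Polishable quotients of infinite dimension\<close>

text \<open>
  The unit ball of the annihilator of \<open>Z\<close> is pointwise bounded on the quotient, and its elements are continuous for
  the finer topology. By Baire's theorem a sequence in it is uniformly bounded on some ball, hence, by invariance of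
  the metric, its values at two points of distance below \<open>r\<close> differ by a bounded amount; scaling turns this
  into uniform approximation on a countable dense set.
\<close>

theorem Cp_beta_no_polishable_quotient:
  assumes Z: "closed_linear_subspace (Cp beta_nat) Z" and pol: "polishable (quotient_tvs (Cp beta_nat) Z)"
  shows "\<not> infinite_dimensional (quotient_tvs (Cp beta_nat) Z)"
proof -
  let ?Q = "quotient_tvs (Cp beta_nat) Z" and ?q = "vcoset (Cp beta_nat) Z"
  let ?sub = "\<lambda>f c g. vadd (Cp beta_nat) f (vscale (Cp beta_nat) c g)"
  define Y where "Y = vcarrier ?Q"
  have lin: "linear_subspace (Cp beta_nat) Z" using Z by (simp add: closed_linear_subspace_def)
  have qlin: "linear_map (Cp beta_nat) ?Q ?q" by (rule linear_map_vcoset[OF lin])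
  have Yq: "Y = ?q ` C_beta" by (simp add: Y_def vcarrier_quotient)
  obtain T where T: "topspace T = Y" "\<And>U. openin (vtop ?Q) U \<Longrightarrow> openin T U"
    "frechet (?Q\<lparr>vtop := T\<rparr>)" "separable_space T"
    using pol unfolding polishable_def Y_def by blast
  obtain d where d: "Metric_space Y d"
    "\<And>x y z. x \<in> Y \<Longrightarrow> y \<in> Y \<Longrightarrow> z \<in> Y \<Longrightarrow> d (vadd ?Q x z) (vadd ?Q y z) = d x y"
    "Metric_space.mtopology Y d = T" "Metric_space.mcomplete Y d"
    using T(3) T(1) unfolding frechet_def by auto
  interpret Metric_space Y d by (rule d(1))
  obtain D where D: "countable D" "D \<subseteq> Y" "T closure_of D = Y"
    using T(4) unfolding separable_space_def T(1) by blast
  define M where "M = {a \<in> beta_measures. \<forall>z\<in>Z. pairing a z = 0}"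
  have comp: "beta.setwise_compact M"
    unfolding beta.setwise_compact_def
  proof (intro allI impI)
    fix a :: "nat \<Rightarrow> ((nat \<Rightarrow> real) \<Rightarrow> real) \<Rightarrow> real"
    assume "\<forall>n. a n \<in> M \<and> variation (a n) UNIV \<le> 1"
    then have a: "a n \<in> M" "variation (a n) UNIV \<le> 1" "finite (msupp (a n))" "msupp (a n) \<subseteq> topspace beta_nat" for n
      by (auto simp: M_def beta_measures_def)
    have "\<exists>g. continuous_map (vtop ?Q) euclideanreal g \<and> (\<forall>f\<in>C_beta. g (?q f) = pairing (a n) f)" for n
    proof -
      have "pairing (a n) f = pairing (a n) f'" if "f \<in> C_beta" "f' \<in> C_beta" "?q f = ?q f'" for f f'
      proof -
        have "?sub f (-1) f' \<in> Z" using vcoset_eq_iff[OF lin that(1,2)] that(3) by simp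
        then have "pairing (a n) (?sub f (-1) f') = 0" using a(1)[of n] by (simp add: M_def)
        then show ?thesis by (simp add: pairing_vadd_vscale[OF a(3,4)])
      qed
      then show ?thesis
        using quotient_map_lift_exists[OF quotient_map_vcoset continuous_pairing[OF a(3,4)], of Z n] by metis
    qed
    then obtain g where g: "\<And>n. continuous_map (vtop ?Q) euclideanreal (g n)"
      "\<And>n f. f \<in> C_beta \<Longrightarrow> g n (?q f) = pairing (a n) f" by metis
    have gT: "continuous_map T euclideanreal (g n)" for n
      using g(1)[of n] T(1,2) by (auto simp: continuous_map_def Y_def)
    define B where "B k = {y \<in> Y. \<forall>n. \<bar>g n y\<bar> \<le> real k}" for k :: nat
    have cover: "\<exists>k. y \<in> B k" if y: "y \<in> Y" for y
    proof -
      obtain f where f: "f \<in> C_beta" "y = ?q f" using y Yq by blast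
      obtain K where K: "\<And>p. p \<in> topspace beta_nat \<Longrightarrow> \<bar>f p\<bar> \<le> K" using C_beta_bounded[OF f(1)] by metis
      have K0: "0 \<le> K" using K[OF nat_point_in_beta, of 0] by linarith
      have "\<bar>g n y\<bar> \<le> K" for n
      proof -
        have "\<bar>pairing (a n) f\<bar> \<le> K * variation (a n) UNIV" by (rule abs_pairing_le) (use K a(4)[of n] in blast)
        also have "\<dots> \<le> K" using a(2)[of n] K0 mult_left_mono[of "variation (a n) UNIV" 1 K] by simp
        finally show ?thesis using g(2) f by simp
      qed
      moreover obtain k :: nat where "K \<le> real k" using real_arch_simple by blast
      ultimately have "\<bar>g n y\<bar> \<le> real k" for n by (meson order_trans)
      then show ?thesis using y by (auto simp: B_def)
    qed
    have closed: "closedin mtopology (B k)" for k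
    proof -
      have "closedin T (\<Inter>n. {y \<in> topspace T. g n y \<in> {- real k..real k}})"
        by (intro closedin_INT closedin_continuous_map_preimage[OF gT]) auto
      moreover have "B k = (\<Inter>n. {y \<in> topspace T. g n y \<in> {- real k..real k}})"
        by (auto simp: B_def T(1) abs_le_iff) (metis minus_le_iff)+
      ultimately show ?thesis using d(3) by simp
    qed
    have "\<exists>k. mtopology interior_of B k \<noteq> {}"
    proof (rule ccontr)
      assume "\<not> ?thesis"
      then have "mtopology interior_of \<Union>(range B) = {}"
        using closed by (intro metric_Baire_category_alt[OF d(4)]) auto
      moreover have "\<Union>(range B) = Y" using cover by (auto simp: B_def)
      moreover have "mtopology interior_of Y = Y" using interior_of_topspace[of mtopology] by simp
      ultimately have "Y = {}" by simp
      then show False using Yq vzero_Cp_closed[of beta_nat] by blast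
    qed
    then obtain k y0 where "y0 \<in> mtopology interior_of B k" by blast
    then obtain r where r: "r > 0" "mball y0 r \<subseteq> B k" "y0 \<in> Y"
      using interior_of_subset[of mtopology "B k"] openin_interior_of[of mtopology "B k"] unfolding openin_mtopology by blast
    obtain f0 where f0: "f0 \<in> C_beta" "y0 = ?q f0" using r(3) Yq by blast
    have equi: "\<bar>g n u - g n v\<bar> \<le> 2 * real k" if uv: "u \<in> Y" "v \<in> Y" "d v u < r" for u v n
    proof -
      obtain f f' where f: "f \<in> C_beta" "f' \<in> C_beta" "u = ?q f" "v = ?q f'" using uv Yq by blast
      (* Translation by ?w moves v to the centre y0 of the ball. *)
      let ?w = "?sub f0 (-1) f'"
      have w: "?w \<in> C_beta" by (rule linear_subspace_vadd_vscale[OF linear_subspace_vcarrier_Cp f0(1) f(2)])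
      have wY: "?q ?w \<in> Y" using w Yq by blast
      have "?sub f' 1 ?w = f0"
        using f0(1) by (auto simp: vadd_Cp vscale_Cp vcarrier_Cp fun_eq_iff extensional_def)
      moreover have add: "vadd ?Q (?q h) (?q ?w) = ?q (?sub h 1 ?w)" if "h \<in> C_beta" for h
      proof -
        have "?sub h 1 ?w = vadd (Cp beta_nat) h ?w" by (auto simp: vadd_Cp vscale_Cp fun_eq_iff)
        then show ?thesis using qlin that w by (simp add: linear_map_def)
      qed
      ultimately have v: "vadd ?Q v (?q ?w) = y0" using f f0 by simp
      have u: "vadd ?Q u (?q ?w) = ?q (?sub f 1 ?w)" using f add by simp
      have fw: "?sub f 1 ?w \<in> C_beta" by (rule linear_subspace_vadd_vscale[OF linear_subspace_vcarrier_Cp f(1) w])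
      have "d y0 (?q (?sub f 1 ?w)) < r" using d(2)[OF uv(2,1) wY] uv(3) u v by simp
      moreover have "?q (?sub f 1 ?w) \<in> Y" using fw Yq by blast
      ultimately have "?q (?sub f 1 ?w) \<in> mball y0 r" using r(3) by (simp only: in_mball)
      then have "?q (?sub f 1 ?w) \<in> B k" using r(2) by blast
      then have "\<bar>g n (?q (?sub f 1 ?w))\<bar> \<le> real k" by (simp only: B_def mem_Collect_eq)
      then have "\<bar>pairing (a n) (?sub f 1 ?w)\<bar> \<le> real k" by (simp only: g(2)[OF fw])
      moreover have "y0 \<in> B k" using r by auto
      then have "\<bar>g n (?q f0)\<bar> \<le> real k" by (simp only: B_def mem_Collect_eq f0(2))
      then have "\<bar>pairing (a n) f0\<bar> \<le> real k" by (simp only: g(2)[OF f0(1)])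
      moreover have "pairing (a n) (?sub f 1 ?w) = g n u - g n v + pairing (a n) f0"
        using g(2) f by (simp add: pairing_vadd_vscale[OF a(3,4)])
      ultimately show ?thesis by linarith
    qed
    obtain s where s: "strict_mono (s :: nat \<Rightarrow> nat)" "\<And>y. y \<in> D \<Longrightarrow> convergent (\<lambda>n. g (s n) y)"
    proof (rule pointwise_bounded_subsequence[OF D(1), of g])
      fix y assume "y \<in> D"
      then show "\<exists>K. \<forall>n. \<bar>g n y\<bar> \<le> K" using cover[of y] D(2) by (auto simp: B_def)
    qed (rule that)
    have conv: "convergent (\<lambda>n. pairing (a (s n)) f)" if f: "f \<in> C_beta" for f
    proof (rule convergent_if_approximable)
      fix e :: real assume e: "e > 0"
      obtain m0 :: nat where m0: "2 * real k / e < real m0" using reals_Archimedean2 by blast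
      define m where "m = real (Suc m0)"
      have m: "m > 0" "2 * real k \<le> e * m"
        using m0 e by (auto simp: m_def field_simps)
      (* The oscillation bound 2 k is absolute, so approximate m f and divide by m. *)
      let ?y = "?q (vscale (Cp beta_nat) m f)"
      have mf: "vscale (Cp beta_nat) m f \<in> C_beta" by (rule vscale_Cp_closed[OF f])
      have yY: "?y \<in> Y" using mf Yq by blast
      then have "?y \<in> mtopology closure_of D" using D(3) d(3) by simp
      then obtain y where y: "y \<in> D" "d ?y y < r"
        unfolding metric_closure_of using r(1) by (auto simp: in_mball)
      have "g n ?y = m * pairing (a n) f" for n
      proof -
        have "pairing (a n) (?sub (vzero (Cp beta_nat)) m f) = m * pairing (a n) f"
          using pairing_vadd_vscale[OF a(3,4), of n "vzero (Cp beta_nat)" m f] a(4)[of n]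
          by (simp add: pairing_def vzero_Cp subset_iff)
        moreover have "?sub (vzero (Cp beta_nat)) m f = vscale (Cp beta_nat) m f"
          by (auto simp: vadd_Cp vscale_Cp vzero_Cp fun_eq_iff)
        ultimately show ?thesis using g(2)[OF mf] by simp
      qed
      then have "\<bar>g n y - m * pairing (a n) f\<bar> \<le> e * m" for n
        using equi[of y ?y n] y yY D(2) m(2) by (metis order_trans subsetD)
      then have "\<bar>pairing (a (s n)) f - (1/m) * g (s n) y\<bar> \<le> e" for n
      proof -
        have "m * \<bar>pairing (a (s n)) f - (1/m) * g (s n) y\<bar> = \<bar>m * (pairing (a (s n)) f - (1/m) * g (s n) y)\<bar>"
          using m(1) by (simp add: abs_mult)
        also have "\<dots> = \<bar>g (s n) y - m * pairing (a (s n)) f\<bar>"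
          using m(1) by (simp add: right_diff_distrib abs_minus_commute)
        also have "\<dots> \<le> m * e" using \<open>\<And>n. \<bar>g n y - m * pairing (a n) f\<bar> \<le> e * m\<close> by (simp add: mult.commute)
        finally show ?thesis using m(1) by simp
      qed
      moreover have "convergent (\<lambda>n. (1/m) * g (s n) y)"
        using s(2)[OF y(1)] by (intro convergent_mult convergent_const)
      ultimately show "\<exists>h. convergent h \<and> (\<forall>n. \<bar>pairing (a (s n)) f - h n\<bar> \<le> e)" by blast
    qed
    show "\<exists>r. strict_mono r \<and> (\<forall>A. convergent (\<lambda>n. mass (a (r n)) (beta_hat A)))"
      using s(1) conv[OF indicator_in_C_beta] by (auto simp: mass_hat_eq_pairing[OF a(3,4)])
  qed
  show ?thesis
  proof (rule finite_dimensional_if_setwise_compact[OF qlin _ vcoset_zero[OF lin] _ _ _ comp])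
    show "?q ` C_beta = vcarrier ?Q" by (simp add: vcarrier_quotient)
    show "M \<subseteq> beta_measures" by (auto simp: M_def)
    show "(\<lambda>p. a p - b p) \<in> M" if "a \<in> M" "b \<in> M" for a b
      using that beta_measures_diff by (auto simp: M_def beta_measures_def pairing_diff)
    show "(\<lambda>p. c * a p) \<in> M" if "a \<in> M" for a c
      using that beta_measures_scale by (auto simp: M_def beta_measures_def pairing_scale)
    fix f assume f: "f \<in> C_beta" "\<And>a. a \<in> M \<Longrightarrow> pairing a f = 0"
    have "f \<in> Z"
    proof (rule ccontr)
      assume "f \<notin> Z"
      then obtain a where "finite (msupp a)" "msupp a \<subseteq> topspace beta_nat" "\<And>z. z \<in> Z \<Longrightarrow> pairing a z = 0" "pairing a f \<noteq> 0"
        using separate_from_closed_subspace[OF Z f(1)] by blast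
      then show False using f(2)[of a] by (auto simp: M_def beta_measures_def)
    qed
    moreover have "?sub f (-1) (vzero (Cp beta_nat)) = f"
      using f(1) by (auto simp: vadd_Cp vscale_Cp vzero_Cp vcarrier_Cp fun_eq_iff extensional_def)
    ultimately have "?q f = ?q (vzero (Cp beta_nat))"
      using vcoset_eq_iff[OF lin f(1) vzero_Cp_closed] by simp
    then show "?q f = vzero ?Q" using vcoset_zero[OF lin] by simp
  qed
qed

section \<open>No complemented separable subspaces of infinite dimension\<close>

text \<open>
  Two points are in the same cell if the first \<open>n\<close> functions agree at them up to the precision \<open>1/(n+1)\<close>.
\<close>

definition cell :: "(nat \<Rightarrow> 'p \<Rightarrow> real) \<Rightarrow> nat \<Rightarrow> 'p \<Rightarrow> int list" where
  "cell d n p = map (\<lambda>i. \<lfloor>real (Suc n) * d i p\<rfloor>) [0..<n]"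

text \<open>
  Functions constant on cells, with rational values given by a finite table. They are discontinuous, but
  finitely supported measures can be evaluated at them, and they are indexed by a countable type.
\<close>

definition step_function :: "(nat \<Rightarrow> 'p \<Rightarrow> real) \<Rightarrow> nat \<times> (int list \<times> rat) list \<Rightarrow> 'p \<Rightarrow> real" where
  "step_function d = (\<lambda>(n, al) p. case map_of al (cell d n p) of None \<Rightarrow> 0 | Some v \<Rightarrow> of_rat v)"

lemma step_function_bounded: "\<exists>K. \<forall>p. \<bar>step_function d s p\<bar> \<le> K"
proof -
  obtain n al where s: "s = (n, al)" by force
  have "step_function d s p \<in> insert 0 (of_rat ` snd ` set al)" for p
  proof (cases "map_of al (cell d n p)")
    case (Some v)
    then have "(cell d n p, v) \<in> set al" by (rule map_of_SomeD)
    then show ?thesis using Some by (force simp: step_function_def s)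
  qed (simp add: step_function_def s)
  then have "range (step_function d s) \<subseteq> insert 0 (of_rat ` snd ` set al)" by blast
  then have "bounded (range (step_function d s))" by (meson bounded_subset finite_imp_bounded finite_insert finite_imageI finite_set)
  then show ?thesis by (auto simp: bounded_iff)
qed

lemma same_cell_close:
  assumes "cell d n x = cell d n y" "i < n"
  shows "\<bar>d i x - d i y\<bar> \<le> 1 / real (Suc n)"
proof -
  have "\<lfloor>real (Suc n) * d i x\<rfloor> = \<lfloor>real (Suc n) * d i y\<rfloor>"
    using assms by (auto simp: cell_def)
  then have "\<bar>real (Suc n) * d i x - real (Suc n) * d i y\<bar> < 1" by linarith
  moreover have "real (Suc n) * d i x - real (Suc n) * d i y = real (Suc n) * (d i x - d i y)" by (simp add: algebra_simps)
  ultimately have "real (Suc n) * \<bar>d i x - d i y\<bar> < 1" by (simp only: abs_mult abs_of_nat)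
  then show ?thesis by (simp add: field_simps)
qed

text \<open>
  Otherwise, by compactness, there are two points at which all \<open>d i\<close> agree whereas \<open>f\<close> differs by at least \<open>e\<close>. But \<open>f\<close> is
  a pointwise limit of the \<open>d i\<close>.
\<close>

lemma oscillation_on_cells:
  assumes X: "compact_space X" and d: "\<And>i. continuous_map X euclideanreal (d i)"
    and f: "f \<in> vtop (Cp X) closure_of (range d)" and e: "e > 0"
  shows "\<exists>n. \<forall>x\<in>topspace X. \<forall>y\<in>topspace X. cell d n x = cell d n y \<longrightarrow> \<bar>f x - f y\<bar> < e"
proof (rule ccontr)
  assume no: "\<not> ?thesis"
  have fC: "f \<in> vcarrier (Cp X)" using f closure_of_subset_topspace by fast
  then have fc: "continuous_map X euclideanreal f" by (simp add: vcarrier_Cp)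
  let ?XX = "prod_topology X X"
  define C where "C n = {z \<in> topspace ?XX. (\<forall>i<n. \<bar>d i (fst z) - d i (snd z)\<bar> \<le> 1 / real (Suc n)) \<and> e \<le> \<bar>f (fst z) - f (snd z)\<bar>}" for n
  have diff: "continuous_map ?XX euclideanreal (\<lambda>z. \<bar>g (fst z) - g (snd z)\<bar>)" if "continuous_map X euclideanreal g" for g
    using continuous_map_compose[OF continuous_map_fst that, of X] continuous_map_compose[OF continuous_map_snd that, of X]
    by (intro continuous_map_real_abs continuous_map_diff) (auto simp: o_def)
  have "(\<Inter>n. C n) \<noteq> {}"
  proof (rule compact_space_imp_nest)
    show "compact_space ?XX" using X by (simp add: compact_space_prod_topology)
    show "closedin ?XX (C n)" for n
    proof -
      have 1: "closedin ?XX {z \<in> topspace ?XX. \<bar>f (fst z) - f (snd z)\<bar> \<in> {e..}}"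
        by (rule closedin_continuous_map_preimage[OF diff[OF fc]]) simp
      have 2: "closedin ?XX {z \<in> topspace ?XX. \<bar>d i (fst z) - d i (snd z)\<bar> \<in> {..1 / real (Suc n)}}" for i
        by (rule closedin_continuous_map_preimage[OF diff[OF d]]) simp
      have "closedin ?XX (\<Inter>(insert {z \<in> topspace ?XX. \<bar>f (fst z) - f (snd z)\<bar> \<in> {e..}}
          ((\<lambda>i. {z \<in> topspace ?XX. \<bar>d i (fst z) - d i (snd z)\<bar> \<in> {..1 / real (Suc n)}}) ` {..<n})))"
        by (rule closedin_Inter) (use 1 2 in auto)
      moreover have "\<Inter>(insert {z \<in> topspace ?XX. \<bar>f (fst z) - f (snd z)\<bar> \<in> {e..}}
          ((\<lambda>i. {z \<in> topspace ?XX. \<bar>d i (fst z) - d i (snd z)\<bar> \<in> {..1 / real (Suc n)}}) ` {..<n})) = C n"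
        by (auto simp: C_def)
      ultimately show ?thesis by simp
    qed
    show "C n \<noteq> {}" for n
    proof -
      obtain x y where "x \<in> topspace X" "y \<in> topspace X" "cell d n x = cell d n y" "e \<le> \<bar>f x - f y\<bar>"
        using no not_less by metis
      then have "(x, y) \<in> C n" using same_cell_close by (auto simp: C_def)
      then show ?thesis by blast
    qed
    show "decseq C"
    proof (rule decseq_SucI, rule subsetI)
      fix n z assume z: "z \<in> C (Suc n)"
      have "1 / real (Suc (Suc n)) \<le> 1 / real (Suc n)" by (simp add: field_simps)
      then show "z \<in> C n" using z unfolding C_def
        by (simp only: mem_Collect_eq) (meson less_SucI order_trans)
    qed
  qed
  then obtain x y where xy: "\<And>n. (x, y) \<in> C n" by auto
  have X2: "x \<in> topspace X" "y \<in> topspace X" and far: "e \<le> \<bar>f x - f y\<bar>"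
    using xy[of 0] by (auto simp: C_def)
  have eq: "d i x = d i y" for i
  proof -
    have "\<bar>d i x - d i y\<bar> \<le> 1 / real (Suc n)" if "n > i" for n
      using xy[of n] that by (auto simp: C_def)
    then have "\<forall>\<^sub>F n in sequentially. \<bar>d i x - d i y\<bar> \<le> 1 / real (Suc n)"
      by (auto simp: eventually_sequentially intro!: exI[of _ "Suc i"])
    then have "\<bar>d i x - d i y\<bar> \<le> 0"
      by (rule tendsto_lowerbound[OF LIMSEQ_Suc[OF lim_1_over_n]]) simp
    then show ?thesis by simp
  qed
  have open': "openin (vtop (Cp X)) {g \<in> vcarrier (Cp X). g p \<in> {f p - e/2<..<f p + e/2}}" if "p \<in> topspace X" for p
    by (rule openin_continuous_map_preimage[OF continuous_eval_Cp[OF that]]) simp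
  define U where "U = {g \<in> vcarrier (Cp X). g x \<in> {f x - e/2<..<f x + e/2}} \<inter> {g \<in> vcarrier (Cp X). g y \<in> {f y - e/2<..<f y + e/2}}"
  have "openin (vtop (Cp X)) U" unfolding U_def by (intro openin_Int open' X2)
  moreover have "f \<in> U" using fC e by (simp add: U_def)
  ultimately obtain i where "d i \<in> U" using f unfolding in_closure_of by blast
  then show False using eq[of i] far by (auto simp: U_def)
qed

text \<open>
  Hence a pointwise separable set of continuous functions on a compact space is uniformly separable, with countably
  many step functions in the role of the dense set.
\<close>

lemma step_function_approximation:
  assumes X: "compact_space X" and d: "\<And>i. continuous_map X euclideanreal (d i)"
    and f: "f \<in> vtop (Cp X) closure_of (range d)" and e: "e > 0"
  shows "\<exists>s. \<forall>p\<in>topspace X. \<bar>f p - step_function d s p\<bar> \<le> e"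
proof -
  obtain n where n: "\<And>x y. x \<in> topspace X \<Longrightarrow> y \<in> topspace X \<Longrightarrow> cell d n x = cell d n y \<Longrightarrow> \<bar>f x - f y\<bar> < e/2"
    using oscillation_on_cells[OF X d f, of "e/2"] e by auto
  have "finite (cell d n ` topspace X)"
  proof -
    have "finite ((\<lambda>p. \<lfloor>real (Suc n) * d i p\<rfloor>) ` topspace X)" for i
    proof -
      have "compactin euclideanreal (d i ` topspace X)"
        using X d by (metis compact_space_def image_compactin)
      then have "bounded (d i ` topspace X)" by (simp add: compact_imp_bounded)
      then obtain K where K: "\<And>p. p \<in> topspace X \<Longrightarrow> \<bar>d i p\<bar> \<le> K" by (auto simp: bounded_iff)
      have "\<bar>real (Suc n) * d i p\<bar> \<le> real (Suc n) * K" if "p \<in> topspace X" for p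
        using K[OF that] by (simp only: abs_mult abs_of_nat) (intro mult_left_mono, auto)
      then have "- (real (Suc n) * K) \<le> real (Suc n) * d i p \<and> real (Suc n) * d i p \<le> real (Suc n) * K"
        if "p \<in> topspace X" for p using that by (metis abs_le_iff minus_le_iff)
      then have "(\<lambda>p. \<lfloor>real (Suc n) * d i p\<rfloor>) ` topspace X \<subseteq> {\<lfloor>- (real (Suc n) * K)\<rfloor>..\<lfloor>real (Suc n) * K\<rfloor>}"
        by (intro image_subsetI) (simp only: atLeastAtMost_iff floor_mono)
      then show ?thesis by (rule finite_subset) simp
    qed
    then have "finite (\<Union>i<n. (\<lambda>p. \<lfloor>real (Suc n) * d i p\<rfloor>) ` topspace X)" by blast
    from finite_lists_length_eq[OF this, of n] show ?thesis
    proof (rule finite_subset[rotated])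
      show "cell d n ` topspace X \<subseteq> {xs. set xs \<subseteq> (\<Union>i<n. (\<lambda>p. \<lfloor>real (Suc n) * d i p\<rfloor>) ` topspace X) \<and> length xs = n}"
        unfolding cell_def by (auto simp del: of_nat_Suc) blast
    qed
  qed
  then obtain ks where ks: "set ks = cell d n ` topspace X" using finite_list by blast
  have "\<exists>v. \<bar>f x - real_of_rat v\<bar> < e/2" for x
  proof -
    obtain v where "f x - e/2 < real_of_rat v" "real_of_rat v < f x + e/2"
      using of_rat_dense[of "f x - e/2" "f x + e/2"] e by auto
    then show ?thesis by (intro exI[of _ v]) linarith
  qed
  then obtain v where v: "\<And>x. \<bar>f x - real_of_rat (v x)\<bar> < e/2" by metis
  define rep where "rep k = inv_into (topspace X) (cell d n) k" for k
  define al where "al = map (\<lambda>k. (k, v (rep k))) ks"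
  show ?thesis
  proof (intro exI[of _ "(n, al)"] ballI)
    fix p assume p: "p \<in> topspace X"
    let ?k = "cell d n p"
    have k: "?k \<in> set ks" using p ks by blast
    have "rep ?k \<in> topspace X" "cell d n (rep ?k) = ?k"
      using p by (auto simp: rep_def inv_into_into f_inv_into_f)
    then have "\<bar>f p - f (rep ?k)\<bar> < e/2" using n[OF p] by simp
    moreover have "step_function d (n, al) p = of_rat (v (rep ?k))"
      using k by (simp add: step_function_def al_def map_of_map_restrict)
    ultimately show "\<bar>f p - step_function d (n, al) p\<bar> \<le> e"
      using v[of "rep ?k"] by linarith
  qed
qed

text \<open>
  A measure \<open>\<mu>\<close> with \<open>\<mu> \<circ> P = \<mu>\<close> is determined by its values on \<open>S\<close>, and these are determined up to \<open>e\<close> by the values at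
  countably many step functions. There are enough such measures, namely \<open>f \<mapsto> P f x\<close> for all points \<open>x\<close>.
\<close>

theorem Cp_beta_no_complemented_separable:
  assumes S: "linear_subspace (Cp beta_nat) S" and compl: "complemented_in (Cp beta_nat) S"
    and sep: "separable_space (vtop (subspace_tvs (Cp beta_nat) S))"
  shows "\<not> infinite_dimensional (subspace_tvs (Cp beta_nat) S)"
proof -
  let ?E = "subspace_tvs (Cp beta_nat) S"
  let ?o = "vzero (Cp beta_nat)"
  have SC: "S \<subseteq> C_beta" using S by (simp add: linear_subspace_def)
  have carE: "vcarrier ?E = S" using SC by (auto simp: subspace_tvs_def)
  have opE: "vadd ?E = vadd (Cp beta_nat)" "vscale ?E = vscale (Cp beta_nat)" "vzero ?E = ?o"
    by (simp_all add: subspace_tvs_def)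
  obtain P where P: "linear_map (Cp beta_nat) (Cp beta_nat) P"
    "continuous_map (vtop (Cp beta_nat)) (vtop (Cp beta_nat)) P"
    "\<And>f. f \<in> C_beta \<Longrightarrow> P (P f) = P f" "P ` C_beta = S"
    using compl unfolding complemented_in_def by blast
  have PS: "P f \<in> S" if "f \<in> C_beta" for f using P(4) that by blast
  have PC: "P f \<in> C_beta" if "f \<in> C_beta" for f using PS[OF that] SC by blast
  obtain D where D: "countable D" "D \<subseteq> S" "vtop ?E closure_of D = S"
    using sep unfolding separable_space_def carE by blast
  have "D \<noteq> {}" using D(3) S by (auto simp: linear_subspace_def)
  define d where "d = from_nat_into D"
  have d: "range d = D" unfolding d_def by (rule range_from_nat_into[OF \<open>D \<noteq> {}\<close> D(1)])
  have dc: "continuous_map beta_nat euclideanreal (d i)" for i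
    using d D(2) SC by (intro continuous_C_beta) auto
  have S_clo: "S \<subseteq> vtop (Cp beta_nat) closure_of range d"
    using D(3) closure_of_subtopology_subset[of "vtop (Cp beta_nat)" S D] d by (simp add: subspace_tvs_def)
  have compact: "compact_space beta_nat" unfolding beta_nat_def by (rule compact_space_stone_cech)
  define M where "M = {a \<in> beta_measures. \<forall>f\<in>C_beta. pairing a (P f) = pairing a f}"
  have comp: "beta.setwise_compact M"
    unfolding beta.setwise_compact_def
  proof (intro allI impI)
    fix a :: "nat \<Rightarrow> ((nat \<Rightarrow> real) \<Rightarrow> real) \<Rightarrow> real"
    assume "\<forall>n. a n \<in> M \<and> variation (a n) UNIV \<le> 1"
    then have a: "a n \<in> M" "variation (a n) UNIV \<le> 1" "finite (msupp (a n))" "msupp (a n) \<subseteq> topspace beta_nat" for n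
      by (auto simp: M_def beta_measures_def)
    have bound: "\<bar>pairing (a n) g\<bar> \<le> K" if "\<And>p. p \<in> topspace beta_nat \<Longrightarrow> \<bar>g p\<bar> \<le> K" for n g K
    proof -
      have K0: "0 \<le> K" using that[OF nat_point_in_beta, of 0] by linarith
      have "\<bar>pairing (a n) g\<bar> \<le> K * variation (a n) UNIV" by (rule abs_pairing_le) (use that a(4)[of n] in blast)
      also have "\<dots> \<le> K" using a(2)[of n] K0 mult_left_mono[of "variation (a n) UNIV" 1 K] by simp
      finally show ?thesis .
    qed
    obtain r where r: "strict_mono (r :: nat \<Rightarrow> nat)" "\<And>s. s \<in> UNIV \<Longrightarrow> convergent (\<lambda>n. pairing (a (r n)) (step_function d s))"
    proof (rule pointwise_bounded_subsequence[of UNIV "\<lambda>n s. pairing (a n) (step_function d s)"])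
      show "\<exists>K. \<forall>n. \<bar>pairing (a n) (step_function d s)\<bar> \<le> K" for s
        using step_function_bounded[of d s] bound by metis
    qed (simp, rule that)
    have S_conv: "convergent (\<lambda>n. pairing (a (r n)) f)" if f: "f \<in> S" for f
    proof (rule convergent_if_approximable)
      fix e :: real assume e: "e > 0"
      obtain s where s: "\<And>p. p \<in> topspace beta_nat \<Longrightarrow> \<bar>f p - step_function d s p\<bar> \<le> e"
        using step_function_approximation[OF compact, of d f e] dc e f S_clo by blast
      have "pairing (a n) f - pairing (a n) (step_function d s) = pairing (a n) (\<lambda>p. f p - step_function d s p)" for n
        by (simp add: pairing_def right_diff_distrib sum_subtractf)
      then have "\<bar>pairing (a n) f - pairing (a n) (step_function d s)\<bar> \<le> e" for n
        using bound[OF s] by simp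
      then show "\<exists>h. convergent h \<and> (\<forall>n. \<bar>pairing (a (r n)) f - h n\<bar> \<le> e)" using r(2) by blast
    qed
    have "convergent (\<lambda>n. pairing (a (r n)) f)" if "f \<in> C_beta" for f
    proof -
      have "pairing (a (r n)) (P f) = pairing (a (r n)) f" for n
        using a(1)[of "r n"] that by (simp add: M_def)
      then show ?thesis using S_conv[OF PS[OF that]] by simp
    qed
    then show "\<exists>r. strict_mono r \<and> (\<forall>A. convergent (\<lambda>n. mass (a (r n)) (beta_hat A)))"
      using r(1) indicator_in_C_beta by (auto simp: mass_hat_eq_pairing[OF a(3,4)])
  qed
  have P0: "P ?o = ?o"
  proof -
    have "vscale (Cp beta_nat) 0 f = ?o" for f by (auto simp: vscale_Cp vzero_Cp)
    then show ?thesis using P(1) vzero_Cp_closed[of beta_nat] unfolding linear_map_def by metis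
  qed
  show ?thesis
  proof (rule finite_dimensional_if_setwise_compact[of ?E P M, OF _ _ _ _ _ _ comp])
    show "linear_map (Cp beta_nat) ?E P" using P(1,4) by (auto simp: linear_map_def opE carE)
    show "P ` C_beta = vcarrier ?E" using P(4) carE by simp
    show "P ?o = vzero ?E" using P0 opE by simp
    show "M \<subseteq> beta_measures" by (auto simp: M_def)
    show "(\<lambda>p. a p - b p) \<in> M" if "a \<in> M" "b \<in> M" for a b
      using that beta_measures_diff by (auto simp: M_def beta_measures_def pairing_diff)
    show "(\<lambda>p. c * a p) \<in> M" if "a \<in> M" for a c
      using that beta_measures_scale by (auto simp: M_def beta_measures_def pairing_scale)
    fix f assume f: "f \<in> C_beta" "\<And>a. a \<in> M \<Longrightarrow> pairing a f = 0"
    have "P f = ?o"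
    proof (rule Cp_eqI[OF PC[OF f(1)] vzero_Cp_closed])
      fix x assume x: "x \<in> topspace beta_nat"
      have "continuous_map (vtop (Cp beta_nat)) euclideanreal (\<lambda>f. P f x)"
        using continuous_map_compose[OF P(2) continuous_eval_Cp[OF x]] by (simp add: o_def)
      moreover have "P (vadd (Cp beta_nat) f (vscale (Cp beta_nat) c g)) x = P f x + c * P g x"
        if "f \<in> C_beta" "g \<in> C_beta" for f g c
        using P(1) that vscale_Cp_closed[OF that(2)] x by (simp add: linear_map_def vadd_vscale_Cp_apply)
      ultimately obtain a where a: "finite (msupp a)" "msupp a \<subseteq> topspace beta_nat"
        "\<And>f. f \<in> C_beta \<Longrightarrow> P f x = pairing a f"
        using continuous_functional_eq_pairing[of beta_nat "\<lambda>f. P f x"] by metis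
      have "pairing a (P g) = pairing a g" if "g \<in> C_beta" for g
        using a(3)[OF PC[OF that]] a(3)[OF that] P(3)[OF that] by simp
      then have "a \<in> M" using a(1,2) by (simp add: M_def beta_measures_def)
      then show "P f x = ?o x" using f a(3) x by (simp add: vzero_Cp)
    qed
    then show "P f = vzero ?E" using opE by simp
  qed
qed

theorem corollary2:
  shows "(\<exists>Z. closed_linear_subspace (Cp beta_nat) Z \<and>
            isomorphic_tvs (quotient_tvs (Cp beta_nat) Z) linf_space) \<and>
         (\<exists>S. linear_subspace (Cp beta_nat) S \<and>
            isomorphic_tvs (subspace_tvs (Cp beta_nat) S) c0_space) \<and>
         \<not> (\<exists>Z. closed_linear_subspace (Cp beta_nat) Z \<and>
            isomorphic_tvs (quotient_tvs (Cp beta_nat) Z) c0_space) \<and>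
         \<not> (\<exists>Z. closed_linear_subspace (Cp beta_nat) Z \<and>
            infinite_dimensional (quotient_tvs (Cp beta_nat) Z) \<and>
            polishable (quotient_tvs (Cp beta_nat) Z)) \<and>
         \<not> (\<exists>S. linear_subspace (Cp beta_nat) S \<and> complemented_in (Cp beta_nat) S \<and>
            separable_space (vtop (subspace_tvs (Cp beta_nat) S)) \<and>
            infinite_dimensional (subspace_tvs (Cp beta_nat) S))"
  using Cp_beta_quotient_linf Cp_beta_contains_c0 Cp_beta_no_quotient_c0
    Cp_beta_no_polishable_quotient Cp_beta_no_complemented_separable
  by blast

end
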